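(* Let $0<\varepsilon<\frac{1}{54}$ be fixed. For $x>1$ define $$W=W(x)=\sum_{\substack{1\le m_1<\sqrt{x}\\ 1\le m_2<\sqrt{x}}}\ \sum_{\substack{1\le q_1<\sqrt{x}+m_1\\ 1\le q_2<\sqrt{x}+m_2}}\ \#\Big\{(k_1,k_2)\in\mathbb{Z}_{>0}^2:\ |k_1-q_1|<2m_1,\ |k_2-q_2|<2m_2,\ m_1^2+k_1q_1=m_2^2+k_2q_2\le x\Big\},$$ where $m_1,m_2,q_1,q_2$ run over integers. Then, as $x\to+\infty$, $$W=c_0x^2+O\big(x^{2-1/54+\varepsilon}\big),\qquad c_0=\frac{13\,\zeta(2)}{14\,\zeta(3)}\,\mathfrak{S},$$ where $$\mathfrak{S}=\int_0^1du_1\int_0^1du_2\int_0^{1+u_1}dv_1\int_0^{1+u_2}\varphi(u_1,u_2,v_1,v_2)\,dv_2,$$ $$\varphi(u_1,u_2,v_1,v_2)=\frac{1}{v_1v_2}\max\Big(0,\ \min\big(1,(u_1+v_1)^2,(u_2+v_2)^2\big)-\max\big(u_1^2,u_2^2,(u_1-v_1)^2,(u_2-v_2)^2\big)\Big),$$ and the implied constant depends only on $\varepsilon$.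
   Context: $\zeta$ denotes the Riemann zeta function. The sum $W$ equals $\sum_{d\le x}g(d)^2$, where $g(d)$ is the number of pairs of integers $m,q\ge1$ with $m<\sqrt d$, $|q-\sqrt d|<m$, $q\mid d-m^2$ (writing $d=m^2+kq$ with $k\ge1$). *)

theory Defs
  imports "HOL-Analysis.Analysis" "HOL-Library.Landau_Symbols"
begin

definition zeta :: "real \<Rightarrow> real" where
  "zeta s = (\<Sum>n. 1 / (real (Suc n)) powr s)"

definition W_set :: "real \<Rightarrow> (int \<times> int \<times> int \<times> int \<times> int \<times> int) set" where
  "W_set x = {(m1, m2, q1, q2, k1, k2).
     1 \<le> m1 \<and> real_of_int m1 < sqrt x \<and> 1 \<le> m2 \<and> real_of_int m2 < sqrt x \<and>
     1 \<le> q1 \<and> real_of_int q1 < sqrt x + real_of_int m1 \<and>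
     1 \<le> q2 \<and> real_of_int q2 < sqrt x + real_of_int m2 \<and>
     0 < k1 \<and> 0 < k2 \<and> \<bar>k1 - q1\<bar> < 2 * m1 \<and> \<bar>k2 - q2\<bar> < 2 * m2 \<and>
     m1^2 + k1 * q1 = m2^2 + k2 * q2 \<and> real_of_int (m1^2 + k1 * q1) \<le> x}"

definition W :: "real \<Rightarrow> real" where
  "W x = real (card (W_set x))"

definition phi :: "real \<Rightarrow> real \<Rightarrow> real \<Rightarrow> real \<Rightarrow> real" where
  "phi u1 u2 v1 v2 = (1 / (v1 * v2)) *
     max 0 (min 1 (min ((u1 + v1)^2) ((u2 + v2)^2))
            - max (max (u1^2) (u2^2)) (max ((u1 - v1)^2) ((u2 - v2)^2)))"

definition singular_S :: real where
  "singular_S = (LBINT u1=0..1. (LBINT u2=0..1. (LBINT v1=0..ereal (1 + u1).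
                   (LBINT v2=0..ereal (1 + u2). phi u1 u2 v1 v2))))"

definition c0 :: real where
  "c0 = 13 * zeta 2 / (14 * zeta 3) * singular_S"

end

theory Submission
  imports Defs "HOL-Number_Theory.Totient"
begin


text \<open>
  Put \<open>a = m1 - m2\<close>. For fixed \<open>a\<close>, \<open>q1\<close>, \<open>q2\<close> the equation \<open>m1\<^sup>2 + k1 q1 = m2\<^sup>2 + k2 q2\<close> becomes the linear
  congruence \<open>2 a m2 + q1 k1 + a\<^sup>2 \<equiv> 0\<close> modulo \<open>q2\<close>, so that the solutions \<open>(m2, k1)\<close> form either the empty set
  or a coset of a plane lattice of index \<open>q2 / G\<close> with \<open>G = gcd (2 a, q1, q2)\<close>; they exist iff \<open>G\<close> divides \<open>a\<^sup>2\<close>.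
  Translates of a system of representatives of the lattice inside a box of side \<open>\<rho>\<close> tile the plane, so
  the number of solutions in a region is its area times \<open>G / q2\<close>, up to the area of a \<open>\<rho>\<close>-neighbourhood of the
  boundary. If the lattice contains no nonzero vector with coordinates at most \<open>X\<close>, then the pigeonhole
  principle, applied to two complementary boxes, yields two independent vectors of size about \<open>q2 / X\<close>, and \<open>\<rho>\<close> may be taken of this size.
  The exceptional triples \<open>(a, q1, q2)\<close> lie on few planes \<open>2 a r + q1 t = q2 s\<close>, and the trivial choice
  \<open>\<rho> = q2\<close> suffices to bound their contribution.

  It remains to sum \<open>G [G dvd a\<^sup>2]\<close> against the function \<^const>\<open>phi\<close>. Expanding the weight by means of
  \<open>gcd = \<Sum> totient\<close> reduces this to Riemann sums over arithmetic progressions. The density of the weight is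
  \<open>\<Sum> totient(n) w(n) / n\<^sup>3\<close> with \<open>w\<close> depending only on the residue of \<open>n\<close> modulo 4, and
  \<open>\<Sum> totient(n) / n\<^sup>3 = zeta 2 / zeta 3\<close>. Taking \<open>x = y^50\<close> and \<open>X\<close>, the truncation point of the totient expansion and the
  threshold for small \<open>q_i\<close> as suitable powers of \<open>y\<close> makes every error \<open>O(y^99) = O(x powr (2 - 1/50))\<close>.
\<close>

section \<open>Counting points of a lattice coset\<close>

text \<open>The obstacle is small \<open>q1\<close>, \<open>q2\<close>: there \<open>phi\<close> is
  unbounded, and the boundary error of the lattice count, of order N^2 \<rho> G / (q1 q2), is too
  large. They are cut off at Q = \<kappa> B. The cut is affordable because the admissible values d
  fill an interval of length at most 4 m_i q_i for both i; geometric means give densities O(1 / sqrt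
  (q1 q2)), so the discarded part has relative size only \<kappa>^(1/2). Relative to B^4 the
  competing errors are \<kappa>^(1/2) from the cut-off, 1 / (X \<kappa>^2) from the boundaries, D
  X^3 / (B \<kappa>^2) from exceptional triples with G at most D, and 1 / (\<kappa> D) from larger
  G. With B = y^25, \<kappa> = y^(-2) and X = D = y^5 the first three all equal 1 / y and the last
  is smaller; this balance is the origin of the exponents. Large values of G are harmless on
  average: each of 2 a, q1, q2 is divisible by g with density about 1 / g, so the weight g leaves
  the convergent series of 1 / g^2.\<close>

lemma small_vector_exists:
  fixes A C q P X :: int
  assumes q: "q > 0" and P: "P \<ge> 0" and X: "X \<ge> 0" and big: "(P + 1) * (X + 1) > q"
  shows "\<exists>r t. (r \<noteq> 0 \<or> t \<noteq> 0) \<and> \<bar>r\<bar> \<le> P \<and> \<bar>t\<bar> \<le> X \<and> q dvd A * r + C * t"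
proof -
  let ?f = "\<lambda>(r, t). (A * r + C * t) mod q"
  let ?R = "{0..P} \<times> {0..X}"
  have "?f ` ?R \<subseteq> {0..<q}" using q by auto
  then have "card (?f ` ?R) \<le> card {0..<q}" by (intro card_mono) auto
  also have "\<dots> = nat q" by simp
  also have "\<dots> < nat ((P + 1) * (X + 1))" using big q by simp
  also have "\<dots> = card ?R" using P X by (simp add: card_cartesian_product nat_mult_distrib)
  finally have "\<not> inj_on ?f ?R" by (rule pigeonhole)
  then obtain r t r' t' where h: "r \<in> {0..P}" "t \<in> {0..X}" "r' \<in> {0..P}" "t' \<in> {0..X}"
     "(r, t) \<noteq> (r', t')" "(A * r + C * t) mod q = (A * r' + C * t') mod q"
    unfolding inj_on_def by auto
  have "q dvd (A * r + C * t) - (A * r' + C * t')" using h(6) by (simp add: mod_eq_dvd_iff)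
  then have "q dvd A * (r - r') + C * (t - t')" by (simp add: algebra_simps)
  moreover have "r - r' \<noteq> 0 \<or> t - t' \<noteq> 0" using h by auto
  moreover have "\<bar>r - r'\<bar> \<le> P" "\<bar>t - t'\<bar> \<le> X" using h by auto
  ultimately show ?thesis by blast
qed

text \<open>The two vectors need only be independent, not a basis. Cramer's rule writes (M, K) as s
  v1 + t v2 with real s, t; subtracting the integer parts leaves frac s v1 + frac t v2, whose
  coordinates are at most 2 P in size.\<close>

lemma representatives_from_independent_vectors:
  fixes A C q P :: int
  assumes v1: "q dvd A * r1 + C * t1" and v2: "q dvd A * r2 + C * t2"
    and det: "r1 * t2 - r2 * t1 \<noteq> 0"
    and bd: "\<bar>r1\<bar> \<le> P" "\<bar>t1\<bar> \<le> P" "\<bar>r2\<bar> \<le> P" "\<bar>t2\<bar> \<le> P"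
  shows "\<exists>u v. \<bar>u\<bar> \<le> 2 * P \<and> \<bar>v\<bar> \<le> 2 * P \<and> q dvd A * (M - u) + C * (K - v)"
proof -
  define d where "d = real_of_int (r1 * t2 - r2 * t1)"
  have d0: "d \<noteq> 0" using det unfolding d_def by (metis of_int_eq_0_iff)
  define s where "s = (M * t2 - K * r2) / d"
  define t where "t = (r1 * K - t1 * M) / d"
  have "s * r1 + t * r2 = M * d / d"
    unfolding s_def t_def d_def by (simp add: field_simps add_divide_distrib [symmetric] diff_divide_distrib [symmetric])
  then have Ms: "s * r1 + t * r2 = M" using d0 by simp
  have "s * t1 + t * t2 = K * d / d"
    unfolding s_def t_def d_def by (simp add: field_simps add_divide_distrib [symmetric] diff_divide_distrib [symmetric])
  then have Ks: "s * t1 + t * t2 = K" using d0 by simp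
  define u where "u = M - \<lfloor>s\<rfloor> * r1 - \<lfloor>t\<rfloor> * r2"
  define v where "v = K - \<lfloor>s\<rfloor> * t1 - \<lfloor>t\<rfloor> * t2"
  have fr: "\<bar>frac s * real_of_int a + frac t * real_of_int b\<bar> \<le> 2 * P"
    if "\<bar>a\<bar> \<le> P" "\<bar>b\<bar> \<le> P" for a b
  proof -
    have "\<bar>frac s * real_of_int a\<bar> \<le> 1 * real_of_int P"
      unfolding abs_mult using that frac_lt_1[of s] frac_ge_0[of s]
      by (intro mult_mono) (auto simp: le_less simp flip: of_int_abs)
    moreover have "\<bar>frac t * real_of_int b\<bar> \<le> 1 * real_of_int P"
      unfolding abs_mult using that frac_lt_1[of t] frac_ge_0[of t]
      by (intro mult_mono) (auto simp: le_less simp flip: of_int_abs)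
    ultimately show ?thesis by linarith
  qed
  have "real_of_int u = frac s * r1 + frac t * r2"
    unfolding u_def frac_def using Ms by (simp add: algebra_simps)
  then have "\<bar>real_of_int u\<bar> \<le> 2 * P" using fr[of r1 r2] bd by simp
  then have u: "\<bar>u\<bar> \<le> 2 * P" by linarith
  have "real_of_int v = frac s * t1 + frac t * t2"
    unfolding v_def frac_def using Ks by (simp add: algebra_simps)
  then have "\<bar>real_of_int v\<bar> \<le> 2 * P" using fr[of t1 t2] bd by simp
  then have v: "\<bar>v\<bar> \<le> 2 * P" by linarith
  have "A * (M - u) + C * (K - v) = \<lfloor>s\<rfloor> * (A * r1 + C * t1) + \<lfloor>t\<rfloor> * (A * r2 + C * t2)"
    unfolding u_def v_def by (simp add: algebra_simps)
  moreover have "q dvd \<dots>" using v1 v2 by simp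
  ultimately have "q dvd A * (M - u) + C * (K - v)" by simp
  with u v show ?thesis by blast
qed

text \<open>Pigeonhole in the boxes P x X and X x P gives two vectors. Neither fits into the X x X
  box, so |r1| > X and |t2| > X, while |t1| and |r2| are at most X; hence |r1 t2| exceeds |r2 t1|
  and the determinant is nonzero. \<open>q div (X + 1)\<close> is the least P with (P + 1) (X + 1) >
  q.\<close>

lemma representatives_of_no_small_vector:
  fixes A C q X :: int
  assumes q: "q > 0" and X: "X \<ge> 0"
    and no: "\<And>r t. \<bar>r\<bar> \<le> X \<Longrightarrow> \<bar>t\<bar> \<le> X \<Longrightarrow> q dvd A * r + C * t \<Longrightarrow> r = 0 \<and> t = 0"
  shows "\<exists>u v. \<bar>u\<bar> \<le> 2 * max X (q div (X + 1)) \<and> \<bar>v\<bar> \<le> 2 * max X (q div (X + 1)) \<and>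
           q dvd A * (M - u) + C * (K - v)"
proof -
  define P where "P = q div (X + 1)"
  have P: "P \<ge> 0" unfolding P_def using q X by (simp add: pos_imp_zdiv_nonneg_iff)
  have "q = (X + 1) * (q div (X + 1)) + q mod (X + 1)" by simp
  moreover have "q mod (X + 1) < X + 1" using X by (intro pos_mod_bound) simp
  ultimately have "q < (X + 1) * P + (X + 1)" unfolding P_def by linarith
  then have big: "(P + 1) * (X + 1) > q" "(X + 1) * (P + 1) > q" by (simp_all add: algebra_simps)
  obtain r1 t1 where v1: "r1 \<noteq> 0 \<or> t1 \<noteq> 0" "\<bar>r1\<bar> \<le> P" "\<bar>t1\<bar> \<le> X" "q dvd A * r1 + C * t1"
    using small_vector_exists[OF q P X big(1)] by blast
  obtain r2 t2 where v2: "r2 \<noteq> 0 \<or> t2 \<noteq> 0" "\<bar>r2\<bar> \<le> X" "\<bar>t2\<bar> \<le> P" "q dvd A * r2 + C * t2"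
    using small_vector_exists[OF q X P big(2)] by blast
  have a: "\<bar>r1\<bar> > X" using no[of r1 t1] v1 by force
  have b: "\<bar>t2\<bar> > X" using no[of r2 t2] v2 by force
  have "\<bar>r2 * t1\<bar> \<le> X * X" unfolding abs_mult using v1 v2 X by (intro mult_mono) auto
  also have "\<dots> < \<bar>r1 * t2\<bar>" unfolding abs_mult using a b X by (intro mult_strict_mono') auto
  finally have "r1 * t2 - r2 * t1 \<noteq> 0" by auto
  then show ?thesis
    using representatives_from_independent_vectors[OF v1(4) v2(4), of "max X P" M K] v1 v2
    unfolding P_def[symmetric] by (simp add: le_max_iff_disj)
qed

text \<open>Modulo q the form A m + C k takes exactly the multiples of g = gcd(A, C, q), that is n
  values. To each j below n belongs a shift (U j, V j) on which the form is congruent to g j. The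
  shifted solution sets have different residues, so they are disjoint; as g divides c, they exhaust
  all residues and so cover the plane.\<close>

lemma coset_tiles:
  fixes A C c q :: int
  assumes q: "q > 0" and G: "gcd (gcd A C) q dvd c" and n: "n = q div gcd (gcd A C) q"
    and reps: "\<And>M K. \<exists>u v. \<bar>u\<bar> \<le> \<rho> \<and> \<bar>v\<bar> \<le> \<rho> \<and> q dvd A * (M - u) + C * (K - v)"
  obtains U V :: "int \<Rightarrow> int" where
    "\<And>j. \<bar>U j\<bar> \<le> \<rho> \<and> \<bar>V j\<bar> \<le> \<rho>"
    "\<And>m k j m' k' j'. q dvd A * m + C * k + c \<Longrightarrow> q dvd A * m' + C * k' + c \<Longrightarrow>
       j \<in> {0..<n} \<Longrightarrow> j' \<in> {0..<n} \<Longrightarrow> (m + U j, k + V j) = (m' + U j', k' + V j') \<Longrightarrow>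
       j = j' \<and> m = m' \<and> k = k'"
    "\<And>m k. \<exists>j\<in>{0..<n}. q dvd A * (m - U j) + C * (k - V j) + c"
proof -
  define g where "g = gcd (gcd A C) q"
  have g0: "g > 0" unfolding g_def using q by simp
  have qn: "q = g * n" unfolding n g_def by simp
  have n0: "n > 0" using q g0 qn by (simp add: zero_less_mult_iff)
  obtain x y where xy: "x * A + y * C = gcd A C" using bezout_int by blast
  obtain z w where zw: "z * gcd A C + w * q = g" unfolding g_def using bezout_int by blast
  have ex: "\<exists>u v. \<bar>u\<bar> \<le> \<rho> \<and> \<bar>v\<bar> \<le> \<rho> \<and> q dvd A * u + C * v - g * j" for j
  proof -
    \<comment> \<open>By Bezout the form is congruent to g j at the point (j z x, j z y), which
      \<open>reps\<close> moves into the \<rho>-box.\<close>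
    obtain u v where uv: "\<bar>u\<bar> \<le> \<rho>" "\<bar>v\<bar> \<le> \<rho>" "q dvd A * (j * z * x - u) + C * (j * z * y - v)"
      using reps by blast
    have "A * u + C * v - g * j = - (A * (j * z * x - u) + C * (j * z * y - v)) - q * (w * j)"
      by (simp add: zw[symmetric] xy[symmetric] algebra_simps)
    moreover have "q dvd \<dots>" by (intro dvd_diff) (use uv(3) dvd_minus_iff in \<open>blast, simp\<close>)
    ultimately show ?thesis using uv by metis
  qed
  then obtain U V where UV: "\<And>j. \<bar>U j\<bar> \<le> \<rho> \<and> \<bar>V j\<bar> \<le> \<rho> \<and> q dvd A * U j + C * V j - g * j"
    by metis
  show thesis
  proof
    show "\<bar>U j\<bar> \<le> \<rho> \<and> \<bar>V j\<bar> \<le> \<rho>" for j using UV by blast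
  next
    fix m k j m' k' j'
    assume h: "q dvd A * m + C * k + c" "q dvd A * m' + C * k' + c"
       "j \<in> {0..<n}" "j' \<in> {0..<n}" "(m + U j, k + V j) = (m' + U j', k' + V j')"
    have "g * (j - j') = (A * U j' + C * V j' - g * j') - (A * U j + C * V j - g * j)
        + ((A * m' + C * k' + c) - (A * m + C * k + c)) + (A * (m + U j - (m' + U j')) + C * (k + V j - (k' + V j')))"
      by (simp add: algebra_simps)
    also have "\<dots> = (A * U j' + C * V j' - g * j') - (A * U j + C * V j - g * j)
        + ((A * m' + C * k' + c) - (A * m + C * k + c))" using h(5) by simp
    also have "q dvd \<dots>"
      by (rule dvd_add[OF dvd_diff dvd_diff]) (use UV[of j] UV[of j'] h(1,2) in blast)+
    finally have "n dvd j - j'" unfolding qn using g0 by simp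
    moreover have "\<bar>j - j'\<bar> < n" using h(3,4) by auto
    ultimately have "j = j'" using zdvd_not_zless[of "\<bar>j - j'\<bar>" n] by fastforce
    then show "j = j' \<and> m = m' \<and> k = k'" using h(5) by simp
  next
    fix m k
    have "g dvd A" "g dvd C" unfolding g_def by (meson dvd_trans gcd_dvd1 gcd_dvd2)+
    then have "g dvd A * m + C * k + c" using G unfolding g_def by (intro dvd_add) auto
    then obtain w' where w': "A * m + C * k + c = g * w'" by (elim dvdE)
    let ?j = "w' mod n"
    have "A * (m - U ?j) + C * (k - V ?j) + c = g * (w' - w' mod n) - (A * U ?j + C * V ?j - g * ?j)"
      using w' by (simp add: algebra_simps)
    moreover have "q dvd g * (w' - w' mod n)" unfolding qn by (simp add: minus_mod_eq_mult_div)
    ultimately have "q dvd A * (m - U ?j) + C * (k - V ?j) + c" using UV[of ?j] by (metis dvd_diff)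
    moreover have "?j \<in> {0..<n}" using n0 by simp
    ultimately show "\<exists>j\<in>{0..<n}. q dvd A * (m - U j) + C * (k - V j) + c" by blast
  qed
qed

text \<open>Every solution in S spreads to n points of S' under the shifts, and all these points are
  distinct. If the gcd does not divide c there is no solution at all.\<close>

lemma coset_count_upper:
  fixes A C c q :: int
  assumes q: "q > 0" and n: "n = q div gcd (gcd A C) q"
    and reps: "\<And>M K. \<exists>u v. \<bar>u\<bar> \<le> \<rho> \<and> \<bar>v\<bar> \<le> \<rho> \<and> q dvd A * (M - u) + C * (K - v)"
    and S': "finite S'" "\<And>m k u v. (m, k) \<in> S \<Longrightarrow> \<bar>u\<bar> \<le> \<rho> \<Longrightarrow> \<bar>v\<bar> \<le> \<rho> \<Longrightarrow> (m + u, k + v) \<in> S'"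
  shows "n * int (card {(m, k). (m, k) \<in> S \<and> q dvd A * m + C * k + c}) \<le> int (card S')"
proof (cases "gcd (gcd A C) q dvd c")
  case True
  let ?L = "{(m, k). (m, k) \<in> S \<and> q dvd A * m + C * k + c}"
  obtain U V where UV: "\<And>j. \<bar>U j\<bar> \<le> \<rho> \<and> \<bar>V j\<bar> \<le> \<rho>"
    "\<And>m k j m' k' j'. q dvd A * m + C * k + c \<Longrightarrow> q dvd A * m' + C * k' + c \<Longrightarrow>
       j \<in> {0..<n} \<Longrightarrow> j' \<in> {0..<n} \<Longrightarrow> (m + U j, k + V j) = (m' + U j', k' + V j') \<Longrightarrow>
       j = j' \<and> m = m' \<and> k = k'"
    using coset_tiles[OF q True n reps] by (metis (no_types, lifting))
  let ?f = "\<lambda>((m, k), j). (m + U j, k + V j)"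
  have inj: "inj_on ?f (?L \<times> {0..<n})"
    unfolding inj_on_def using UV(2) by clarsimp
  have sub: "?f ` (?L \<times> {0..<n}) \<subseteq> S'" using UV(1) S'(2) by auto
  have "nat n * card ?L = card (?L \<times> {0..<n})" by (simp add: card_cartesian_product)
  also have "\<dots> \<le> card S'" using card_inj_on_le[OF inj sub S'(1)] .
  finally have "int (nat n * card ?L) \<le> int (card S')" by linarith
  moreover have "n \<ge> 0" unfolding n using q by (simp add: pos_imp_zdiv_nonneg_iff)
  ultimately show ?thesis by simp
next
  case False
  have "\<not> q dvd A * m + C * k + c" for m k
  proof
    assume "q dvd A * m + C * k + c"
    then have "gcd (gcd A C) q dvd A * m + C * k + c" by (meson dvd_trans gcd_dvd2)
    moreover have "gcd (gcd A C) q dvd A * m + C * k" by (meson dvd_add dvd_mult2 dvd_trans gcd_dvd1 gcd_dvd2)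
    ultimately show False using False dvd_add_right_iff by blast
  qed
  then show ?thesis by simp
qed

text \<open>Every point of S' is a solution in S moved by one of the n shifts, so the shifted
  solutions cover S'.\<close>

lemma coset_count_lower:
  fixes A C c q :: int
  assumes q: "q > 0" and G: "gcd (gcd A C) q dvd c" and n: "n = q div gcd (gcd A C) q"
    and reps: "\<And>M K. \<exists>u v. \<bar>u\<bar> \<le> \<rho> \<and> \<bar>v\<bar> \<le> \<rho> \<and> q dvd A * (M - u) + C * (K - v)"
    and S': "finite S" "\<And>m k u v. (m, k) \<in> S' \<Longrightarrow> \<bar>u\<bar> \<le> \<rho> \<Longrightarrow> \<bar>v\<bar> \<le> \<rho> \<Longrightarrow> (m - u, k - v) \<in> S"
  shows "int (card S') \<le> n * int (card {(m, k). (m, k) \<in> S \<and> q dvd A * m + C * k + c})"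
proof -
  let ?L = "{(m, k). (m, k) \<in> S \<and> q dvd A * m + C * k + c}"
  obtain U V where UV: "\<And>j. \<bar>U j\<bar> \<le> \<rho> \<and> \<bar>V j\<bar> \<le> \<rho>"
    "\<And>m k. \<exists>j\<in>{0..<n}. q dvd A * (m - U j) + C * (k - V j) + c"
    using coset_tiles[OF q G n reps] by (metis (no_types, lifting))
  let ?f = "\<lambda>((m, k), j). (m + U j, k + V j)"
  have fin: "finite (?L \<times> {0..<n})" using S'(1) by (auto intro: finite_subset[of _ S])
  have "S' \<subseteq> ?f ` (?L \<times> {0..<n})"
  proof
    fix z assume z: "z \<in> S'"
    obtain m k where mk: "z = (m, k)" by (cases z)
    obtain j where j: "j \<in> {0..<n}" "q dvd A * (m - U j) + C * (k - V j) + c" using UV(2) by blast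
    have "(m - U j, k - V j) \<in> S" using S'(2) z mk UV(1) by blast
    then have "((m - U j, k - V j), j) \<in> ?L \<times> {0..<n}" using j by simp
    moreover have "z = ?f ((m - U j, k - V j), j)" using mk by simp
    ultimately show "z \<in> ?f ` (?L \<times> {0..<n})" by blast
  qed
  then have "card S' \<le> card (?L \<times> {0..<n})" using fin by (meson card_image_le card_mono finite_imageI le_trans)
  also have "\<dots> = nat n * card ?L" by (simp add: card_cartesian_product)
  finally have "int (card S') \<le> int (nat n * card ?L)" by linarith
  moreover have "n \<ge> 0" unfolding n using q by (simp add: pos_imp_zdiv_nonneg_iff)
  ultimately show ?thesis by simp
qed

lemma representatives_trivial:
  fixes A C q :: int
  assumes "q > 0"
  shows "\<exists>u v. \<bar>u\<bar> \<le> q \<and> \<bar>v\<bar> \<le> q \<and> q dvd A * (M - u) + C * (K - v)"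
proof (intro exI conjI)
  show "\<bar>M mod q\<bar> \<le> q" "\<bar>K mod q\<bar> \<le> q" using assms by (simp_all add: order.strict_implies_order)
  show "q dvd A * (M - M mod q) + C * (K - K mod q)" by (simp add: minus_mod_eq_mult_div)
qed


section \<open>Decomposition into fibres over (a, q1, q2)\<close>

definition lo :: "int \<Rightarrow> int \<Rightarrow> int \<Rightarrow> int \<Rightarrow> int" where
  "lo m1 m2 q1 q2 = max (max (m1^2) (m2^2)) (max ((q1 - m1)^2) ((q2 - m2)^2))"

definition up :: "real \<Rightarrow> int \<Rightarrow> int \<Rightarrow> int \<Rightarrow> int \<Rightarrow> real" where
  "up B m1 m2 q1 q2 = min (B^2) (min (of_int ((m1 + q1)^2)) (of_int ((m2 + q2)^2)))"

definition width :: "real \<Rightarrow> int \<Rightarrow> int \<Rightarrow> int \<Rightarrow> int \<Rightarrow> real" where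
  "width B m1 m2 q1 q2 = max 0 (up B m1 m2 q1 q2 - of_int (lo m1 m2 q1 q2))"

text \<open>With \<open>a = m1 - m2\<close> and \<open>m = m2\<close>, the common value \<open>d = m1\<^sup>2 + k1 q1\<close> of a solution is constrained
  only by \<open>lo < d < (m_i + q_i)\<^sup>2\<close> and \<open>d \<le> B\<^sup>2\<close>, where \<open>B = sqrt x\<close>: the remaining inequalities of
  \<^const>\<open>W_set\<close>, including the positivity of \<open>m1\<close> and \<open>m2\<close>, follow from these. The variable \<open>k\<close> is \<open>k1\<close>, and \<open>k2\<close>
  is eliminated by the congruence modulo \<open>q2\<close> in \<open>T\<close>.\<close>

definition Reg :: "real \<Rightarrow> int \<Rightarrow> int \<Rightarrow> int \<Rightarrow> (int \<times> int) set" where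
  "Reg B a q1 q2 = {(m, k). lo (m + a) m q1 q2 < (m + a)^2 + k * q1 \<and>
     (m + a)^2 + k * q1 < (m + a + q1)^2 \<and> (m + a)^2 + k * q1 < (m + q2)^2 \<and>
     real_of_int ((m + a)^2 + k * q1) \<le> B^2}"

definition T :: "real \<Rightarrow> int \<Rightarrow> int \<Rightarrow> int \<Rightarrow> nat" where
  "T B a q1 q2 = card {(m, k). (m, k) \<in> Reg B a q1 q2 \<and> q2 dvd (2 * a) * m + q1 * k + a^2}"

definition Fib :: "real \<Rightarrow> int \<Rightarrow> int \<Rightarrow> int \<Rightarrow> (int \<times> int \<times> int \<times> int \<times> int \<times> int) set" where
  "Fib B a q1 q2 = {(m1, m2, r1, r2, k1, k2). (m1, m2, r1, r2, k1, k2) \<in> W_set (B^2) \<and>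
     r1 = q1 \<and> r2 = q2 \<and> m1 - m2 = a}"

definition G :: "int \<Rightarrow> int \<Rightarrow> int \<Rightarrow> int" where
  "G a q1 q2 = gcd (gcd (2 * a) q1) q2"

text \<open>With d = m^2 + k q the differences factor as d - (q - m)^2 = q (k + 2 m - q) and (m +
  q)^2 - d = q (q + 2 m - k), which turns |k - q| < 2 m into bounds on d. Adding the two positive
  factors gives 4 m > 0.\<close>

lemma pair_conditions_iff:
  fixes m q k :: int
  assumes q: "q \<ge> 1"
  shows "1 \<le> m \<and> 0 < k \<and> \<bar>k - q\<bar> < 2 * m \<longleftrightarrow>
         m^2 < m^2 + k * q \<and> (q - m)^2 < m^2 + k * q \<and> m^2 + k * q < (m + q)^2"
proof -
  have 1: "m^2 < m^2 + k * q \<longleftrightarrow> 0 < k" using q by (simp add: zero_less_mult_iff)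
  have "(q - m)^2 < m^2 + k * q \<longleftrightarrow> q * 0 < q * (k + 2 * m - q)"
    by (simp add: power2_eq_square algebra_simps)
  also have "\<dots> \<longleftrightarrow> 0 < k + 2 * m - q" using q by (subst mult_less_cancel_left_pos) auto
  finally have 2: "(q - m)^2 < m^2 + k * q \<longleftrightarrow> 0 < k + 2 * m - q" .
  have "m^2 + k * q < (m + q)^2 \<longleftrightarrow> q * 0 < q * (q + 2 * m - k)"
    by (simp add: power2_eq_square algebra_simps)
  also have "\<dots> \<longleftrightarrow> 0 < q + 2 * m - k" using q by (subst mult_less_cancel_left_pos) auto
  finally have 3: "m^2 + k * q < (m + q)^2 \<longleftrightarrow> 0 < q + 2 * m - k" .
  show ?thesis unfolding 1 2 3 by auto
qed

lemma mem_W_set_iff: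
  fixes B :: real
  assumes B: "B > 0"
  shows "(m1, m2, q1, q2, k1, k2) \<in> W_set (B^2) \<longleftrightarrow>
    1 \<le> q1 \<and> 1 \<le> q2 \<and> m1^2 + k1 * q1 = m2^2 + k2 * q2 \<and>
    lo m1 m2 q1 q2 < m1^2 + k1 * q1 \<and> m1^2 + k1 * q1 < (m1 + q1)^2 \<and>
    m1^2 + k1 * q1 < (m2 + q2)^2 \<and> real_of_int (m1^2 + k1 * q1) \<le> B^2" (is "?L \<longleftrightarrow> ?R")
proof
  assume L: ?L
  then show ?R
    using pair_conditions_iff[of q1 m1 k1] pair_conditions_iff[of q2 m2 k2]
    unfolding W_set_def lo_def by (auto simp del: of_int_add of_int_mult of_int_power)
next
  assume R: ?R
  \<comment> \<open>Since d is at most B^2, an integer whose square lies below d is below B; for q_i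
    - m_i this yields q_i < B + m_i.\<close>
  have sq: "m < B" if "m^2 < m1^2 + k1 * q1" for m :: int
  proof (rule power2_less_imp_less)
    have "(real_of_int m)^2 = real_of_int (m^2)" by simp
    also have "\<dots> < real_of_int (m1^2 + k1 * q1)" using that by (simp only: of_int_less_iff)
    also have "\<dots> \<le> B^2" using R by blast
    finally show "(real_of_int m)^2 < B^2" .
  qed (use B in simp)
  have "real_of_int m1 < B" "real_of_int m2 < B" "real_of_int (q1 - m1) < B" "real_of_int (q2 - m2) < B"
    by (intro sq; use R in \<open>simp add: lo_def\<close>)+
  then show ?L using R B
      pair_conditions_iff[of q1 m1 k1] pair_conditions_iff[of q2 m2 k2]
    unfolding W_set_def lo_def by (auto simp del: of_int_add of_int_mult of_int_power)
qed

lemma bij_betw_Fib: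
  assumes B: "B > 0" and q: "1 \<le> q1" "1 \<le> q2"
  shows "bij_betw (\<lambda>(m, k). (m + a, m, q1, q2, k, ((2 * a) * m + q1 * k + a^2) div q2))
    {(m, k). (m, k) \<in> Reg B a q1 q2 \<and> q2 dvd (2 * a) * m + q1 * k + a^2} (Fib B a q1 q2)"
    (is "bij_betw ?f ?L _")
proof (rule bij_betwI')
  fix x y assume "x \<in> ?L" "y \<in> ?L"
  then show "(?f x = ?f y) = (x = y)" by auto
next
  fix x assume x: "x \<in> ?L"
  obtain m k where mk: "x = (m, k)" by (cases x)
  define k2 where "k2 = ((2 * a) * m + q1 * k + a^2) div q2"
  have "q2 * k2 = (2 * a) * m + q1 * k + a^2" unfolding k2_def using x mk by simp
  then have "(m + a)^2 + k * q1 = m^2 + k2 * q2"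
    by (simp add: power2_eq_square algebra_simps)
  then have "(m + a, m, q1, q2, k, k2) \<in> Fib B a q1 q2" using x q unfolding mk Fib_def
    by (simp add: mem_W_set_iff[OF B] Reg_def del: of_int_add of_int_mult of_int_power)
  then show "?f x \<in> Fib B a q1 q2" unfolding mk k2_def by simp
next
  fix y assume y: "y \<in> Fib B a q1 q2"
  then obtain m2 k1 k2 where mk: "y = (m2 + a, m2, q1, q2, k1, k2)"
    unfolding Fib_def by (auto simp: algebra_simps)
  have h: "(m2 + a)^2 + k1 * q1 = m2^2 + k2 * q2" using y unfolding mk Fib_def by (auto simp: mem_W_set_iff[OF B])
  then have e: "(2 * a) * m2 + q1 * k1 + a^2 = k2 * q2" by (simp add: power2_eq_square algebra_simps)
  have "(m2, k1) \<in> ?L" using y e unfolding mk Fib_def by (auto simp: mem_W_set_iff[OF B] Reg_def)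
  moreover have "y = ?f (m2, k1)" unfolding mk using e q by simp
  ultimately show "\<exists>x\<in>?L. y = ?f x" by blast
qed

lemma card_Fib:
  assumes "B > 0" "1 \<le> q1" "1 \<le> q2"
  shows "card (Fib B a q1 q2) = T B a q1 q2"
  using bij_betw_same_card[OF bij_betw_Fib[OF assms]] unfolding T_def by simp

text \<open>The congruence modulo q2 breaks the symmetry between the two representations of d;
  exchanging them restores it and turns estimates in q2 into estimates in q1.\<close>

lemma T_swap:
  assumes B: "B > 0" and q: "1 \<le> q1" "1 \<le> q2"
  shows "T B (- a) q2 q1 = T B a q1 q2"
proof -
  let ?f = "\<lambda>(m1, m2, q1, q2, k1, k2). (m2, m1, q2, q1, k2, k1)"
  have "bij_betw ?f (Fib B a q1 q2) (Fib B (- a) q2 q1)"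
    by (rule bij_betw_byWitness[where f' = ?f]) (auto simp: Fib_def W_set_def simp del: of_int_add of_int_mult of_int_power)
  then have "card (Fib B a q1 q2) = card (Fib B (- a) q2 q1)" by (rule bij_betw_same_card)
  then show ?thesis using card_Fib[OF B] q by simp
qed

lemma Reg_bounds:
  assumes B: "B > 0" and q: "1 \<le> q1" "1 \<le> q2" and mk: "(m, k) \<in> Reg B a q1 q2"
  shows "1 \<le> m" "1 \<le> m + a" "m < B" "m + a < B" "1 \<le> k" "k < q1 + 2 * (m + a)"
    "q1 < B + (m + a)" "q2 < B + m"
proof -
  let ?d = "(m + a)^2 + k * q1"
  have h: "lo (m + a) m q1 q2 < ?d" "?d < (m + a + q1)^2" "?d < (m + q2)^2" "real_of_int ?d \<le> B^2"
    using mk unfolding Reg_def by auto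
  have sq: "n < B" if "n^2 < ?d" for n :: int
  proof (rule power2_less_imp_less)
    have "real_of_int (n^2) < real_of_int ?d" using that by (simp only: of_int_less_iff)
    then show "(real_of_int n)^2 < B^2" using h(4) by simp
  qed (use B in simp)
  have 1: "1 \<le> m + a \<and> 0 < k \<and> \<bar>k - q1\<bar> < 2 * (m + a)"
    using pair_conditions_iff[OF q(1), of "m + a" k] h unfolding lo_def by auto
  then show "1 \<le> m + a" "1 \<le> k" "k < q1 + 2 * (m + a)" by auto
  have "(q2 - m)^2 < (m + q2)^2" using h unfolding lo_def by auto
  then have "0 < q2 * m" by (simp add: power2_eq_square algebra_simps)
  then show "1 \<le> m" using q(2) by (simp add: zero_less_mult_iff)
  have "real_of_int (m + a) < B" "real_of_int m < B" "real_of_int (q1 - (m + a)) < B" "real_of_int (q2 - m) < B"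
    by (intro sq; use h in \<open>simp add: lo_def\<close>)+
  then show "m < B" "m + a < B" "q1 < B + (m + a)" "q2 < B + m" by auto
qed

definition Tr :: "int \<Rightarrow> (int \<times> int \<times> int) set" where
  "Tr N = {-N..N} \<times> {1..N} \<times> {1..N}"

lemma finite_Tr [simp]: "finite (Tr N)" unfolding Tr_def by simp

lemma Reg_subset:
  assumes B: "B \<ge> 1" and N: "N = \<lfloor>2 * B\<rfloor>" and q: "1 \<le> q1" "1 \<le> q2"
  shows "Reg B a q1 q2 \<subseteq> {1..N} \<times> {1..2 * N}"
proof (rule subsetI, clarify)
  fix m k assume mk: "(m, k) \<in> Reg B a q1 q2"
  have B0: "B > 0" using B by simp
  note b = Reg_bounds[OF B0 q mk]
  have "m + a \<le> \<lfloor>B\<rfloor>" "m \<le> \<lfloor>B\<rfloor>" using b by linarith+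
  moreover have "q1 \<le> \<lfloor>B\<rfloor> + (m + a)" using b(7) by linarith
  moreover have "2 * \<lfloor>B\<rfloor> \<le> N" unfolding N by linarith
  ultimately show "m \<in> {1..N} \<and> k \<in> {1..2 * N}" using b(1,2,5,6) by auto
qed

lemma finite_Reg:
  assumes "B \<ge> 1" "1 \<le> q1" "1 \<le> q2"
  shows "finite (Reg B a q1 q2)"
  using Reg_subset[OF assms(1) refl assms(2,3)] finite_subset by blast

lemma W_eq_sum_T:
  assumes B: "B \<ge> 1" and N: "N = \<lfloor>2 * B\<rfloor>"
  shows "W (B^2) = (\<Sum>(a, q1, q2)\<in>Tr N. real (T B a q1 q2))"
proof -
  have B0: "B > 0" using B by simp
  have fin: "finite (Fib B a q1 q2)" if "1 \<le> q1" "1 \<le> q2" for a q1 q2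
  proof -
    have "finite {(m, k). (m, k) \<in> Reg B a q1 q2 \<and> q2 dvd (2 * a) * m + q1 * k + a^2}"
      by (rule finite_subset[OF _ finite_Reg[OF B that]]) auto
    then show ?thesis using bij_betw_finite[OF bij_betw_Fib[OF B0 that]] by blast
  qed
  have "W_set (B^2) = (\<Union>t\<in>Tr N. case t of (a, q1, q2) \<Rightarrow> Fib B a q1 q2)"
  proof (intro equalityI subsetI)
    fix z assume z: "z \<in> W_set (B^2)"
    obtain m1 m2 q1 q2 k1 k2 where zz: "z = (m1, m2, q1, q2, k1, k2)" by (cases z)
    have b: "1 \<le> m1" "m1 < B" "1 \<le> m2" "m2 < B" "1 \<le> q1" "q1 < B + m1" "1 \<le> q2" "q2 < B + m2"
      using z B0 unfolding zz W_set_def by auto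
    have "m1 - m2 < B" "m2 - m1 < B" "q1 < 2 * B" "q2 < 2 * B" using b by linarith+
    then have "(m1 - m2, q1, q2) \<in> Tr N" unfolding Tr_def N using b B by (auto; linarith)
    moreover have "z \<in> Fib B (m1 - m2) q1 q2" using z unfolding zz Fib_def by simp
    ultimately show "z \<in> (\<Union>t\<in>Tr N. case t of (a, q1, q2) \<Rightarrow> Fib B a q1 q2)" by force
  qed (auto simp: Fib_def)
  then have "card (W_set (B^2)) = card (\<Union>t\<in>Tr N. case t of (a, q1, q2) \<Rightarrow> Fib B a q1 q2)" by simp
  also have "\<dots> = (\<Sum>t\<in>Tr N. card (case t of (a, q1, q2) \<Rightarrow> Fib B a q1 q2))"
    by (rule card_UN_disjoint) (use fin in \<open>auto simp: Tr_def Fib_def\<close>)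
  also have "\<dots> = (\<Sum>(a, q1, q2)\<in>Tr N. T B a q1 q2)"
    by (rule sum.cong) (auto simp: Tr_def card_Fib[OF B0])
  finally show ?thesis unfolding W_def by (simp add: case_prod_unfold)
qed

lemma G_pos: "1 \<le> q1 \<Longrightarrow> G a q1 q2 > 0"
  unfolding G_def by (simp add: gcd_pos_int)

lemma dvd_G_iff: "e dvd G a q1 q2 \<longleftrightarrow> e dvd 2 * a \<and> e dvd q1 \<and> e dvd q2"
  unfolding G_def by (simp add: conj_assoc)

lemma G_dvd: "G a q1 q2 dvd 2 * a" "G a q1 q2 dvd q1" "G a q1 q2 dvd q2"
  using dvd_G_iff[of "G a q1 q2" a q1 q2] by simp_all

lemma T_bound_2:
  assumes B: "B \<ge> 1" and N: "N = \<lfloor>2 * B\<rfloor>" and q: "1 \<le> q1" "1 \<le> q2" "q2 \<le> N"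
  shows "real (T B a q1 q2) \<le> 20 * (real_of_int N)^2 * G a q1 q2 / q2"
proof -
  let ?S' = "{-N..2*N} \<times> {-N..3*N}"
  have N1: "N \<ge> 1" using q by simp
  have "(q2 div gcd (gcd (2 * a) q1) q2) * int (T B a q1 q2) \<le> int (card ?S')"
    unfolding T_def
  proof (rule coset_count_upper[where \<rho> = q2])
    show "\<exists>u v. \<bar>u\<bar> \<le> q2 \<and> \<bar>v\<bar> \<le> q2 \<and> q2 dvd 2 * a * (M - u) + q1 * (K - v)" for M K
      using representatives_trivial[of q2] q by auto
    fix m k u v assume mk: "(m, k) \<in> Reg B a q1 q2" and uv: "\<bar>u\<bar> \<le> q2" "\<bar>v\<bar> \<le> q2"
    have "m \<in> {1..N} \<and> k \<in> {1..2 * N}" using Reg_subset[OF B N q(1,2)] mk by blast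
    then show "(m + u, k + v) \<in> ?S'" using uv q by auto
  qed (use q in auto)
  also have "int (card ?S') = (3 * N + 1) * (4 * N + 1)" using N1 by (simp add: card_cartesian_product)
  also have "\<dots> \<le> (4 * N) * (5 * N)" using N1 by (intro mult_mono) auto
  finally have a: "(q2 div G a q1 q2) * int (T B a q1 q2) \<le> 20 * N^2" unfolding G_def by (simp add: power2_eq_square)
  have e: "q2 = G a q1 q2 * (q2 div G a q1 q2)" using G_dvd(3) by simp
  have "q2 * int (T B a q1 q2) = G a q1 q2 * ((q2 div G a q1 q2) * int (T B a q1 q2))" by (subst e) simp
  also have "\<dots> \<le> G a q1 q2 * (20 * N^2)" using a G_pos[OF q(1), of a q2] by (intro mult_left_mono) auto
  finally have "real_of_int (q2 * int (T B a q1 q2)) \<le> real_of_int (G a q1 q2 * (20 * N^2))" by (simp only: of_int_le_iff)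
  then show ?thesis using q by (simp add: field_simps)
qed

text \<open>The bounds in q2 and, through \<open>T_swap\<close>, in q1 are merged into their
  geometric mean. Each variable then carries the exponent 1/2, so that a sum over small values of
  either one still gains a factor.\<close>

lemma T_bound:
  assumes B: "B \<ge> 1" and N: "N = \<lfloor>2 * B\<rfloor>" and q: "1 \<le> q1" "q1 \<le> N" "1 \<le> q2" "q2 \<le> N"
  shows "real (T B a q1 q2) \<le> 20 * (real_of_int N)^2 * G a q1 q2 / (sqrt q1 * sqrt q2)"
proof -
  have B0: "B > 0" using B by simp
  let ?K = "20 * (real_of_int N)^2 * G a q1 q2"
  have t2: "real (T B a q1 q2) \<le> ?K / q2" using T_bound_2[OF B N q(1,3,4)] .
  have "G (-a) q2 q1 = G a q1 q2" unfolding G_def by (simp add: gcd.assoc gcd.commute gcd.left_commute)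
  then have t1: "real (T B a q1 q2) \<le> ?K / q1" using T_bound_2[OF B N q(3,1,2), of "-a"] T_swap[OF B0 q(1,3), of a] by simp
  have K: "0 \<le> ?K" using G_pos[OF q(1), of a q2] by (intro mult_nonneg_nonneg) auto
  have "(real (T B a q1 q2))^2 \<le> (?K / q1) * (?K / q2)"
    unfolding power2_eq_square[of "real (T B a q1 q2)"]
    by (rule mult_mono[OF t1 t2], rule divide_nonneg_nonneg[OF K]) (use q in simp_all)
  also have "\<dots> = (?K / (sqrt q1 * sqrt q2))^2"
  proof -
    have e: "(sqrt q1 * sqrt q2)^2 = real_of_int q1 * q2" using q by (simp add: power_mult_distrib)
    show ?thesis unfolding power_divide e by (simp add: power2_eq_square)
  qed
  finally show ?thesis by (rule power2_le_imp_le) (rule divide_nonneg_nonneg[OF K], use q in simp)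
qed


section \<open>Sums of greatest common divisors\<close>

text \<open>The quotients 2 a / g are distinct and lie in the symmetric interval of radius 2 N / g.
  Their number times g is at most 4 N + g, hence at most 5 N.\<close>

lemma card_dvd_double:
  fixes g N :: int
  assumes "1 \<le> g" "g \<le> N"
  shows "g * int (card {a \<in> {-N..N}. g dvd 2 * a}) \<le> 5 * N"
proof -
  let ?M = "2 * N div g"
  have "card {a \<in> {-N..N}. g dvd 2 * a} \<le> card {- ?M..?M}"
  proof (rule card_inj_on_le[where f = "\<lambda>a. 2 * a div g"])
    show "inj_on (\<lambda>a. 2 * a div g) {a \<in> {-N..N}. g dvd 2 * a}"
      using assms by (auto simp: inj_on_def dvd_div_eq_iff elim!: dvdE)
    show "(\<lambda>a. 2 * a div g) ` {a \<in> {-N..N}. g dvd 2 * a} \<subseteq> {- ?M..?M}"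
    proof clarsimp
      fix a assume a: "- N \<le> a" "a \<le> N" "g dvd 2 * a"
      have "2 * a div g \<le> ?M" using a assms by (intro zdiv_mono1) auto
      moreover have "(2 * (- a)) div g \<le> ?M" using a assms by (intro zdiv_mono1) auto
      moreover have "(2 * (- a)) div g = - (2 * a div g)" using dvd_neg_div[OF a(3)] by simp
      ultimately show "- ?M \<le> 2 * a div g \<and> 2 * a div g \<le> ?M" by auto
    qed
  qed simp
  also have "\<dots> = nat (2 * ?M + 1)" by simp
  finally have "int (card {a \<in> {-N..N}. g dvd 2 * a}) \<le> 2 * ?M + 1"
    using assms pos_imp_zdiv_nonneg_iff[of g "2 * N"] by linarith
  then have "g * int (card {a \<in> {-N..N}. g dvd 2 * a}) \<le> g * (2 * ?M + 1)" using assms by (intro mult_left_mono) auto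
  also have "\<dots> = 2 * (g * ?M) + g" by (simp add: algebra_simps)
  also have "g * ?M \<le> 2 * N" using assms by (simp add: minus_mod_eq_mult_div[symmetric])
  finally show ?thesis using assms by simp
qed

text \<open>For G > D the term of G is one of those for the g in (D, N] dividing 2 a, q1 and q2.
  Weakening G = g to these divisibilities separates the three variables, and the weight g is
  absorbed by the sparsity of the admissible a.\<close>

lemma gcd_weighted_sum:
  fixes F H :: "int \<Rightarrow> real"
  assumes F: "\<And>q. F q \<ge> 0" and H: "\<And>q. H q \<ge> 0" and D: "D \<ge> 0" and N: "N \<ge> 1"
  shows "(\<Sum>(a, q1, q2)\<in>Tr N. if G a q1 q2 > D then G a q1 q2 * F q1 * H q2 else 0) \<le>
    (\<Sum>g\<in>{D+1..N}. 5 * real_of_int N * (\<Sum>q\<in>{q \<in> {1..N}. g dvd q}. F q) * (\<Sum>q\<in>{q \<in> {1..N}. g dvd q}. H q))"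
proof -
  have "(\<Sum>(a, q1, q2)\<in>Tr N. if G a q1 q2 > D then G a q1 q2 * F q1 * H q2 else 0) \<le>
     (\<Sum>(a, q1, q2)\<in>Tr N. \<Sum>g\<in>{D+1..N}. if g dvd 2 * a \<and> g dvd q1 \<and> g dvd q2 then g * F q1 * H q2 else 0)"
  proof (rule sum_mono, clarify)
    fix a q1 q2 assume t: "(a, q1, q2) \<in> Tr N"
    have q: "1 \<le> q1" "q1 \<le> N" using t unfolding Tr_def by auto
    show "(if G a q1 q2 > D then G a q1 q2 * F q1 * H q2 else 0) \<le>
      (\<Sum>g\<in>{D+1..N}. if g dvd 2 * a \<and> g dvd q1 \<and> g dvd q2 then g * F q1 * H q2 else 0)"
    proof (cases "G a q1 q2 > D")
      case True
      let ?h = "\<lambda>g. if g dvd 2 * a \<and> g dvd q1 \<and> g dvd q2 then real_of_int g * F q1 * H q2 else 0"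
      note d = G_dvd[of a q1 q2]
      have "G a q1 q2 \<le> N" using zdvd_imp_le[OF d(2)] q by simp
      then have "?h (G a q1 q2) \<le> sum ?h {D+1..N}"
        using True D F H by (intro member_le_sum) auto
      then show ?thesis using True d by simp
    next
      case False
      show ?thesis using False D F H by (auto intro!: sum_nonneg)
    qed
  qed
  also have "\<dots> = (\<Sum>g\<in>{D+1..N}. \<Sum>(a, q1, q2)\<in>Tr N. if g dvd 2 * a \<and> g dvd q1 \<and> g dvd q2 then g * F q1 * H q2 else 0)"
    unfolding case_prod_unfold by (rule sum.swap)
  also have "\<dots> \<le> (\<Sum>g\<in>{D+1..N}. 5 * real_of_int N * (\<Sum>q\<in>{q \<in> {1..N}. g dvd q}. F q) * (\<Sum>q\<in>{q \<in> {1..N}. g dvd q}. H q))"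
  proof (rule sum_mono)
    fix g assume g: "g \<in> {D+1..N}"
    let ?A = "{a \<in> {-N..N}. g dvd 2 * a}" and ?Q = "{q \<in> {1..N}. g dvd q}"
    have "(\<Sum>(a, q1, q2)\<in>Tr N. if g dvd 2 * a \<and> g dvd q1 \<and> g dvd q2 then g * F q1 * H q2 else 0)
      = (\<Sum>(a, q1, q2)\<in>?A \<times> ?Q \<times> ?Q. g * F q1 * H q2)"
      by (rule sum.mono_neutral_cong_right) (auto simp: Tr_def split: if_splits)
    also have "\<dots> = (g * card ?A) * (\<Sum>q\<in>?Q. F q) * (\<Sum>q\<in>?Q. H q)"
      by (simp add: sum.cartesian_product[symmetric] sum_distrib_left sum_distrib_right mult_ac)
    also have "\<dots> \<le> 5 * real_of_int N * (\<Sum>q\<in>?Q. F q) * (\<Sum>q\<in>?Q. H q)"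
    proof -
      have "g * int (card ?A) \<le> 5 * N" using g D by (intro card_dvd_double) auto
      then have "real_of_int (g * int (card ?A)) \<le> real_of_int (5 * N)" by (simp only: of_int_le_iff)
      then have "real_of_int g * real (card ?A) \<le> 5 * real_of_int N" by simp
      then show ?thesis using F H by (intro mult_right_mono sum_nonneg) auto
    qed
    finally show "(\<Sum>(a, q1, q2)\<in>Tr N. if g dvd 2 * a \<and> g dvd q1 \<and> g dvd q2 then g * F q1 * H q2 else 0)
      \<le> 5 * real_of_int N * (\<Sum>q\<in>?Q. F q) * (\<Sum>q\<in>?Q. H q)" .
  qed
  finally show ?thesis .
qed

lemma card_multiples:
  fixes g N :: int
  assumes "1 \<le> g" "N \<ge> 1"
  shows "real (card {q \<in> {1..N}. g dvd q}) \<le> N / g"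
proof -
  have "card {q \<in> {1..N}. g dvd q} \<le> card {1..N div g}"
  proof (rule card_inj_on_le[where f = "\<lambda>q. q div g"])
    show "inj_on (\<lambda>q. q div g) {q \<in> {1..N}. g dvd q}" using assms by (auto simp: inj_on_def elim!: dvdE)
    show "(\<lambda>q. q div g) ` {q \<in> {1..N}. g dvd q} \<subseteq> {1..N div g}"
      using assms by (auto simp: zdiv_mono1 int_one_le_iff_zero_less pos_imp_zdiv_pos_iff zdvd_imp_le)
  qed simp
  then have "real (card {q \<in> {1..N}. g dvd q}) \<le> real (card {1..N div g})" by simp
  also have "\<dots> = real_of_int (N div g)" using assms by (simp add: pos_imp_zdiv_nonneg_iff)
  also have "\<dots> \<le> N / g" by (rule real_of_int_div4)
  finally show ?thesis .
qed

lemma sum_inverse_sqrt_le: "(\<Sum>i=1..n. 1 / sqrt (real i)) \<le> 2 * sqrt (real n)"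
proof (induction n)
  case (Suc n)
  let ?a = "sqrt (real n)" and ?b = "sqrt (real (Suc n))"
  have ab: "?a \<le> ?b" "?b > 0" by auto
  have "1 = (?b - ?a) * (?b + ?a)" by (simp add: algebra_simps flip: power2_eq_square)
  also have "\<dots> \<le> (?b - ?a) * (2 * ?b)" using ab by (intro mult_left_mono) auto
  finally have "1 / ?b \<le> 2 * ?b - 2 * ?a" using ab by (simp add: field_simps)
  then show ?case using Suc by simp
qed simp

lemma sum_inverse_sqrt_multiples:
  fixes g N :: int and Q :: real
  assumes g: "1 \<le> g" and Q: "Q \<ge> 0"
  shows "(\<Sum>q\<in>{q \<in> {1..N}. g dvd q}. if real_of_int q \<le> Q then 1 / sqrt (real_of_int q) else 0) \<le> 2 * sqrt Q / g"
proof -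
  define n where "n = nat \<lfloor>Q / g\<rfloor>"
  have "(\<Sum>q\<in>{q \<in> {1..N}. g dvd q}. if real_of_int q \<le> Q then 1 / sqrt (real_of_int q) else 0) =
     (\<Sum>q\<in>{q \<in> {1..N}. g dvd q \<and> real_of_int q \<le> Q}. 1 / sqrt (real_of_int q))"
    by (rule sum.mono_neutral_cong_right) (auto intro: finite_subset[of _ "{1..N}"])
  also have "\<dots> \<le> (\<Sum>q\<in>(\<lambda>i. g * int i) ` {1..n}. 1 / sqrt (real_of_int q))"
  proof (rule sum_mono2)
    show "{q \<in> {1..N}. g dvd q \<and> real_of_int q \<le> Q} \<subseteq> (\<lambda>i. g * int i) ` {1..n}"
    proof
      fix q assume q: "q \<in> {q \<in> {1..N}. g dvd q \<and> real_of_int q \<le> Q}"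
      then obtain j where j: "q = g * j" by (auto elim: dvdE)
      have j1: "j \<ge> 1" using q g j by (auto simp: int_one_le_iff_zero_less zero_less_mult_iff)
      have "real_of_int g * real_of_int j \<le> Q" using q j by auto
      then have "real_of_int j \<le> Q / g" using g by (simp add: field_simps)
      then have "j \<le> \<lfloor>Q / g\<rfloor>" by linarith
      then have "nat j \<in> {1..n}" using j1 unfolding n_def by auto
      then show "q \<in> (\<lambda>i. g * int i) ` {1..n}" using j j1 by (intro image_eqI[of _ _ "nat j"]) auto
    qed
  qed (use g in auto)
  also have "\<dots> = (\<Sum>i=1..n. 1 / sqrt (g * int i))"
    using g by (subst sum.reindex) (auto simp: inj_on_def)
  also have "\<dots> = (1 / sqrt g) * (\<Sum>i=1..n. 1 / sqrt (real i))"
    by (simp add: sum_distrib_left real_sqrt_mult)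
  also have "\<dots> \<le> (1 / sqrt g) * (2 * sqrt (Q / g))"
  proof (rule mult_left_mono, rule order_trans[OF sum_inverse_sqrt_le])
    have "0 \<le> Q / g" using Q g by simp
    then have "real n \<le> Q / g" unfolding n_def by linarith
    then show "2 * sqrt (real n) \<le> 2 * sqrt (Q / g)" by simp
  qed (use g in simp)
  also have "\<dots> = 2 * sqrt Q / g" using g by (simp add: real_sqrt_divide field_simps)
  finally show ?thesis .
qed

lemma sum_inverse_squares_tail:
  fixes D N :: int
  assumes "D \<ge> 1"
  shows "(\<Sum>g\<in>{D+1..N}. 1 / (real_of_int g)^2) \<le> 1 / D"
proof (cases "N \<ge> D")
  case True
  \<comment> \<open>The additional - 1 / N lets the induction telescope through 1 / (i + 1)^2 \<le>
    1 / i - 1 / (i + 1).\<close>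
  have "(\<Sum>g\<in>{D+1..N}. 1 / (real_of_int g)^2) \<le> 1 / D - 1 / N" using True
  proof (induction N rule: int_ge_induct)
    case (step i)
    have "{D+1..i+1} = insert (i+1) {D+1..i}" using step.hyps by auto
    then have "(\<Sum>g\<in>{D+1..i+1}. 1 / (real_of_int g)^2) = 1 / (real_of_int (i+1))^2 + (\<Sum>g\<in>{D+1..i}. 1 / (real_of_int g)^2)"
      by simp
    also have "1 / (real_of_int (i+1))^2 \<le> 1 / i - 1 / (i + 1)"
    proof -
      have i: "real_of_int i > 0" using assms step.hyps by simp
      have "1 / (real_of_int i + 1)^2 \<le> 1 / (real_of_int i * (real_of_int i + 1))"
        using i by (intro divide_left_mono) (auto simp: power2_eq_square)
      also have "\<dots> = 1 / real_of_int i - 1 / (real_of_int i + 1)" using i by (simp add: field_simps)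
      finally show ?thesis by simp
    qed
    finally show ?case using step.IH by simp
  qed simp
  moreover have "1 / real_of_int N \<ge> 0" using True assms by simp
  ultimately show ?thesis by linarith
qed (use assms in simp)

lemma sum_inverse_squares:
  fixes N :: int
  shows "(\<Sum>g\<in>{1..N}. 1 / (real_of_int g)^2) \<le> 2"
proof (cases "N \<ge> 1")
  case True
  then have "{1..N} = insert 1 {1+1..N}" by auto
  then have "(\<Sum>g\<in>{1..N}. 1 / (real_of_int g)^2) = 1 + (\<Sum>g\<in>{1+1..N}. 1 / (real_of_int g)^2)" by simp
  then show ?thesis using sum_inverse_squares_tail[of 1 N] by simp
qed simp

lemma sum_G_above:
  fixes D N :: int
  assumes D: "D \<ge> 0" and N: "N \<ge> 1"
  shows "(\<Sum>(a, q1, q2)\<in>Tr N. if G a q1 q2 > D then real_of_int (G a q1 q2) else 0)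
    \<le> 5 * (real_of_int N)^3 * (\<Sum>g\<in>{D+1..N}. 1 / (real_of_int g)^2)"
proof -
  have "(\<Sum>(a, q1, q2)\<in>Tr N. if G a q1 q2 > D then real_of_int (G a q1 q2) else 0)
    = (\<Sum>(a, q1, q2)\<in>Tr N. if G a q1 q2 > D then real_of_int (G a q1 q2) * 1 * 1 else 0)"
    by (rule sum.cong) auto
  also have "\<dots> \<le> (\<Sum>g\<in>{D+1..N}. 5 * real_of_int N * (\<Sum>q\<in>{q \<in> {1..N}. g dvd q}. 1) * (\<Sum>q\<in>{q \<in> {1..N}. g dvd q}. 1))"
    using gcd_weighted_sum[of "\<lambda>_. 1" "\<lambda>_. 1" D N] D N by simp
  also have "\<dots> \<le> (\<Sum>g\<in>{D+1..N}. 5 * real_of_int N * (N / g) * (N / g))"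
    using D N by (intro sum_mono mult_mono mult_nonneg_nonneg) (auto intro!: order_trans[OF _ card_multiples])
  also have "\<dots> = 5 * (real_of_int N)^3 * (\<Sum>g\<in>{D+1..N}. 1 / (real_of_int g)^2)"
    by (simp add: sum_distrib_left power2_eq_square power3_eq_cube mult_ac)
  finally show ?thesis .
qed

lemma sum_G_tail:
  fixes D N :: int
  assumes D: "D \<ge> 1" and N: "N \<ge> 1"
  shows "(\<Sum>(a, q1, q2)\<in>Tr N. if G a q1 q2 > D then real_of_int (G a q1 q2) else 0) \<le> 5 * (real_of_int N)^3 / D"
proof -
  have "5 * (real_of_int N)^3 * (\<Sum>g\<in>{D+1..N}. 1 / (real_of_int g)^2) \<le> 5 * (real_of_int N)^3 * (1 / D)"
    using sum_inverse_squares_tail[OF D] N by (intro mult_left_mono) auto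
  then show ?thesis using sum_G_above[of D N] D N by simp
qed

lemma sum_G:
  fixes N :: int
  assumes N: "N \<ge> 1"
  shows "(\<Sum>(a, q1, q2)\<in>Tr N. real_of_int (G a q1 q2)) \<le> 10 * (real_of_int N)^3"
proof -
  have "(\<Sum>(a, q1, q2)\<in>Tr N. real_of_int (G a q1 q2)) = (\<Sum>(a, q1, q2)\<in>Tr N. if G a q1 q2 > 0 then real_of_int (G a q1 q2) else 0)"
    by (rule sum.cong) (auto simp: Tr_def G_pos)
  also have "\<dots> \<le> 5 * (real_of_int N)^3 * (\<Sum>g\<in>{1..N}. 1 / (real_of_int g)^2)"
    using sum_G_above[of 0 N] N by simp
  also have "\<dots> \<le> 5 * (real_of_int N)^3 * 2"
    using sum_inverse_squares N by (intro mult_left_mono) auto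
  finally show ?thesis by simp
qed

lemma sum_G_inverse_sqrt:
  fixes N :: int and Q1 Q2 :: real
  assumes N: "N \<ge> 1" and Q: "Q1 \<ge> 0" "Q2 \<ge> 0"
  shows "(\<Sum>(a, q1, q2)\<in>Tr N. G a q1 q2 * (if q1 \<le> Q1 then 1 / sqrt q1 else 0) * (if q2 \<le> Q2 then 1 / sqrt q2 else 0))
    \<le> 40 * real_of_int N * sqrt Q1 * sqrt Q2"
proof -
  \<comment> \<open>\<open>gcd_weighted_sum\<close> asks for nonnegative values at all integers, but
    \<open>sqrt\<close> is negative at negative arguments; \<open>max 0 q\<close> repairs this
    without changing the values for q \<ge> 1.\<close>
  let ?F = "\<lambda>Q q. if real_of_int q \<le> Q then 1 / sqrt (real_of_int (max 0 q)) else 0"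
  have Fs: "(\<Sum>q\<in>{q \<in> {1..N}. g dvd q}. ?F Q q) \<le> 2 * sqrt Q / g" if "1 \<le> g" "Q \<ge> 0" for g Q
  proof -
    have "(\<Sum>q\<in>{q \<in> {1..N}. g dvd q}. ?F Q q) = (\<Sum>q\<in>{q \<in> {1..N}. g dvd q}. if real_of_int q \<le> Q then 1 / sqrt (real_of_int q) else 0)"
      by (rule sum.cong) auto
    then show ?thesis using sum_inverse_sqrt_multiples[OF that] by simp
  qed
  have "(\<Sum>(a, q1, q2)\<in>Tr N. G a q1 q2 * (if q1 \<le> Q1 then 1 / sqrt q1 else 0) * (if q2 \<le> Q2 then 1 / sqrt q2 else 0))
    = (\<Sum>(a, q1, q2)\<in>Tr N. if G a q1 q2 > 0 then G a q1 q2 * ?F Q1 q1 * ?F Q2 q2 else 0)"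
    by (rule sum.cong) (auto simp: Tr_def G_pos)
  also have "\<dots> \<le>
    (\<Sum>g\<in>{0+1..N}. 5 * real_of_int N * (\<Sum>q\<in>{q \<in> {1..N}. g dvd q}. ?F Q1 q) * (\<Sum>q\<in>{q \<in> {1..N}. g dvd q}. ?F Q2 q))"
    using gcd_weighted_sum[of "?F Q1" "?F Q2" 0 N] N by simp
  also have "\<dots> \<le> (\<Sum>g\<in>{0+1..N}. 5 * real_of_int N * (2 * sqrt Q1 / g) * (2 * sqrt Q2 / g))"
    using N Q by (intro sum_mono mult_mono mult_nonneg_nonneg sum_nonneg Fs) auto
  also have "\<dots> = 20 * real_of_int N * sqrt Q1 * sqrt Q2 * (\<Sum>g\<in>{1..N}. 1 / (real_of_int g)^2)"
    by (simp add: sum_distrib_left power2_eq_square mult_ac)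
  also have "\<dots> \<le> 20 * real_of_int N * sqrt Q1 * sqrt Q2 * 2"
    using sum_inverse_squares N Q by (intro mult_left_mono) auto
  finally show ?thesis by simp
qed


section \<open>Asymptotics of a single fibre\<close>

lemma int_multiple_bound_iff:
  fixes c q k :: int and \<alpha> :: real
  assumes q: "q \<ge> 1"
  shows "\<alpha> < c + k * q \<longleftrightarrow> \<lfloor>(\<alpha> - c) / q\<rfloor> + 1 \<le> k" "c + k * q \<le> \<alpha> \<longleftrightarrow> k \<le> \<lfloor>(\<alpha> - c) / q\<rfloor>"
    "c + k * q < \<alpha> \<longleftrightarrow> k \<le> \<lceil>(\<alpha> - c) / q\<rceil> - 1"
proof -
  have "\<alpha> < c + k * q \<longleftrightarrow> (\<alpha> - c) / q < k" using q by (simp add: field_simps)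
  also have "\<dots> \<longleftrightarrow> \<lfloor>(\<alpha> - c) / q\<rfloor> + 1 \<le> k" by linarith
  finally show "\<alpha> < c + k * q \<longleftrightarrow> \<lfloor>(\<alpha> - c) / q\<rfloor> + 1 \<le> k" .
  have "c + k * q \<le> \<alpha> \<longleftrightarrow> k \<le> (\<alpha> - c) / q" using q by (simp add: field_simps)
  then show "c + k * q \<le> \<alpha> \<longleftrightarrow> k \<le> \<lfloor>(\<alpha> - c) / q\<rfloor>" by (simp add: le_floor_iff)
  have "c + k * q < \<alpha> \<longleftrightarrow> k < (\<alpha> - c) / q" using q by (simp add: field_simps)
  also have "\<dots> \<longleftrightarrow> k \<le> \<lceil>(\<alpha> - c) / q\<rceil> - 1" by linarith
  finally show "c + k * q < \<alpha> \<longleftrightarrow> k \<le> \<lceil>(\<alpha> - c) / q\<rceil> - 1" .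
qed

lemma card_int_interval_upper:
  fixes c q :: int and \<alpha> \<beta> :: real
  assumes q: "q \<ge> 1"
  shows "finite {k::int. \<alpha> < c + k * q \<and> c + k * q \<le> \<beta>}"
    "real (card {k::int. \<alpha> < c + k * q \<and> c + k * q \<le> \<beta>}) \<le> max 0 (\<beta> - \<alpha>) / q + 1"
proof -
  let ?l = "(\<alpha> - c) / q" and ?u = "(\<beta> - c) / q"
  have e: "{k::int. \<alpha> < c + k * q \<and> c + k * q \<le> \<beta>} = {\<lfloor>?l\<rfloor> + 1..\<lfloor>?u\<rfloor>}"
    unfolding int_multiple_bound_iff[OF q] by auto
  show "finite {k::int. \<alpha> < c + k * q \<and> c + k * q \<le> \<beta>}" unfolding e by simp
  have "?u - ?l = (\<beta> - \<alpha>) / q" by (simp add: diff_divide_distrib)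
  also have "\<dots> \<le> max 0 (\<beta> - \<alpha>) / q" using q by (intro divide_right_mono) auto
  finally have "?u - ?l \<le> max 0 (\<beta> - \<alpha>) / q" .
  moreover have "max 0 (\<beta> - \<alpha>) / q \<ge> 0" using q by simp
  ultimately show "real (card {k::int. \<alpha> < c + k * q \<and> c + k * q \<le> \<beta>}) \<le> max 0 (\<beta> - \<alpha>) / q + 1"
    unfolding e by (simp; linarith)
qed

lemma card_int_interval_lower:
  fixes c q :: int and \<alpha> \<beta> :: real
  assumes q: "q \<ge> 1"
  shows "finite {k::int. \<alpha> < c + k * q \<and> c + k * q < \<beta>}"
    "(\<beta> - \<alpha>) / q - 1 \<le> real (card {k::int. \<alpha> < c + k * q \<and> c + k * q < \<beta>})"
proof -
  let ?l = "(\<alpha> - c) / q" and ?u = "(\<beta> - c) / q"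
  have e: "{k::int. \<alpha> < c + k * q \<and> c + k * q < \<beta>} = {\<lfloor>?l\<rfloor> + 1..\<lceil>?u\<rceil> - 1}"
    unfolding int_multiple_bound_iff[OF q] by auto
  show "finite {k::int. \<alpha> < c + k * q \<and> c + k * q < \<beta>}" unfolding e by simp
  have "?u - ?l = (\<beta> - \<alpha>) / q" by (simp add: diff_divide_distrib)
  then show "(\<beta> - \<alpha>) / q - 1 \<le> real (card {k::int. \<alpha> < c + k * q \<and> c + k * q < \<beta>})"
    unfolding e by (simp; linarith)
qed

lemma width_nonneg: "width B m1 m2 q1 q2 \<ge> 0" unfolding width_def by simp

text \<open>From (m + q)^2 - (q - m)^2 = 4 m q: a nonempty interval forces m_i > 0, and its length
  is at most 4 B q_i for both i. This double bound is the source of the square roots in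
  \<open>width_le\<close> and \<open>Ph_bound\<close>.\<close>

lemma width_pos_bounds:
  assumes B: "B > 0" and q: "q1 \<ge> 1" "q2 \<ge> 1" and w: "of_int (lo m1 m2 q1 q2) < up B m1 m2 q1 q2"
  shows "1 \<le> m1" "1 \<le> m2" "m1 < B" "m2 < B" "up B m1 m2 q1 q2 - lo m1 m2 q1 q2 \<le> 4 * B * q1"
    "up B m1 m2 q1 q2 - lo m1 m2 q1 q2 \<le> 4 * B * q2"
proof -
  have lo: "m1^2 \<le> lo m1 m2 q1 q2" "m2^2 \<le> lo m1 m2 q1 q2"
    "(q1 - m1)^2 \<le> lo m1 m2 q1 q2" "(q2 - m2)^2 \<le> lo m1 m2 q1 q2" unfolding lo_def by auto
  have up: "up B m1 m2 q1 q2 \<le> B^2" "up B m1 m2 q1 q2 \<le> of_int ((m1 + q1)^2)"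
    "up B m1 m2 q1 q2 \<le> of_int ((m2 + q2)^2)" unfolding up_def by auto
  have sq: "n < B" if "n^2 \<le> lo m1 m2 q1 q2" for n :: int
  proof (rule power2_less_imp_less)
    have "(real_of_int n)^2 = real_of_int (n^2)" by simp
    also have "\<dots> \<le> real_of_int (lo m1 m2 q1 q2)" using that by (simp only: of_int_le_iff)
    also have "\<dots> < B^2" using w up by linarith
    finally show "(real_of_int n)^2 < B^2" .
  qed (use B in simp)
  show mB: "m1 < B" "m2 < B" using sq lo by auto
  have p: "0 < m \<and> up B m1 m2 q1 q2 - lo m1 m2 q1 q2 \<le> 4 * B * q"
    if qq: "q \<ge> 1" and l: "(q - m)^2 \<le> lo m1 m2 q1 q2" and u: "up B m1 m2 q1 q2 \<le> of_int ((m + q)^2)"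
      and mB: "m < B" for m q :: int
  proof -
    have l': "real_of_int ((q - m)^2) \<le> lo m1 m2 q1 q2" using l by (simp only: of_int_le_iff)
    have "real_of_int ((q - m)^2) < real_of_int ((m + q)^2)" using l' u w by linarith
    then have "(q - m)^2 < (m + q)^2" by (simp only: of_int_less_iff)
    then have "0 < q * m" by (simp add: power2_eq_square algebra_simps)
    then have m: "0 < m" using qq by (simp add: zero_less_mult_iff)
    have "up B m1 m2 q1 q2 - lo m1 m2 q1 q2 \<le> real_of_int ((m + q)^2) - real_of_int ((q - m)^2)" using l' u by linarith
    also have "\<dots> = 4 * real_of_int m * q" by (simp add: power2_eq_square algebra_simps)
    also have "\<dots> \<le> 4 * B * q" using mB qq by (intro mult_right_mono) auto
    finally show ?thesis using m by simp
  qed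
  show "1 \<le> m1" "up B m1 m2 q1 q2 - lo m1 m2 q1 q2 \<le> 4 * B * q1" using p[OF q(1) lo(3) up(2) mB(1)] by auto
  show "1 \<le> m2" "up B m1 m2 q1 q2 - lo m1 m2 q1 q2 \<le> 4 * B * q2" using p[OF q(2) lo(4) up(3) mB(2)] by auto
qed

lemma width_eq_0:
  assumes B: "B > 0" and q: "q1 \<ge> 1" "q2 \<ge> 1" and w: "m1 < 1 \<or> m2 < 1 \<or> m1 \<ge> B \<or> m2 \<ge> B"
  shows "width B m1 m2 q1 q2 = 0"
proof (rule ccontr)
  assume "width B m1 m2 q1 q2 \<noteq> 0"
  then have "of_int (lo m1 m2 q1 q2) < up B m1 m2 q1 q2" unfolding width_def by (auto simp: max_def split: if_splits)
  from width_pos_bounds[OF B q this] w show False by auto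
qed

lemma width_le:
  assumes B: "B > 0" and q: "q1 \<ge> 1" "q2 \<ge> 1"
  shows "width B m1 m2 q1 q2 \<le> 4 * B * (sqrt q1 * sqrt q2)"
proof (cases "of_int (lo m1 m2 q1 q2) < up B m1 m2 q1 q2")
  case True
  note b = width_pos_bounds[OF B q True]
  have w: "width B m1 m2 q1 q2 = up B m1 m2 q1 q2 - lo m1 m2 q1 q2" using True unfolding width_def by simp
  have "(width B m1 m2 q1 q2)^2 \<le> (4 * B * q1) * (4 * B * q2)"
    unfolding power2_eq_square using b(5,6) w True B q
    by (intro mult_mono) auto
  also have "\<dots> = (4 * B * (sqrt q1 * sqrt q2))^2" using q by (simp add: power_mult_distrib power2_eq_square[of B])
  finally show ?thesis by (rule power2_le_imp_le) (use B q in simp)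
next
  case False
  then show ?thesis unfolding width_def using B q by simp
qed

text \<open>\<open>width / q1\<close> approximates the number of \<open>k\<close> in the column
  \<open>m\<close> of \<open>Reg\<close>, so its sum over \<open>m\<close> plays the part of the
  area. The remaining \<open>1 / q2\<close>, multiplied by \<open>G\<close>, is the density of a
  nonempty coset.\<close>

definition Ph :: "real \<Rightarrow> int \<Rightarrow> int \<Rightarrow> int \<Rightarrow> int \<Rightarrow> real" where
  "Ph B N a q1 q2 = (\<Sum>m\<in>{-N..N}. width B (m + a) m q1 q2 / (q1 * q2))"

lemma Ph_nonneg: "q1 \<ge> 1 \<Longrightarrow> q2 \<ge> 1 \<Longrightarrow> Ph B N a q1 q2 \<ge> 0"
  unfolding Ph_def by (intro sum_nonneg divide_nonneg_nonneg width_nonneg) simp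

lemma Ph_bound:
  assumes B: "B \<ge> 1" and N: "N = \<lfloor>2 * B\<rfloor>" and q: "1 \<le> q1" "1 \<le> q2"
  shows "Ph B N a q1 q2 \<le> 4 * (real_of_int N)^2 / (sqrt q1 * sqrt q2)"
proof -
  have B0: "B > 0" using B by simp
  have BN: "B \<le> N" "N \<ge> 1" using B unfolding N by linarith+
  have "Ph B N a q1 q2 = (\<Sum>m\<in>{1..N}. width B (m + a) m q1 q2 / (q1 * q2))"
    unfolding Ph_def by (rule sum.mono_neutral_right) (use width_eq_0[OF B0 q] BN in auto)
  also have "\<dots> \<le> (\<Sum>m\<in>{1..N}. 4 * real_of_int N / (sqrt q1 * sqrt q2))"
  proof (rule sum_mono)
    fix m assume "m \<in> {1..N}"
    have "width B (m + a) m q1 q2 / (q1 * q2) \<le> 4 * B * (sqrt q1 * sqrt q2) / (q1 * q2)"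
      using q by (intro divide_right_mono width_le B0) auto
    also have "4 * B * (sqrt q1 * sqrt q2) / (q1 * q2) = 4 * B / (sqrt q1 * sqrt q2)"
    proof -
      have e: "real_of_int (q1 * q2) = (sqrt q1 * sqrt q1) * (sqrt q2 * sqrt q2)" using q by simp
      show ?thesis unfolding e using q by (simp add: field_simps del: real_sqrt_mult_self)
    qed
    also have "\<dots> \<le> 4 * real_of_int N / (sqrt q1 * sqrt q2)" using q BN by (intro divide_right_mono) auto
    finally show "width B (m + a) m q1 q2 / (q1 * q2) \<le> 4 * real_of_int N / (sqrt q1 * sqrt q2)" .
  qed
  also have "\<dots> = 4 * (real_of_int N)^2 / (sqrt q1 * sqrt q2)" using BN by (simp add: power2_eq_square)
  finally show ?thesis .
qed

lemma square_shift:
  fixes s u N \<rho> :: int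
  assumes "\<bar>s\<bar> \<le> 2 * N" "\<bar>u\<bar> \<le> \<rho>" "\<rho> \<le> N"
  shows "\<bar>(s + u)^2 - s^2\<bar> \<le> 5 * N * \<rho>"
proof -
  have "(s + u)^2 - s^2 = u * (2 * s + u)" by (simp add: power2_eq_square algebra_simps)
  then have "\<bar>(s + u)^2 - s^2\<bar> = \<bar>u\<bar> * \<bar>2 * s + u\<bar>" by (simp add: abs_mult)
  also have "\<dots> \<le> \<rho> * (5 * N)" using assms by (intro mult_mono) auto
  finally show ?thesis by (simp add: mult_ac)
qed

lemma lo_shift:
  fixes N \<rho> :: int
  assumes "\<bar>m1\<bar> \<le> N" "\<bar>m2\<bar> \<le> N" "0 \<le> q1" "q1 \<le> N" "0 \<le> q2" "q2 \<le> N" "\<bar>u\<bar> \<le> \<rho>" "\<rho> \<le> N"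
  shows "lo (m1 + u) (m2 + u) q1 q2 \<le> lo m1 m2 q1 q2 + 5 * N * \<rho>"
proof -
  have "\<bar>(m1 + u)^2 - m1^2\<bar> \<le> 5 * N * \<rho>" "\<bar>(m2 + u)^2 - m2^2\<bar> \<le> 5 * N * \<rho>"
    "\<bar>(q1 - m1 + - u)^2 - (q1 - m1)^2\<bar> \<le> 5 * N * \<rho>" "\<bar>(q2 - m2 + - u)^2 - (q2 - m2)^2\<bar> \<le> 5 * N * \<rho>"
    by (intro square_shift; use assms in auto)+
  then have "(m1 + u)^2 \<le> m1^2 + 5 * N * \<rho>" "(m2 + u)^2 \<le> m2^2 + 5 * N * \<rho>"
    "(q1 - (m1 + u))^2 \<le> (q1 - m1)^2 + 5 * N * \<rho>" "(q2 - (m2 + u))^2 \<le> (q2 - m2)^2 + 5 * N * \<rho>"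
    by (simp_all add: algebra_simps)
  moreover have "max x y \<le> max x' y' + d" if "x \<le> x' + d" "y \<le> y' + d" for x y x' y' d :: int
    using that by linarith
  ultimately show ?thesis unfolding lo_def by blast
qed

lemma up_shift:
  fixes N \<rho> :: int
  assumes "\<bar>m1\<bar> \<le> N" "\<bar>m2\<bar> \<le> N" "0 \<le> q1" "q1 \<le> N" "0 \<le> q2" "q2 \<le> N" "\<bar>u\<bar> \<le> \<rho>" "\<rho> \<le> N"
  shows "up B m1 m2 q1 q2 \<le> up B (m1 + u) (m2 + u) q1 q2 + 5 * N * \<rho>"
proof -
  have a: "\<bar>(m1 + q1 + u)^2 - (m1 + q1)^2\<bar> \<le> 5 * N * \<rho>" "\<bar>(m2 + q2 + u)^2 - (m2 + q2)^2\<bar> \<le> 5 * N * \<rho>"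
    by (intro square_shift; use assms in auto)+
  have "(m1 + q1)^2 \<le> (m1 + u + q1)^2 + 5 * N * \<rho>" "(m2 + q2)^2 \<le> (m2 + u + q2)^2 + 5 * N * \<rho>"
    using a by (simp_all add: add_ac)
  then have "real_of_int ((m1 + q1)^2) \<le> real_of_int ((m1 + u + q1)^2 + 5 * N * \<rho>)"
    "real_of_int ((m2 + q2)^2) \<le> real_of_int ((m2 + u + q2)^2 + 5 * N * \<rho>)" by (simp_all only: of_int_le_iff)
  then have b: "real_of_int ((m1 + q1)^2) \<le> real_of_int ((m1 + u + q1)^2) + 5 * N * \<rho>"
    "real_of_int ((m2 + q2)^2) \<le> real_of_int ((m2 + u + q2)^2) + 5 * N * \<rho>" by (simp_all del: of_int_power)
  have "0 \<le> N * \<rho>" using assms by (intro mult_nonneg_nonneg) auto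
  then have "0 \<le> real_of_int (N * \<rho>)" by (simp only: of_int_0_le_iff)
  then have "0 \<le> 5 * real_of_int N * \<rho>" by simp
  then show ?thesis using b unfolding up_def by (simp only: of_int_mult of_int_numeral)
qed

lemma d_shift:
  fixes N \<rho> :: int
  assumes "\<bar>m1\<bar> \<le> N" "0 \<le> q1" "q1 \<le> N" "\<bar>u\<bar> \<le> \<rho>" "\<bar>v\<bar> \<le> \<rho>" "\<rho> \<le> N"
  shows "\<bar>((m1 + u)^2 + (k + v) * q1) - (m1^2 + k * q1)\<bar> \<le> 4 * N * \<rho>"
proof -
  have "((m1 + u)^2 + (k + v) * q1) - (m1^2 + k * q1) = u * (2 * m1 + u) + v * q1"
    by (simp add: power2_eq_square algebra_simps)
  moreover have "\<bar>u * (2 * m1 + u)\<bar> \<le> \<rho> * (3 * N)" unfolding abs_mult using assms by (intro mult_mono) auto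
  moreover have "\<bar>v * q1\<bar> \<le> \<rho> * N" unfolding abs_mult using assms by (intro mult_mono) auto
  ultimately show ?thesis by (simp add: algebra_simps)
qed

text \<open>By the tiling, T times the index lies between the numbers of points of a shrunken and of
  an enlarged region. Column by column the enlarged count exceeds, and the shrunken one falls short
  of, \<open>width / q1\<close> by at most 2 E / q1 + 1; there are at most 4 N columns.\<close>

lemma coset_count_Reg:
  fixes \<rho> :: int
  assumes B: "B \<ge> 1" and N: "N = \<lfloor>2 * B\<rfloor>" and q: "1 \<le> q1" "q1 \<le> N" "1 \<le> q2" "q2 \<le> N"
    and \<rho>: "1 \<le> \<rho>" "\<rho> \<le> N" and Ga: "G a q1 q2 dvd a^2"
    and reps: "\<And>M K. \<exists>u v. \<bar>u\<bar> \<le> \<rho> \<and> \<bar>v\<bar> \<le> \<rho> \<and> q2 dvd (2 * a) * (M - u) + q1 * (K - v)"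
  shows "\<bar>real_of_int (q2 div G a q1 q2) * T B a q1 q2 - (\<Sum>m\<in>{-N..N}. width B (m + a) m q1 q2 / q1)\<bar>
    \<le> 76 * (real_of_int N)^2 * \<rho> / q1"
proof -
  have B0: "B > 0" using B by simp
  have BN: "B \<le> N" "N \<ge> 1" using B unfolding N by linarith+
  \<comment> \<open>Under a shift by at most \<rho>, \<open>lo\<close> can rise and
    \<open>up\<close> can fall by at most 5 N \<rho>, while d moves by at most 4 N \<rho>.\<close>
  define E where "E = 9 * real_of_int N * \<rho>"
  have E0: "E \<ge> 0" unfolding E_def using BN \<rho> by simp
  let ?w = "\<lambda>m. width B (m + a) m q1 q2"
  let ?lo = "\<lambda>m. real_of_int (lo (m + a) m q1 q2)" and ?up = "\<lambda>m. up B (m + a) m q1 q2"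
  let ?n = "q2 div G a q1 q2"
  have q2pos: "q2 > 0" using q by simp
  \<comment> \<open>The rounding error 1 of a column is swallowed by N \<rho> / q1, which is at
    least 1 as q1 \<le> N; the constant is 4 * (18 + 1) = 76.\<close>
  have err: "(4 * real_of_int N) * (2 * E / q1 + 1) \<le> 76 * (real_of_int N)^2 * \<rho> / q1"
  proof -
    have "real_of_int q1 * 1 \<le> real_of_int N * \<rho>" using q \<rho> BN by (intro mult_mono) auto
    then have "1 \<le> real_of_int N * \<rho> / q1" using q by (simp add: field_simps)
    then have "2 * E / q1 + 1 \<le> 2 * E / q1 + real_of_int N * \<rho> / q1" by simp
    also have "\<dots> = 19 * (real_of_int N * \<rho> / q1)" unfolding E_def by (simp add: field_simps)
    finally have "(4 * real_of_int N) * (2 * E / q1 + 1) \<le> (4 * real_of_int N) * (19 * (real_of_int N * \<rho> / q1))"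
      using BN by (intro mult_left_mono) auto
    then show ?thesis by (simp add: power2_eq_square)
  qed
  have up: "real_of_int ?n * T B a q1 q2 \<le> (\<Sum>m\<in>{-N..N}. ?w m / q1) + (4 * real_of_int N) * (2 * E / q1 + 1)"
  proof -
    let ?K = "\<lambda>m. {k::int. (?lo m - E) < ((m + a)^2) + k * q1 \<and> ((m + a)^2) + k * q1 \<le> ?up m + E}"
    let ?S' = "Sigma {-N..2*N} ?K"
    have fin: "finite (?K m)" for m using card_int_interval_upper(1)[OF q(1), of "?lo m - E" "(m+a)^2" "?up m + E"] by simp
    have "?n * int (T B a q1 q2) \<le> int (card ?S')"
      unfolding T_def G_def
    proof (rule coset_count_upper[where \<rho> = \<rho>, OF q2pos refl reps])
      show "finite ?S'" using fin by auto
      fix m k u v assume mk: "(m, k) \<in> Reg B a q1 q2" and uv: "\<bar>u\<bar> \<le> \<rho>" "\<bar>v\<bar> \<le> \<rho>"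
      note b = Reg_bounds[OF B0 q(1,3) mk]
      have mN: "1 \<le> m" "m \<le> N" "1 \<le> m + a" "m + a \<le> N" using b BN by linarith+
      let ?d = "(m + a)^2 + k * q1" and ?d' = "(m + u + a)^2 + (k + v) * q1"
      have h: "lo (m + a) m q1 q2 < ?d" "?d < (m + a + q1)^2" "?d < (m + q2)^2" "real_of_int ?d \<le> B^2"
        using mk unfolding Reg_def by auto
      have "real_of_int ?d \<le> (m + a + q1)^2" "real_of_int ?d \<le> (m + q2)^2"
        using h(2,3) by (simp_all only: of_int_le_iff less_imp_le)
      then have d_up: "real_of_int ?d \<le> ?up m" using h(4) unfolding up_def by simp
      have "\<bar>((m + a + u)^2 + (k + v) * q1) - ?d\<bar> \<le> 4 * N * \<rho>"
        by (rule d_shift) (use mN q uv \<rho> in auto)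
      then have d: "\<bar>?d' - ?d\<bar> \<le> 4 * N * \<rho>" by (simp add: add_ac)
      have l: "lo (m + u + a) (m + u) q1 q2 \<le> lo (m + a) m q1 q2 + 5 * N * \<rho>"
        using lo_shift[of "m + a" N m q1 q2 u \<rho>] mN q uv \<rho> by (simp add: add_ac)
      have u: "?up m \<le> ?up (m + u) + 5 * real_of_int N * \<rho>"
        using up_shift[of "m + a" N m q1 q2 u \<rho> B] mN q uv \<rho> by (simp add: add_ac)
      have "lo (m + u + a) (m + u) q1 q2 - 9 * N * \<rho> < ?d'" using d l h(1) by linarith
      then have "real_of_int (lo (m + u + a) (m + u) q1 q2 - 9 * N * \<rho>) < real_of_int ?d'" by (simp only: of_int_less_iff)
      then have 1: "?lo (m + u) - E < real_of_int ?d'" unfolding E_def by (simp add: add_ac)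
      have "?d' \<le> ?d + 4 * N * \<rho>" using d by linarith
      then have "real_of_int ?d' \<le> real_of_int (?d + 4 * N * \<rho>)" by (simp only: of_int_le_iff)
      then have "real_of_int ?d' \<le> real_of_int ?d + 4 * real_of_int N * \<rho>" by simp
      then have 2: "real_of_int ?d' \<le> ?up (m + u) + E" using u d_up unfolding E_def by linarith
      have "- N \<le> m + u" "m + u \<le> 2 * N" using mN uv \<rho> by linarith+
      then show "(m + u, k + v) \<in> ?S'" using 1 2 by simp
    qed
    then have "real_of_int (?n * int (T B a q1 q2)) \<le> real_of_int (int (card ?S'))" by (simp only: of_int_le_iff)
    then have "real_of_int ?n * T B a q1 q2 \<le> real (card ?S')" by simp
    also have "\<dots> = (\<Sum>m\<in>{-N..2*N}. real (card (?K m)))" using fin by (subst card_SigmaI) auto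
    also have "\<dots> \<le> (\<Sum>m\<in>{-N..2*N}. ?w m / q1 + (2 * E / q1 + 1))"
    proof (rule sum_mono)
      fix m assume "m \<in> {-N..2*N}"
      have "real (card (?K m)) \<le> max 0 ((?up m + E) - (?lo m - E)) / q1 + 1"
        using card_int_interval_upper(2)[OF q(1), of "?lo m - E" "(m+a)^2" "?up m + E"] by simp
      also have "max 0 ((?up m + E) - (?lo m - E)) / q1 \<le> (?w m + 2 * E) / q1"
        using E0 q unfolding width_def by (intro divide_right_mono) auto
      finally show "real (card (?K m)) \<le> ?w m / q1 + (2 * E / q1 + 1)" by (simp add: add_divide_distrib)
    qed
    also have "\<dots> = (\<Sum>m\<in>{-N..2*N}. ?w m / q1) + (3 * real_of_int N + 1) * (2 * E / q1 + 1)"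
      using BN by (simp add: sum.distrib)
    also have "(\<Sum>m\<in>{-N..2*N}. ?w m / q1) = (\<Sum>m\<in>{-N..N}. ?w m / q1)"
      by (rule sum.mono_neutral_right) (use width_eq_0[OF B0 q(1,3)] BN in auto)
    also have "(3 * real_of_int N + 1) * (2 * E / q1 + 1) \<le> (4 * real_of_int N) * (2 * E / q1 + 1)"
      using BN E0 q by (intro mult_right_mono) auto
    finally show ?thesis by simp
  qed
  have low: "(\<Sum>m\<in>{-N..N}. ?w m / q1) - (4 * real_of_int N) * (2 * E / q1 + 1) \<le> real_of_int ?n * T B a q1 q2"
  proof -
    let ?K = "\<lambda>m. {k::int. (?lo m + E) < ((m + a)^2) + k * q1 \<and> ((m + a)^2) + k * q1 < ?up m - E}"
    let ?S' = "Sigma {-N..N} ?K"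
    have fin: "finite (?K m)" for m using card_int_interval_lower(1)[OF q(1), of "?lo m + E" "(m+a)^2" "?up m - E"] by simp
    have "int (card ?S') \<le> ?n * int (T B a q1 q2)"
      unfolding T_def G_def
    proof (rule coset_count_lower[where \<rho> = \<rho>, OF q2pos Ga[unfolded G_def] refl reps])
      show "finite (Reg B a q1 q2)" using finite_Reg[OF B q(1,3)] .
      fix m k u v assume mk: "(m, k) \<in> ?S'" and uv: "\<bar>u\<bar> \<le> \<rho>" "\<bar>v\<bar> \<le> \<rho>"
      have h: "?lo m + E < real_of_int ((m + a)^2 + k * q1)" "real_of_int ((m + a)^2 + k * q1) < ?up m - E"
        using mk by auto
      \<comment> \<open>A point of the shrunken region makes the original interval of its column
        nonempty; this confines m and m + a to [1, B), as the shift bounds require.\<close>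
      have "?lo m < ?up m" using h E0 by linarith
      note b = width_pos_bounds[OF B0 q(1,3) this]
      have mN: "1 \<le> m" "m \<le> N" "1 \<le> m + a" "m + a \<le> N" using b BN by linarith+
      let ?d = "(m + a)^2 + k * q1" and ?d' = "(m - u + a)^2 + (k - v) * q1"
      have "\<bar>((m + a + (-u))^2 + (k + (-v)) * q1) - ?d\<bar> \<le> 4 * N * \<rho>"
        by (rule d_shift) (use mN q uv \<rho> in auto)
      moreover have "m + a + (-u) = m - u + a" "k + (-v) = k - v" by auto
      ultimately have d: "\<bar>?d' - ?d\<bar> \<le> 4 * N * \<rho>" by (simp only:)
      have "\<bar>real_of_int (?d' - ?d)\<bar> \<le> real_of_int (4 * N * \<rho>)" using d by (simp only: of_int_le_iff flip: of_int_abs)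
      then have d: "\<bar>real_of_int ?d' - real_of_int ?d\<bar> \<le> 4 * real_of_int N * \<rho>" by simp
      have e: "m + a + - u = m - u + a" "m + - u = m - u" by auto
      have "lo (m - u + a) (m - u) q1 q2 \<le> lo (m + a) m q1 q2 + 5 * N * \<rho>"
        using lo_shift[of "m + a" N m q1 q2 "-u" \<rho>, unfolded e] mN q uv \<rho> by simp
      then have "?lo (m - u) \<le> real_of_int (lo (m + a) m q1 q2 + 5 * N * \<rho>)" by (simp only: of_int_le_iff)
      then have l: "?lo (m - u) \<le> ?lo m + 5 * real_of_int N * \<rho>" by simp
      have u: "?up m \<le> ?up (m - u) + 5 * real_of_int N * \<rho>"
        using up_shift[of "m + a" N m q1 q2 "-u" \<rho> B, unfolded e] mN q uv \<rho> by simp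
      have "?lo (m - u) < real_of_int ?d'" using d l h unfolding E_def by linarith
      then have 1: "lo (m - u + a) (m - u) q1 q2 < ?d'" by (simp only: of_int_less_iff)
      have 2: "real_of_int ?d' < ?up (m - u)" using d u h unfolding E_def by linarith
      then have "real_of_int ?d' < real_of_int ((m - u + a + q1)^2)" "real_of_int ?d' < real_of_int ((m - u + q2)^2)"
         "real_of_int ?d' \<le> B^2" unfolding up_def by (simp_all only: min_less_iff_conj less_imp_le)
      then show "(m - u, k - v) \<in> Reg B a q1 q2" using 1 unfolding Reg_def of_int_less_iff by blast
    qed
    then have "real_of_int (int (card ?S')) \<le> real_of_int (?n * int (T B a q1 q2))" by (simp only: of_int_le_iff)
    then have *: "real (card ?S') \<le> real_of_int ?n * T B a q1 q2" by simp
    have "(\<Sum>m\<in>{-N..N}. ?w m / q1) - (4 * real_of_int N) * (2 * E / q1 + 1) \<le>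
       (\<Sum>m\<in>{-N..N}. ?w m / q1) - (2 * real_of_int N + 1) * (2 * E / q1 + 1)"
      using BN E0 q by (intro diff_left_mono mult_right_mono) auto
    also have "\<dots> = (\<Sum>m\<in>{-N..N}. ?w m / q1 - (2 * E / q1 + 1))"
      using BN by (simp add: sum_subtractf)
    also have "\<dots> \<le> (\<Sum>m\<in>{-N..N}. real (card (?K m)))"
    proof (rule sum_mono)
      fix m assume "m \<in> {-N..N}"
      have "((?up m - E) - (?lo m + E)) / q1 - 1 \<le> real (card (?K m))"
        using card_int_interval_lower(2)[OF q(1), of "?up m - E" "?lo m + E" "(m+a)^2"] by simp
      moreover have "0 \<le> real (card (?K m))" by simp
      moreover have "0 \<le> 2 * E / q1" using E0 q by simp
      \<comment> \<open>For an empty interval \<open>width\<close> is 0 and the left side is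
        negative.\<close>
      ultimately show "?w m / q1 - (2 * E / q1 + 1) \<le> real (card (?K m))"
        by (cases "?lo m < ?up m") (auto simp: width_def max_def add_divide_distrib diff_divide_distrib)
    qed
    also have "\<dots> = real (card ?S')" using fin by (subst card_SigmaI) auto
    finally show ?thesis using * by simp
  qed
  show ?thesis using up low err by (simp add: abs_le_iff)
qed


section \<open>Exceptional triples\<close>

text \<open>The lattice of the homogeneous congruence behind \<open>T\<close> has a nonzero vector
  in the X-box; the negation supplies the hypothesis \<open>no\<close> of
  \<open>representatives_of_no_small_vector\<close>.\<close>

definition Bad :: "int \<Rightarrow> int \<Rightarrow> int \<Rightarrow> int \<Rightarrow> bool" where
  "Bad X a q1 q2 \<longleftrightarrow> (\<exists>r t. (r \<noteq> 0 \<or> t \<noteq> 0) \<and> \<bar>r\<bar> \<le> X \<and> \<bar>t\<bar> \<le> X \<and> q2 dvd (2 * a) * r + q1 * t)"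

text \<open>The equation determines a from (q1, q2) if r is nonzero, and q1 from (a, q2) otherwise,
  leaving at most N^2 or (2 N + 1) N triples.\<close>

lemma card_plane_le:
  fixes r t s N :: int
  assumes N: "N \<ge> 1" and rt: "r \<noteq> 0 \<or> t \<noteq> 0"
  shows "int (card {(a, q1, q2) \<in> Tr N. (2 * a) * r + q1 * t = s * q2}) \<le> 3 * N^2"
proof (cases "r = 0")
  case False
  have "card {(a, q1, q2) \<in> Tr N. (2 * a) * r + q1 * t = s * q2} \<le> card ({1..N} \<times> {1..N})"
  proof (rule card_inj_on_le[where f = "\<lambda>(a, q1, q2). (q1, q2)"])
    show "inj_on (\<lambda>(a, q1, q2). (q1, q2)) {(a, q1, q2) \<in> Tr N. (2 * a) * r + q1 * t = s * q2}"
    proof (rule inj_onI, clarsimp)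
      fix a a' q1 q2 assume "2 * a * r + q1 * t = s * q2" "2 * a' * r + q1 * t = s * q2"
      then have "2 * a * r = 2 * a' * r" by linarith
      then show "a = a'" using False by simp
    qed
  qed (auto simp: Tr_def)
  then have "int (card {(a, q1, q2) \<in> Tr N. (2 * a) * r + q1 * t = s * q2}) \<le> int (card ({1..N} \<times> {1..N}))" by linarith
  also have "\<dots> = N^2" using N by (simp add: card_cartesian_product power2_eq_square)
  finally show ?thesis by simp
next
  case True
  then have t: "t \<noteq> 0" using rt by simp
  have "card {(a, q1, q2) \<in> Tr N. (2 * a) * r + q1 * t = s * q2} \<le> card ({-N..N} \<times> {1..N})"
  proof (rule card_inj_on_le[where f = "\<lambda>(a, q1, q2). (a, q2)"])
    show "inj_on (\<lambda>(a, q1, q2). (a, q2)) {(a, q1, q2) \<in> Tr N. (2 * a) * r + q1 * t = s * q2}"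
    proof (rule inj_onI, clarsimp simp: True)
      fix q1 q1' q2 assume "q1 * t = s * q2" "q1' * t = s * q2"
      then have "q1 * t = q1' * t" by linarith
      then show "q1 = q1'" using t by simp
    qed
  qed (auto simp: Tr_def)
  then have "int (card {(a, q1, q2) \<in> Tr N. (2 * a) * r + q1 * t = s * q2}) \<le> int (card ({-N..N} \<times> {1..N}))" by linarith
  also have "\<dots> = (2 * N + 1) * N" using N by (simp add: card_cartesian_product)
  also have "\<dots> \<le> (3 * N) * N" using N by (intro mult_right_mono) auto
  finally show ?thesis by (simp add: power2_eq_square)
qed

text \<open>A bad triple lies on a plane 2 a r + q1 t = q2 s with |q2 s| \<le> 3 N X, so q2 \<ge> Q
  gives |s| \<le> 3 N X / Q. There are at most 9 X^2 * 7 N X / Q choices of (r, t, s) and at most 3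
  N^2 triples on each plane, whence 189 = 9 * 7 * 3.\<close>

lemma card_Bad_le:
  fixes N X :: int and Q :: real
  assumes N: "N \<ge> 1" and X: "X \<ge> 1" and Q: "0 < Q" "Q \<le> N"
  shows "real (card {(a, q1, q2) \<in> Tr N. Q \<le> q2 \<and> Bad X a q1 q2}) \<le> 189 * (real_of_int X)^3 * (real_of_int N)^3 / Q"
proof -
  define S where "S = \<lfloor>3 * real_of_int N * X / Q\<rfloor>"
  have S0: "S \<ge> 0" unfolding S_def using N X Q by simp
  let ?I = "{(r, t, s). (r \<noteq> 0 \<or> t \<noteq> 0) \<and> (r, t, s) \<in> {-X..X} \<times> {-X..X} \<times> {-S..S}}"
  let ?P = "\<lambda>(r, t, s). {(a, q1, q2) \<in> Tr N. (2 * a) * r + q1 * t = s * q2}"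
  have finI: "finite ?I" by (rule finite_subset[of _ "{-X..X} \<times> {-X..X} \<times> {-S..S}"]) auto
  have finP: "finite (?P i)" for i by (cases i) (auto intro: finite_subset[OF _ finite_Tr[of N]])
  have "{(a, q1, q2) \<in> Tr N. Q \<le> q2 \<and> Bad X a q1 q2} \<subseteq> (\<Union>i\<in>?I. ?P i)"
  proof
    fix z assume z: "z \<in> {(a, q1, q2) \<in> Tr N. Q \<le> q2 \<and> Bad X a q1 q2}"
    obtain a q1 q2 where zz: "z = (a, q1, q2)" by (cases z)
    have h: "(a, q1, q2) \<in> Tr N" "Q \<le> q2" "Bad X a q1 q2" using z zz by auto
    obtain r t where rt: "r \<noteq> 0 \<or> t \<noteq> 0" "\<bar>r\<bar> \<le> X" "\<bar>t\<bar> \<le> X" "q2 dvd (2 * a) * r + q1 * t"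
      using h(3) unfolding Bad_def by blast
    obtain s where s: "(2 * a) * r + q1 * t = q2 * s" using rt(4) by (elim dvdE)
    have tr: "\<bar>a\<bar> \<le> N" "1 \<le> q1" "q1 \<le> N" "1 \<le> q2" using h(1) unfolding Tr_def by auto
    have "\<bar>(2 * a) * r\<bar> \<le> (2 * N) * X" unfolding abs_mult using tr rt by (intro mult_mono) auto
    moreover have "\<bar>q1 * t\<bar> \<le> N * X" unfolding abs_mult using tr rt by (intro mult_mono) auto
    ultimately have "\<bar>q2 * s\<bar> \<le> 3 * N * X" unfolding s[symmetric] by linarith
    then have "real_of_int \<bar>q2 * s\<bar> \<le> real_of_int (3 * N * X)" by (simp only: of_int_le_iff)
    then have "real_of_int q2 * \<bar>real_of_int s\<bar> \<le> 3 * real_of_int N * X" using tr by (simp add: abs_mult)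
    moreover have "Q * \<bar>real_of_int s\<bar> \<le> real_of_int q2 * \<bar>real_of_int s\<bar>" using h(2) by (intro mult_right_mono) auto
    ultimately have "\<bar>real_of_int s\<bar> \<le> 3 * real_of_int N * X / Q" using Q by (simp add: field_simps)
    then have "\<bar>s\<bar> \<le> S" unfolding S_def by linarith
    then have "(r, t, s) \<in> ?I" using rt by auto
    moreover have "z \<in> ?P (r, t, s)" using zz h(1) s by (simp add: mult.commute)
    ultimately show "z \<in> (\<Union>i\<in>?I. ?P i)" by blast
  qed
  then have "card {(a, q1, q2) \<in> Tr N. Q \<le> q2 \<and> Bad X a q1 q2} \<le> card (\<Union>i\<in>?I. ?P i)"
    using finI finP by (intro card_mono) auto
  also have "\<dots> \<le> (\<Sum>i\<in>?I. card (?P i))" by (rule card_UN_le[OF finI])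
  finally have "int (card {(a, q1, q2) \<in> Tr N. Q \<le> q2 \<and> Bad X a q1 q2}) \<le> (\<Sum>i\<in>?I. int (card (?P i)))"
    by (simp flip: of_nat_sum)
  also have "\<dots> \<le> (\<Sum>i\<in>?I. 3 * N^2)"
  proof (rule sum_mono)
    fix i assume "i \<in> ?I"
    then show "int (card (?P i)) \<le> 3 * N^2" using card_plane_le[OF N] by (cases i) auto
  qed
  also have "\<dots> = int (card ?I) * (3 * N^2)" by simp
  finally have "real_of_int (int (card {(a, q1, q2) \<in> Tr N. Q \<le> q2 \<and> Bad X a q1 q2})) \<le> real_of_int (int (card ?I) * (3 * N^2))"
    by (simp only: of_int_le_iff)
  then have 1: "real (card {(a, q1, q2) \<in> Tr N. Q \<le> q2 \<and> Bad X a q1 q2}) \<le> real (card ?I) * (3 * (real_of_int N)^2)" by simp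
  have "card ?I \<le> card ({-X..X} \<times> {-X..X} \<times> {-S..S})" by (intro card_mono) auto
  then have "real (card ?I) \<le> real (card ({-X..X} \<times> {-X..X} \<times> {-S..S}))" by (simp only: of_nat_le_iff)
  also have "\<dots> = (2 * real_of_int X + 1) * (2 * real_of_int X + 1) * (2 * real_of_int S + 1)"
    using X S0 by (simp add: card_cartesian_product mult.assoc)
  also have "\<dots> \<le> (3 * real_of_int X) * (3 * real_of_int X) * (7 * real_of_int N * X / Q)"
  proof -
    have "real_of_int S \<le> 3 * real_of_int N * X / Q" unfolding S_def by linarith
    moreover have "1 \<le> real_of_int N * X / Q"
    proof -
      have "Q * 1 \<le> real_of_int N * X" using Q X N by (intro mult_mono) auto
      then show ?thesis using Q by (simp add: field_simps)
    qed
    moreover have "3 * real_of_int N * X / Q = 3 * (real_of_int N * X / Q)" "7 * real_of_int N * X / Q = 7 * (real_of_int N * X / Q)" by simp_all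
    ultimately have "2 * real_of_int S + 1 \<le> 7 * real_of_int N * X / Q" by linarith
    then show ?thesis using X S0 by (intro mult_mono) auto
  qed
  finally have 2: "real (card ?I) \<le> 63 * (real_of_int X)^3 * N / Q" by (simp add: power3_eq_cube mult_ac)
  have "real (card ?I) * (3 * (real_of_int N)^2) \<le> 63 * (real_of_int X)^3 * N / Q * (3 * (real_of_int N)^2)"
    using 2 by (intro mult_right_mono) auto
  also have "\<dots> = 189 * (real_of_int X)^3 * (real_of_int N)^3 / Q" by (simp add: power2_eq_square power3_eq_cube)
  finally show ?thesis using 1 by linarith
qed


section \<open>Comparison of \<open>W\<close> with the weighted sum of \<open>Ph\<close>\<close>

definition omega :: "int \<Rightarrow> int \<Rightarrow> int \<Rightarrow> real" where
  "omega a q1 q2 = (if G a q1 q2 dvd a^2 then G a q1 q2 else 0)"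

lemma T_eq_0:
  assumes "\<not> G a q1 q2 dvd a^2"
  shows "T B a q1 q2 = 0"
proof -
  have "\<not> q2 dvd (2 * a) * m + q1 * k + a^2" for m k
  proof
    assume "q2 dvd (2 * a) * m + q1 * k + a^2"
    then have "G a q1 q2 dvd (2 * a) * m + q1 * k + a^2" using G_dvd(3) dvd_trans by blast
    moreover have "G a q1 q2 dvd (2 * a) * m + q1 * k" using G_dvd(1,2) by (meson dvd_add dvd_mult2)
    ultimately show False using assms dvd_add_right_iff by blast
  qed
  then show ?thesis unfolding T_def by simp
qed

text \<open>Multiplying the estimate of \<open>coset_count_Reg\<close> by G / q2 gives the error 76
  N^2 \<rho> G / (q1 q2). Since X^2 and X P are both at most N, the choice \<rho> = 2 max X P is at
  most 2 N / X.\<close>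

lemma T_approx_good:
  fixes Q :: real
  assumes B: "B \<ge> 1" and N: "N = \<lfloor>2 * B\<rfloor>" and tr: "(a, q1, q2) \<in> Tr N"
    and X: "X \<ge> 1" "X^2 \<le> N" "2 * X \<le> N" and Q: "0 < Q" "Q \<le> q1" "Q \<le> q2"
    and good: "\<not> Bad X a q1 q2"
  shows "\<bar>T B a q1 q2 - omega a q1 q2 * Ph B N a q1 q2\<bar> \<le> 152 * (real_of_int N)^3 / (X * Q^2) * G a q1 q2"
proof (cases "G a q1 q2 dvd a^2")
  case False
  have "G a q1 q2 > 0" using G_pos tr unfolding Tr_def by auto
  then show ?thesis using False T_eq_0[OF False] X Q tr unfolding omega_def Tr_def by simp
next
  case True
  have q: "1 \<le> q1" "q1 \<le> N" "1 \<le> q2" "q2 \<le> N" using tr unfolding Tr_def by auto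
  have G0: "G a q1 q2 > 0" using G_pos[OF q(1)] .
  define P where "P = q2 div (X + 1)"
  define \<rho> where "\<rho> = 2 * max X P"
  have PX: "(X + 1) * P \<le> q2" unfolding P_def using X by (simp add: minus_mod_eq_mult_div[symmetric])
  have P0: "P \<ge> 0" unfolding P_def using X q by (simp add: pos_imp_zdiv_nonneg_iff)
  have "X * P \<le> (X + 1) * P" using P0 by (simp add: algebra_simps)
  then have XP: "X * P \<le> N" using PX q by linarith
  have "2 * P \<le> (X + 1) * P" using P0 X by (intro mult_right_mono) auto
  then have "2 * P \<le> N" using PX q by linarith
  then have \<rho>: "1 \<le> \<rho>" "\<rho> \<le> N" unfolding \<rho>_def using X by auto
  have "X * \<rho> \<le> 2 * N" unfolding \<rho>_def using XP X by (simp add: max_def power2_eq_square)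
  then have "real_of_int (X * \<rho>) \<le> real_of_int (2 * N)" by (simp only: of_int_le_iff)
  then have \<rho>X: "real_of_int \<rho> \<le> 2 * real_of_int N / X" using X by (simp add: field_simps)
  have reps: "\<exists>u v. \<bar>u\<bar> \<le> \<rho> \<and> \<bar>v\<bar> \<le> \<rho> \<and> q2 dvd (2 * a) * (M - u) + q1 * (K - v)" for M K
    unfolding \<rho>_def P_def using good q X
    by (intro representatives_of_no_small_vector) (auto simp: Bad_def)
  let ?n = "q2 div G a q1 q2"
  have "q2 = G a q1 q2 * ?n" using G_dvd(3) by simp
  then have "real_of_int q2 = real_of_int (G a q1 q2 * ?n)" by (simp only:)
  then have qn: "real_of_int q2 = G a q1 q2 * real_of_int ?n" by simp
  have Ph: "(\<Sum>m\<in>{-N..N}. width B (m + a) m q1 q2 / q1) = q2 * Ph B N a q1 q2"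
    unfolding Ph_def sum_distrib_left using q by (intro sum.cong) auto
  have m: "\<bar>real_of_int ?n * T B a q1 q2 - q2 * Ph B N a q1 q2\<bar> \<le> 76 * (real_of_int N)^2 * \<rho> / q1"
    using coset_count_Reg[OF B N q \<rho> True reps] unfolding Ph .
  have "q2 * (T B a q1 q2 - G a q1 q2 * Ph B N a q1 q2) = G a q1 q2 * (real_of_int ?n * T B a q1 q2 - q2 * Ph B N a q1 q2)"
    using qn by (simp add: algebra_simps)
  then have "T B a q1 q2 - G a q1 q2 * Ph B N a q1 q2 = G a q1 q2 * (real_of_int ?n * T B a q1 q2 - q2 * Ph B N a q1 q2) / q2"
    using q by (simp add: field_simps)
  then have "\<bar>T B a q1 q2 - G a q1 q2 * Ph B N a q1 q2\<bar> = G a q1 q2 * \<bar>real_of_int ?n * T B a q1 q2 - q2 * Ph B N a q1 q2\<bar> / q2"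
    using G0 q by (simp add: abs_mult)
  also have "\<dots> \<le> G a q1 q2 * (76 * (real_of_int N)^2 * (2 * real_of_int N / X) / Q) / Q"
  proof (rule frac_le)
    have "76 * (real_of_int N)^2 * \<rho> / q1 \<le> 76 * (real_of_int N)^2 * (2 * real_of_int N / X) / Q"
      using \<rho>X Q q \<rho> X by (intro frac_le mult_left_mono) auto
    then show "G a q1 q2 * \<bar>real_of_int ?n * T B a q1 q2 - q2 * Ph B N a q1 q2\<bar>
      \<le> G a q1 q2 * (76 * (real_of_int N)^2 * (2 * real_of_int N / X) / Q)"
      using m G0 by (intro mult_left_mono) auto
    then show "0 \<le> G a q1 q2 * (76 * (real_of_int N)^2 * (2 * real_of_int N / X) / Q)"
      using G0 X Q q by (intro mult_nonneg_nonneg divide_nonneg_nonneg) auto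
  qed (use Q in auto)
  also have "\<dots> = 152 * (real_of_int N)^3 / (X * Q^2) * G a q1 q2"
    by (simp add: power2_eq_square power3_eq_cube mult_ac)
  finally show ?thesis using True unfolding omega_def by simp
qed

lemma omega_bounds: "1 \<le> q1 \<Longrightarrow> 0 \<le> omega a q1 q2 \<and> omega a q1 q2 \<le> G a q1 q2"
  unfolding omega_def using G_pos[of q1 a q2] by auto

text \<open>Three kinds of triple occur: those with some q_i < Q, where \<open>T_bound\<close> is
  summed; those without a small lattice vector, where \<open>T_approx_good\<close> applies; and the
  exceptional ones, where both terms are bounded trivially. On the last kind the weight G is either
  at most D, and the number of such triples is small, or it belongs to the tail G > D.\<close>

lemma W_arith_approx:
  fixes Q n :: real and N X D :: int
  assumes B: "B \<ge> 1" and N: "N = \<lfloor>2 * B\<rfloor>"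
    and X: "X \<ge> 1" "X^2 \<le> N" "2 * X \<le> N" and D: "D \<ge> 1" and Q: "0 < Q" "Q \<le> N"
  defines "n \<equiv> real_of_int N"
  shows "\<bar>W (B^2) - (\<Sum>(a, q1, q2)\<in>Tr N. if Q \<le> q1 \<and> Q \<le> q2 then omega a q1 q2 * Ph B N a q1 q2 else 0)\<bar>
    \<le> 1600 * n^3 * (sqrt Q * sqrt n) + 24 * n^2 / Q * (189 * D * X^3 * n^3 / Q + 5 * n^3 / D) + 1520 * n^6 / (X * Q^2)"
proof -
  have N1: "N \<ge> 1" using X by linarith
  have n0: "n \<ge> 1" unfolding n_def using N1 by simp
  let ?g = "\<lambda>t. case t of (a, q1, q2) \<Rightarrow> real_of_int (G a q1 q2)"
  let ?e1 = "\<lambda>Q1 Q2 t. case t of (a, q1, q2) \<Rightarrow> G a q1 q2 * (if real_of_int q1 \<le> Q1 then 1 / sqrt (real_of_int q1) else 0) * (if real_of_int q2 \<le> Q2 then 1 / sqrt (real_of_int q2) else 0)"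
  let ?bad = "\<lambda>t. case t of (a, q1, q2) \<Rightarrow> Q \<le> real_of_int q2 \<and> Bad X a q1 q2"
  let ?tail = "\<lambda>t. case t of (a, q1, q2) \<Rightarrow> if G a q1 q2 > D then real_of_int (G a q1 q2) else 0"
  let ?bound = "\<lambda>t. 20 * n^2 * ?e1 Q n t + 20 * n^2 * ?e1 n Q t
       + 24 * n^2 / Q * ((if ?bad t then real_of_int D else 0) + ?tail t) + 152 * n^3 / (X * Q^2) * ?g t"
  have pw: "\<bar>real (T B a q1 q2) - (if Q \<le> q1 \<and> Q \<le> q2 then omega a q1 q2 * Ph B N a q1 q2 else 0)\<bar> \<le> ?bound (a, q1, q2)"
    if tr: "(a, q1, q2) \<in> Tr N" for a q1 q2
  proof -
    have q: "1 \<le> q1" "q1 \<le> N" "1 \<le> q2" "q2 \<le> N" using tr unfolding Tr_def by auto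
    have qr: "real_of_int q1 \<le> n" "real_of_int q2 \<le> n" using q unfolding n_def by auto
    have G0: "G a q1 q2 > 0" using G_pos[OF q(1)] .
    have nn: "0 \<le> ?e1 Q n (a, q1, q2)" "0 \<le> ?e1 n Q (a, q1, q2)" "0 \<le> (if ?bad (a, q1, q2) then real_of_int D else 0)"
      "0 \<le> ?tail (a, q1, q2)" "0 \<le> ?g (a, q1, q2)" using G0 q D by auto
    have c: "0 \<le> 20 * n^2" "0 \<le> 24 * n^2 / Q" "0 \<le> 152 * n^3 / (X * Q^2)" using Q X n0 by auto
    have nn': "0 \<le> 20 * n^2 * ?e1 Q n (a, q1, q2)" "0 \<le> 20 * n^2 * ?e1 n Q (a, q1, q2)"
      "0 \<le> 24 * n^2 / Q * ((if ?bad (a, q1, q2) then real_of_int D else 0) + ?tail (a, q1, q2))"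
      "0 \<le> 152 * n^3 / (X * Q^2) * ?g (a, q1, q2)"
      by (rule mult_nonneg_nonneg; use c nn in linarith)+
    have Tb: "real (T B a q1 q2) \<le> 20 * n^2 * G a q1 q2 / (sqrt q1 * sqrt q2)"
      using T_bound[OF B N q] unfolding n_def .
    show ?thesis
    proof (cases "Q \<le> q1 \<and> Q \<le> q2")
      case False
      then have z: "(if Q \<le> q1 \<and> Q \<le> q2 then omega a q1 q2 * Ph B N a q1 q2 else 0) = 0" by (rule if_not_P)
      show ?thesis
      proof (cases "Q \<le> q1")
        case True
        then have "20 * n^2 * G a q1 q2 / (sqrt q1 * sqrt q2) = 20 * n^2 * ?e1 n Q (a, q1, q2)"
          using False qr by simp
        moreover have "real (T B a q1 q2) \<ge> 0" by simp
        ultimately show ?thesis using Tb nn' unfolding z by linarith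
      next
        case False': False
        then have "20 * n^2 * G a q1 q2 / (sqrt q1 * sqrt q2) = 20 * n^2 * ?e1 Q n (a, q1, q2)"
          using False qr by simp
        moreover have "real (T B a q1 q2) \<ge> 0" by simp
        ultimately show ?thesis using Tb nn' unfolding z by linarith
      qed
    next
      case True
      then have z: "(if Q \<le> q1 \<and> Q \<le> q2 then omega a q1 q2 * Ph B N a q1 q2 else 0) = omega a q1 q2 * Ph B N a q1 q2" by (rule if_P)
      show ?thesis
      proof (cases "Bad X a q1 q2")
        case False
        have "\<bar>T B a q1 q2 - omega a q1 q2 * Ph B N a q1 q2\<bar> \<le> 152 * n^3 / (X * Q^2) * ?g (a, q1, q2)"
          using T_approx_good[OF B N tr X Q(1) _ _ False] True unfolding n_def by simp
        then show ?thesis using nn' unfolding z by linarith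
      next
        case bad: True
        \<comment> \<open>The constant 24 arises as 20 from \<open>T_bound\<close> plus 4 from
          \<open>Ph_bound\<close>.\<close>
        have "omega a q1 q2 * Ph B N a q1 q2 \<le> G a q1 q2 * (4 * n^2 / (sqrt q1 * sqrt q2))"
          using omega_bounds[OF q(1), of a q2] Ph_bound[OF B N q(1,3), of a] Ph_nonneg[OF q(1,3)] G0 unfolding n_def
          by (intro mult_mono) auto
        moreover have "0 \<le> omega a q1 q2 * Ph B N a q1 q2" using omega_bounds[OF q(1), of a q2] Ph_nonneg[OF q(1,3)] by simp
        moreover have "real (T B a q1 q2) \<ge> 0" by simp
        ultimately have "\<bar>T B a q1 q2 - omega a q1 q2 * Ph B N a q1 q2\<bar> \<le>
           20 * n^2 * G a q1 q2 / (sqrt q1 * sqrt q2) + G a q1 q2 * (4 * n^2 / (sqrt q1 * sqrt q2))" using Tb by linarith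
        also have "\<dots> = 24 * n^2 * G a q1 q2 / (sqrt q1 * sqrt q2)" by (simp add: field_simps)
        also have "\<dots> \<le> 24 * n^2 * G a q1 q2 / Q"
        proof (rule divide_left_mono)
          have "sqrt Q * sqrt Q \<le> sqrt q1 * sqrt q2" using True Q by (intro mult_mono) auto
          then show "Q \<le> sqrt q1 * sqrt q2" using Q by simp
        qed (use G0 Q q in auto)
        also have "\<dots> = 24 * n^2 / Q * G a q1 q2" by simp
        also have "\<dots> \<le> 24 * n^2 / Q * ((if ?bad (a, q1, q2) then real_of_int D else 0) + ?tail (a, q1, q2))"
          using True bad c D by (intro mult_left_mono) auto
        finally show ?thesis using nn' unfolding z by linarith
      qed
    qed
  qed
  have "\<bar>W (B^2) - (\<Sum>(a, q1, q2)\<in>Tr N. if Q \<le> q1 \<and> Q \<le> q2 then omega a q1 q2 * Ph B N a q1 q2 else 0)\<bar>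
    = \<bar>\<Sum>(a, q1, q2)\<in>Tr N. real (T B a q1 q2) - (if Q \<le> q1 \<and> Q \<le> q2 then omega a q1 q2 * Ph B N a q1 q2 else 0)\<bar>"
    unfolding W_eq_sum_T[OF B N] case_prod_unfold by (simp only: sum_subtractf)
  also have "\<dots> \<le> (\<Sum>t\<in>Tr N. ?bound t)"
    by (rule order_trans[OF sum_abs], rule sum_mono) (use pw in \<open>auto simp only: split_paired_all prod.case\<close>)
  also have "\<dots> = 20 * n^2 * (\<Sum>t\<in>Tr N. ?e1 Q n t) + 20 * n^2 * (\<Sum>t\<in>Tr N. ?e1 n Q t)
     + 24 * n^2 / Q * ((\<Sum>t\<in>Tr N. if ?bad t then real_of_int D else 0) + (\<Sum>t\<in>Tr N. ?tail t))
     + 152 * n^3 / (X * Q^2) * (\<Sum>t\<in>Tr N. ?g t)"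
    by (simp only: sum.distrib sum_distrib_left distrib_left)
  also have "\<dots> \<le> 20 * n^2 * (40 * n * sqrt Q * sqrt n) + 20 * n^2 * (40 * n * sqrt n * sqrt Q)
     + 24 * n^2 / Q * (D * (189 * X^3 * n^3 / Q) + 5 * n^3 / D)
     + 152 * n^3 / (X * Q^2) * (10 * n^3)"
  proof -
    have "(\<Sum>t\<in>Tr N. ?e1 Q n t) \<le> 40 * n * sqrt Q * sqrt n" "(\<Sum>t\<in>Tr N. ?e1 n Q t) \<le> 40 * n * sqrt n * sqrt Q"
      using sum_G_inverse_sqrt[OF N1, of Q n] sum_G_inverse_sqrt[OF N1, of n Q] n0 Q unfolding n_def by simp_all
    moreover have "(\<Sum>t\<in>Tr N. ?tail t) \<le> 5 * n^3 / D" using sum_G_tail[OF D N1] unfolding n_def .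
    moreover have "(\<Sum>t\<in>Tr N. ?g t) \<le> 10 * n^3" using sum_G[OF N1] unfolding n_def .
    moreover have "(\<Sum>t\<in>Tr N. if ?bad t then real_of_int D else 0) \<le> D * (189 * X^3 * n^3 / Q)"
    proof -
      have "(\<Sum>t\<in>Tr N. if ?bad t then real_of_int D else 0) = (\<Sum>t\<in>{t \<in> Tr N. ?bad t}. real_of_int D)"
        by (rule sum.inter_filter[symmetric]) simp
      also have "{t \<in> Tr N. ?bad t} = {(a, q1, q2) \<in> Tr N. Q \<le> q2 \<and> Bad X a q1 q2}" by auto
      also have "(\<Sum>t\<in>\<dots>. real_of_int D) = D * real (card {(a, q1, q2) \<in> Tr N. Q \<le> q2 \<and> Bad X a q1 q2})" by simp
      also have "\<dots> \<le> D * (189 * X^3 * n^3 / Q)"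
        using card_Bad_le[OF N1 X(1) Q] D unfolding n_def by (intro mult_left_mono) auto
      finally show ?thesis .
    qed
    ultimately show ?thesis using Q X n0 by (intro add_mono mult_left_mono) auto
  qed
  also have "\<dots> = 1600 * n^3 * (sqrt Q * sqrt n) + 24 * n^2 / Q * (189 * D * X^3 * n^3 / Q + 5 * n^3 / D) + 1520 * n^6 / (X * Q^2)"
    by (simp add: power2_eq_square power3_eq_cube eval_nat_numeral algebra_simps)
  finally show ?thesis .
qed


section \<open>Riemann sums over arithmetic progressions\<close>

definition lip :: "real \<Rightarrow> (real \<Rightarrow> real) \<Rightarrow> bool" where
  "lip K f \<longleftrightarrow> (\<forall>x y. \<bar>f x - f y\<bar> \<le> K * \<bar>x - y\<bar>)"

lemma lip_nonneg: "lip K f \<Longrightarrow> 0 \<le> K"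
proof -
  assume "lip K f"
  then have "\<bar>f 0 - f 1\<bar> \<le> K * \<bar>0 - 1\<bar>" unfolding lip_def by blast
  then have "\<bar>f 0 - f 1\<bar> \<le> K" by simp
  then show "0 \<le> K" by linarith
qed

lemma lip_continuous: "lip K f \<Longrightarrow> continuous_on S f"
proof -
  assume l: "lip K f"
  have "(max K 0)-lipschitz_on UNIV f"
  proof (rule lipschitz_onI)
    fix x y
    have "\<bar>f x - f y\<bar> \<le> K * \<bar>x - y\<bar>" using l unfolding lip_def by blast
    also have "\<dots> \<le> max K 0 * \<bar>x - y\<bar>" by (intro mult_right_mono) auto
    finally show "dist (f x) (f y) \<le> max K 0 * dist x y" by (simp add: dist_real_def)
  qed simp
  then have "continuous_on UNIV f" by (rule lipschitz_on_continuous_on)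
  then show ?thesis using continuous_on_subset by blast
qed

lemma lip_integrable: "lip K f \<Longrightarrow> f integrable_on {a..b}"
  by (intro integrable_continuous_real lip_continuous)

lemma integral_abs_le:
  fixes f :: "real \<Rightarrow> real"
  assumes "lip K f" "\<And>x. \<bar>f x\<bar> \<le> M" "a \<le> b"
  shows "\<bar>integral {a..b} f\<bar> \<le> M * (b - a)"
  using integral_bound[OF assms(3) lip_continuous[OF assms(1)], of M] assms(2) by simp

lemma riemann_block:
  assumes l: "lip K f" and h: "h > 0"
  shows "\<bar>h * (\<Sum>j<J. f (t + real j * h)) - integral {t..t + real J * h} f\<bar> \<le> real J * (K * h^2)"
proof (induction J)
  case (Suc J)
  let ?s = "t + real J * h"
  have e: "t + real (Suc J) * h = ?s + h" by (simp add: algebra_simps)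
  have c: "integral {t..?s} f + integral {?s..?s + h} f = integral {t..?s + h} f"
    by (rule Henstock_Kurzweil_Integration.integral_combine) (use h lip_integrable[OF l] in auto)
  have "h * f ?s - integral {?s..?s + h} f = integral {?s..?s + h} (\<lambda>x. f ?s - f x)"
    using h by (subst integral_diff) (auto intro: lip_integrable[OF l])
  also have "\<bar>\<dots>\<bar> \<le> (K * h) * (?s + h - ?s)"
  proof -
    have "norm (integral {?s..?s + h} (\<lambda>x. f ?s - f x)) \<le> (K * h) * (?s + h - ?s)"
    proof (rule integral_bound)
      show "continuous_on {?s..?s + h} (\<lambda>x. f ?s - f x)" by (intro continuous_intros lip_continuous[OF l])
      fix x assume x: "x \<in> {?s..?s + h}"
      have K: "0 \<le> K" by (rule lip_nonneg[OF l])
      have "\<bar>f ?s - f x\<bar> \<le> K * \<bar>?s - x\<bar>" using l unfolding lip_def by blast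
      also have "\<dots> \<le> K * h" using x K by (intro mult_left_mono) auto
      finally show "norm (f ?s - f x) \<le> K * h" by simp
    qed (use h in simp)
    then show ?thesis by simp
  qed
  finally have "\<bar>h * f ?s - integral {?s..?s + h} f\<bar> \<le> K * h^2" by (simp add: power2_eq_square)
  moreover have "h * (\<Sum>j<Suc J. f (t + real j * h)) = h * (\<Sum>j<J. f (t + real j * h)) + h * f ?s" by (simp add: algebra_simps)
  moreover have "real (Suc J) * (K * h^2) = real J * (K * h^2) + K * h^2" by (simp add: algebra_simps)
  ultimately show ?case using Suc.IH c unfolding e by linarith
qed simp

definition AP :: "real \<Rightarrow> int \<Rightarrow> int \<Rightarrow> real \<Rightarrow> real \<Rightarrow> int set" where
  "AP B e c \<alpha> \<beta> = {n. e dvd n - c \<and> \<alpha> \<le> n / B \<and> n / B \<le> \<beta>}"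

text \<open>\<open>n0\<close> is the first member of the residue class at or beyond \<alpha> B, and
  \<open>J\<close> counts the members up to \<beta> B. For J > 0 the inequalities say that the block
  of J steps from \<open>n0 / B\<close> differs from [\<alpha>, \<beta>] by at most one step at
  either end; for J = 0 the interval itself is shorter than one step.\<close>

lemma AP_param:
  fixes e c :: int and B \<alpha> \<beta> :: real
  assumes B: "B > 0" and e: "e \<ge> 1" and ab: "\<alpha> \<le> \<beta>"
  obtains n0 J where "AP B e c \<alpha> \<beta> = (\<lambda>j. n0 + e * int j) ` {..<J}"
    "\<alpha> \<le> n0 / B" "n0 / B < \<alpha> + e / B" "J = 0 \<longrightarrow> \<beta> < n0 / B" "J > 0 \<longrightarrow> n0 / B \<le> \<beta>"
    "J > 0 \<longrightarrow> \<beta> < n0 / B + real J * (e / B)" "J > 0 \<longrightarrow> n0 / B + real J * (e / B) \<le> \<beta> + e / B"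
proof -
  define s where "s = \<lceil>(\<alpha> * B - c) / e\<rceil>"
  define n0 where "n0 = c + e * s"
  define r where "r = \<lfloor>(\<beta> * B - n0) / e\<rfloor>"
  define J where "J = nat (r + 1)"
  have e0: "real_of_int e > 0" using e by simp
  have 1: "(\<alpha> * B - c) / e \<le> s" "s < (\<alpha> * B - c) / e + 1" unfolding s_def by linarith+
  have n0r: "real_of_int n0 = c + e * real_of_int s" unfolding n0_def by simp
  have "\<alpha> * B \<le> n0" using 1(1) e0 n0r by (simp add: field_simps)
  then have r1: "\<alpha> \<le> n0 / B" using B by (simp add: field_simps)
  have "real_of_int n0 < \<alpha> * B + e" using 1(2) e0 n0r by (simp add: field_simps)
  then have r2: "n0 / B < \<alpha> + e / B" using B by (simp add: field_simps)
  have 2: "r \<le> (\<beta> * B - n0) / e" "(\<beta> * B - n0) / e < r + 1" unfolding r_def by linarith+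
  have rl: "n0 + e * real_of_int r \<le> \<beta> * B" "\<beta> * B < n0 + e * (real_of_int r + 1)"
    using 2 e0 by (simp_all add: field_simps)
  { assume "J = 0"
    then have "real_of_int r + 1 \<le> 0" unfolding J_def by linarith
    then have "e * (real_of_int r + 1) \<le> 0" using e0 by (simp add: mult_le_0_iff)
    then have "\<beta> * B < n0" using rl by linarith
    then have "\<beta> < n0 / B" using B by (simp add: field_simps) }
  note J0 = this
  have Jr: "real J = real_of_int r + 1" "r \<ge> 0" if "J > 0" using that unfolding J_def by auto
  have r3: "J = 0 \<longrightarrow> \<beta> < n0 / B" using J0 by blast
  have A: "n0 / B \<le> \<beta> \<and> \<beta> < n0 / B + real J * (e / B) \<and> n0 / B + real J * (e / B) \<le> \<beta> + e / B" if j: "J > 0"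
  proof -
    have "e * real_of_int r \<ge> 0" using Jr(2)[OF j] e0 by simp
    then have "n0 \<le> \<beta> * B" using rl by linarith
    moreover have "\<beta> * B < n0 + e * real J" "n0 + e * real J \<le> \<beta> * B + e" using rl Jr(1)[OF j] by (simp_all add: algebra_simps)
    moreover have "n0 / B + real J * (e / B) = (n0 + e * real J) / B" by (simp add: add_divide_distrib mult_ac)
    moreover have "\<beta> + e / B = (\<beta> * B + e) / B" using B by (simp add: add_divide_distrib)
    moreover have "n0 / B \<le> \<beta>" using calculation(1) B by (simp add: pos_divide_le_eq)
    moreover have "\<beta> < (n0 + e * real J) / B" using calculation(2) B by (simp add: pos_less_divide_eq)
    moreover have "(n0 + e * real J) / B \<le> (\<beta> * B + e) / B" using calculation(3) B by (intro divide_right_mono) auto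
    ultimately show ?thesis by simp
  qed
  have r4: "J > 0 \<longrightarrow> n0 / B \<le> \<beta>" "J > 0 \<longrightarrow> \<beta> < n0 / B + real J * (e / B)" "J > 0 \<longrightarrow> n0 / B + real J * (e / B) \<le> \<beta> + e / B"
    using A by blast+
  have r0: "AP B e c \<alpha> \<beta> = (\<lambda>j. n0 + e * int j) ` {..<J}"
  proof (intro equalityI subsetI)
    fix n assume n: "n \<in> AP B e c \<alpha> \<beta>"
    then obtain w where w: "n - c = e * w" unfolding AP_def by (auto elim: dvdE)
    have nB: "\<alpha> * B \<le> n" "n \<le> \<beta> * B" using n B unfolding AP_def by (auto simp: field_simps)
    have nr: "real_of_int n = c + e * real_of_int w" using w by (simp add: algebra_simps flip: of_int_mult of_int_add)
    have "(\<alpha> * B - c) / e \<le> w" using nB(1) nr e0 by (simp add: field_simps)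
    then have sw: "s \<le> w" unfolding s_def by (simp add: ceiling_le_iff)
    have "real_of_int (w - s) \<le> (\<beta> * B - n0) / e" using nB(2) nr n0r e0 by (simp add: field_simps)
    then have "w - s \<le> r" unfolding r_def by (simp only: le_floor_iff)
    then have "nat (w - s) < J" unfolding J_def using sw by linarith
    moreover have "n = n0 + e * int (nat (w - s))" using sw w unfolding n0_def by (simp add: algebra_simps)
    ultimately show "n \<in> (\<lambda>j. n0 + e * int j) ` {..<J}" by blast
  next
    fix n assume "n \<in> (\<lambda>j. n0 + e * int j) ` {..<J}"
    then obtain j where j: "j < J" "n = n0 + e * int j" by blast
    have "real j \<le> real_of_int r" using j(1) unfolding J_def by linarith
    then have "e * real j \<le> e * real_of_int r" using e0 by (intro mult_left_mono) auto
    then have "n0 + e * real j \<le> \<beta> * B" using rl(1) by linarith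
    moreover have "\<alpha> * B \<le> n0 + e * real j" using \<open>\<alpha> * B \<le> n0\<close> e0 by (simp add: add_increasing2)
    moreover have "real_of_int n = n0 + e * real j" using j by simp
    ultimately have "\<alpha> * B \<le> n" "n \<le> \<beta> * B" by simp_all
    moreover have "e dvd n - c" using j unfolding n0_def by simp
    ultimately show "n \<in> AP B e c \<alpha> \<beta>" using B unfolding AP_def by (simp add: field_simps)
  qed
  show thesis by (rule that[OF r0 r1 r2 r3 r4])
qed

lemma finite_AP: "B > 0 \<Longrightarrow> e \<ge> 1 \<Longrightarrow> \<alpha> \<le> \<beta> \<Longrightarrow> finite (AP B e c \<alpha> \<beta>)"
  by (rule AP_param[of B e \<alpha> \<beta> c]) auto

lemma card_AP_le:
  fixes B \<alpha> \<beta> :: real and e :: int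
  assumes B: "B \<ge> 1" and e: "e \<ge> 1" and ab: "\<alpha> \<le> \<beta>" "\<beta> - \<alpha> \<le> 2"
  shows "real (card (AP B e c \<alpha> \<beta>)) \<le> 3 * B"
proof -
  have B0: "B > 0" using B by simp
  obtain n0 J where A: "AP B e c \<alpha> \<beta> = (\<lambda>j. n0 + e * int j) ` {..<J}"
    "\<alpha> \<le> n0 / B" "J > 0 \<longrightarrow> n0 / B + real J * (e / B) \<le> \<beta> + e / B"
    using AP_param[OF B0 e ab(1), of c] by metis
  have "card (AP B e c \<alpha> \<beta>) \<le> J" unfolding A(1) using card_image_le[of "{..<J}"] by simp
  moreover have "real J \<le> 3 * B"
  proof (cases "J > 0")
    case True
    have "real J * (e / B) \<le> 2 + e / B" using A(2,3) True ab by linarith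
    then have "real J * e \<le> 2 * B + e" using B0 by (simp add: field_simps)
    then have "(real J - 1) * e \<le> 2 * B" by (simp add: algebra_simps)
    moreover have "(real J - 1) * 1 \<le> (real J - 1) * e" using True e by (intro mult_left_mono) auto
    ultimately have "(real J - 1) * 1 \<le> 2 * B" by (rule order_trans[rotated])
    then show ?thesis using B by simp
  qed (use B in simp)
  ultimately show ?thesis by linarith
qed

text \<open>With step h = e / B, the sum times h misses the integral by K h per unit of length and
  by M h at each end. Dividing by h leaves a bound independent of e, so that moduli as large as B
  are admissible.\<close>

lemma riemann_AP:
  fixes e c :: int and B \<alpha> \<beta> :: real
  assumes B: "B > 0" and e: "e \<ge> 1" "e \<le> B" and ab: "\<alpha> \<le> \<beta>"
    and l: "lip K f" and M: "\<And>x. \<bar>f x\<bar> \<le> M"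
  shows "\<bar>(\<Sum>n\<in>AP B e c \<alpha> \<beta>. f (n / B)) - (B / e) * integral {\<alpha>..\<beta>} f\<bar> \<le> K * (\<beta> - \<alpha> + 1) + 2 * M"
proof -
  obtain n0 J where A: "AP B e c \<alpha> \<beta> = (\<lambda>j. n0 + e * int j) ` {..<J}"
    "\<alpha> \<le> n0 / B" "n0 / B < \<alpha> + e / B" "J = 0 \<longrightarrow> \<beta> < n0 / B" "J > 0 \<longrightarrow> n0 / B \<le> \<beta>"
    "J > 0 \<longrightarrow> \<beta> < n0 / B + real J * (e / B)" "J > 0 \<longrightarrow> n0 / B + real J * (e / B) \<le> \<beta> + e / B"
    using AP_param[OF B e(1) ab, of c] by metis
  define h where "h = real_of_int e / B"
  define t where "t = real_of_int n0 / B"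
  have h: "h > 0" "h \<le> 1" unfolding h_def using B e by auto
  have K: "0 \<le> K" by (rule lip_nonneg[OF l])
  have M0: "0 \<le> M" using M[of 0] by linarith
  note A' = A(2-)[folded h_def t_def]
  have S: "(\<Sum>n\<in>AP B e c \<alpha> \<beta>. f (n / B)) = (\<Sum>j<J. f (t + real j * h))"
    unfolding A(1) using e(1)
    by (subst sum.reindex) (auto simp: inj_on_def t_def h_def add_divide_distrib mult.commute intro!: sum.cong)
  let ?S = "\<Sum>j<J. f (t + real j * h)"
  have "\<bar>h * ?S - integral {\<alpha>..\<beta>} f\<bar> \<le> h * (K * (\<beta> - \<alpha> + 1) + 2 * M)"
  proof (cases "J = 0")
    case True
    have "\<bar>integral {\<alpha>..\<beta>} f\<bar> \<le> M * (\<beta> - \<alpha>)" by (rule integral_abs_le[OF l M ab])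
    also have "\<dots> \<le> M * h" using A' True M0 by (intro mult_left_mono) auto
    also have "\<dots> \<le> h * (2 * M)" using M0 h by simp
    also have "\<dots> \<le> h * (K * (\<beta> - \<alpha> + 1) + 2 * M)" using K h ab by (intro mult_left_mono) auto
    finally show ?thesis using True by simp
  next
    case False
    let ?u = "t + real J * h"
    have o: "\<alpha> \<le> t" "t \<le> \<beta>" "\<beta> < ?u" "?u \<le> \<beta> + h" "t < \<alpha> + h" using A' False by auto
    have 1: "\<bar>h * ?S - integral {t..?u} f\<bar> \<le> real J * (K * h^2)" by (rule riemann_block[OF l h(1)])
    have 2: "integral {\<alpha>..t} f + integral {t..?u} f = integral {\<alpha>..?u} f"
      by (rule Henstock_Kurzweil_Integration.integral_combine) (use o lip_integrable[OF l] in auto)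
    have 3: "integral {\<alpha>..\<beta>} f + integral {\<beta>..?u} f = integral {\<alpha>..?u} f"
      by (rule Henstock_Kurzweil_Integration.integral_combine) (use o ab lip_integrable[OF l] in auto)
    have "\<bar>integral {\<alpha>..t} f\<bar> \<le> M * (t - \<alpha>)" by (rule integral_abs_le[OF l M o(1)])
    also have "\<dots> \<le> M * h" using M0 o by (intro mult_left_mono) auto
    finally have 4: "\<bar>integral {\<alpha>..t} f\<bar> \<le> M * h" .
    have "\<bar>integral {\<beta>..?u} f\<bar> \<le> M * (?u - \<beta>)" by (rule integral_abs_le[OF l M]) (use o in simp)
    also have "\<dots> \<le> M * h" using M0 o by (intro mult_left_mono) auto
    finally have 5: "\<bar>integral {\<beta>..?u} f\<bar> \<le> M * h" .
    have "real J * h \<le> \<beta> - \<alpha> + 1" using o h by linarith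
    then have "(real J * h) * (K * h) \<le> (\<beta> - \<alpha> + 1) * (K * h)" using K h by (intro mult_right_mono) auto
    then have 6: "real J * (K * h^2) \<le> (\<beta> - \<alpha> + 1) * (K * h)" by (simp add: power2_eq_square mult_ac)
    have "\<bar>h * ?S - integral {\<alpha>..\<beta>} f\<bar> \<le> (\<beta> - \<alpha> + 1) * (K * h) + 2 * (M * h)" using 1 2 3 4 5 6 by linarith
    also have "\<dots> = h * (K * (\<beta> - \<alpha> + 1) + 2 * M)" by (simp add: algebra_simps)
    finally show ?thesis .
  qed
  moreover have "h * ?S - integral {\<alpha>..\<beta>} f = h * (?S - (B / e) * integral {\<alpha>..\<beta>} f)"
    unfolding h_def using B e by (simp add: field_simps)
  ultimately have "h * \<bar>?S - (B / e) * integral {\<alpha>..\<beta>} f\<bar> \<le> h * (K * (\<beta> - \<alpha> + 1) + 2 * M)"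
    using h by (simp add: abs_mult)
  then show ?thesis unfolding S using h by simp
qed

lemma lip_integral:
  assumes l1: "\<And>y. lip K (\<lambda>x. g x y)" and l2: "\<And>x. lip K' (g x)" and ab: "a \<le> b" "b - a \<le> 2"
  shows "lip (2 * K) (\<lambda>x. integral {a..b} (g x))"
  unfolding lip_def
proof (intro allI)
  fix x x'
  have K: "0 \<le> K" by (rule lip_nonneg[OF l1])
  have "integral {a..b} (g x) - integral {a..b} (g x') = integral {a..b} (\<lambda>y. g x y - g x' y)"
    by (rule integral_diff[symmetric]) (rule lip_integrable[OF l2])+
  also have "norm \<dots> \<le> (K * \<bar>x - x'\<bar>) * (b - a)"
  proof (rule integral_bound[OF ab(1)])
    show "continuous_on {a..b} (\<lambda>y. g x y - g x' y)" by (intro continuous_intros lip_continuous[OF l2])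
  qed (use l1 in \<open>auto simp: lip_def\<close>)
  also have "\<dots> \<le> (K * \<bar>x - x'\<bar>) * 2" using K ab by (intro mult_left_mono) auto
  finally show "\<bar>integral {a..b} (g x) - integral {a..b} (g x')\<bar> \<le> 2 * K * \<bar>x - x'\<bar>" by simp
qed

lemma integral_abs_le_2:
  fixes f :: "real \<Rightarrow> real"
  assumes "lip K f" "\<And>x. \<bar>f x\<bar> \<le> M" "a \<le> b" "b - a \<le> 2"
  shows "\<bar>integral {a..b} f\<bar> \<le> 2 * M"
proof -
  have "0 \<le> M" using assms(2)[of 0] by linarith
  then have "M * (b - a) \<le> M * 2" using assms by (intro mult_left_mono) auto
  then show ?thesis using integral_abs_le[OF assms(1-3)] by simp
qed

lemma sum_approx_step:
  fixes g h :: "int \<Rightarrow> real"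
  assumes "\<And>n. n \<in> A \<Longrightarrow> \<bar>g n - h n\<bar> \<le> E" "real (card A) \<le> C" "E \<ge> 0"
  shows "\<bar>(\<Sum>n\<in>A. g n) - (\<Sum>n\<in>A. h n)\<bar> \<le> C * E"
proof -
  have "\<bar>(\<Sum>n\<in>A. g n) - (\<Sum>n\<in>A. h n)\<bar> \<le> (\<Sum>n\<in>A. \<bar>g n - h n\<bar>)" by (simp only: sum_subtractf[symmetric] sum_abs)
  also have "\<dots> \<le> (\<Sum>n\<in>A. E)" by (intro sum_mono assms)
  also have "\<dots> \<le> C * E" using assms by (simp add: mult_right_mono)
  finally show ?thesis .
qed

lemma approx_chain:
  fixes P R S x z w Y :: real
  shows "\<bar>P - R\<bar> \<le> x \<Longrightarrow> \<bar>Y\<bar> \<le> z \<Longrightarrow> Y = R - S \<Longrightarrow> x + z = w \<Longrightarrow> \<bar>P - S\<bar> \<le> w"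
  by linarith

text \<open>For u_i \<ge> 0 the function \<open>phi\<close> vanishes from v_i = 1 + u_i on, so with
  u_i at most 1 the inner integrals may end at the constant 2; \<kappa> cuts off the singularity at
  0.\<close>

definition I4 :: "real \<Rightarrow> (real \<Rightarrow> real \<Rightarrow> real \<Rightarrow> real \<Rightarrow> real) \<Rightarrow> real" where
  "I4 \<kappa> F = integral {0..1} (\<lambda>x1. integral {0..1} (\<lambda>x2. integral {\<kappa>..2} (\<lambda>x3. integral {\<kappa>..2} (F x1 x2 x3))))"

text \<open>Sums become integrals from the inside outwards. An integration at most doubles the
  Lipschitz constant and the bound, and every outer sum has at most 3 B terms, so the error
  constants grow as 5 = 3 + 2, 19 = 3 * 5 + 4 and 65 = 3 * 19 + 8. The residue class of m2 modulo f
  encodes that f divides a = m1 - m2.\<close>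

lemma riemann_AP_4:
  fixes e f :: int and B \<kappa> :: real
  assumes B: "B \<ge> 1" and e: "e \<ge> 1" "e \<le> B" and f: "f \<ge> 1" "f \<le> B" and \<kappa>: "0 < \<kappa>" "\<kappa> \<le> 1"
    and l1: "\<And>x2 x3 x4. lip K (\<lambda>x. F x x2 x3 x4)" and l2: "\<And>x1 x3 x4. lip K (\<lambda>x. F x1 x x3 x4)"
    and l3: "\<And>x1 x2 x4. lip K (\<lambda>x. F x1 x2 x x4)" and l4: "\<And>x1 x2 x3. lip K (F x1 x2 x3)"
    and M: "\<And>x1 x2 x3 x4. \<bar>F x1 x2 x3 x4\<bar> \<le> M"
  shows "\<bar>(\<Sum>m1\<in>AP B 1 0 0 1. \<Sum>m2\<in>AP B f m1 0 1. \<Sum>q1\<in>AP B e 0 \<kappa> 2. \<Sum>q2\<in>AP B e 0 \<kappa> 2. F (m1/B) (m2/B) (q1/B) (q2/B))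
     - B^4 / (f * e^2) * I4 \<kappa> F\<bar> \<le> 65 * B^3 * (3 * K + 2 * M)"
proof -
  have B0: "B > 0" using B by simp
  have K0: "0 \<le> K" by (rule lip_nonneg[OF l4])
  have M0: "0 \<le> M" using M[of 0 0 0 0] by linarith
  define F3 where "F3 x1 x2 x3 = integral {\<kappa>..2} (F x1 x2 x3)" for x1 x2 x3
  define F2 where "F2 x1 x2 = integral {\<kappa>..2} (F3 x1 x2)" for x1 x2
  define F1 where "F1 x1 = integral {0..1} (F2 x1)" for x1
  have I: "I4 \<kappa> F = integral {0..1} F1" unfolding I4_def F1_def F2_def F3_def by simp
  have lk: "\<kappa> \<le> 2" "2 - \<kappa> \<le> 2" "(0::real) \<le> 1" "(1::real) - 0 \<le> 2" using \<kappa> by auto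
  have a3: "lip (2 * K) (\<lambda>x. F3 x x2 x3)" for x2 x3 unfolding F3_def by (rule lip_integral[OF l1 l4 lk(1,2)])
  have b3: "lip (2 * K) (\<lambda>x. F3 x1 x x3)" for x1 x3 unfolding F3_def by (rule lip_integral[OF l2 l4 lk(1,2)])
  have c3: "lip (2 * K) (F3 x1 x2)" for x1 x2 unfolding F3_def by (rule lip_integral[OF l3 l4 lk(1,2)])
  have M3: "\<bar>F3 x1 x2 x3\<bar> \<le> 2 * M" for x1 x2 x3 unfolding F3_def by (rule integral_abs_le_2[OF l4 M lk(1,2)])
  have a2: "lip (2 * (2 * K)) (\<lambda>x. F2 x x2)" for x2 unfolding F2_def by (rule lip_integral[OF a3 c3 lk(1,2)])
  have b2: "lip (2 * (2 * K)) (F2 x1)" for x1 unfolding F2_def by (rule lip_integral[OF b3 c3 lk(1,2)])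
  have M2: "\<bar>F2 x1 x2\<bar> \<le> 2 * (2 * M)" for x1 x2 unfolding F2_def by (rule integral_abs_le_2[OF c3 M3 lk(1,2)])
  have a1: "lip (2 * (2 * (2 * K))) F1" unfolding F1_def by (rule lip_integral[OF a2 b2 lk(3,4)])
  have M1: "\<bar>F1 x1\<bar> \<le> 2 * (2 * (2 * M))" for x1 unfolding F1_def by (rule integral_abs_le_2[OF b2 M2 lk(3,4)])
  let ?E = "3 * K + 2 * M"
  have E0: "?E \<ge> 0" using K0 M0 by simp
  have ce: "card (AP B e 0 \<kappa> 2) \<le> 3 * B" by (rule card_AP_le[OF B e(1) lk(1,2)])
  have cf: "card (AP B f c 0 1) \<le> 3 * B" for c by (rule card_AP_le[OF B f(1) lk(3,4)])
  have c1: "card (AP B 1 0 0 1) \<le> 3 * B" by (rule card_AP_le[OF B _ lk(3,4)]) simp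
  have b: "B / e \<ge> 0" "B / e \<le> B" "B / f \<ge> 0" "B / f \<le> B" using B e f by (auto simp: divide_le_eq)
  have s4: "\<bar>(\<Sum>q2\<in>AP B e 0 \<kappa> 2. F x1 x2 x3 (q2/B)) - (B / e) * F3 x1 x2 x3\<bar> \<le> ?E" for x1 x2 x3
  proof -
    have "\<bar>(\<Sum>q2\<in>AP B e 0 \<kappa> 2. F x1 x2 x3 (q2/B)) - (B / e) * F3 x1 x2 x3\<bar> \<le> K * (2 - \<kappa> + 1) + 2 * M"
      unfolding F3_def by (rule riemann_AP[OF B0 e lk(1) l4 M])
    also have "\<dots> \<le> K * 3 + 2 * M" using K0 \<kappa> by (intro add_mono mult_left_mono) auto
    finally show ?thesis by simp
  qed
  have s3: "\<bar>(\<Sum>q1\<in>AP B e 0 \<kappa> 2. F3 x1 x2 (q1/B)) - (B / e) * F2 x1 x2\<bar> \<le> 2 * ?E" for x1 x2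
  proof -
    have "\<bar>(\<Sum>q1\<in>AP B e 0 \<kappa> 2. F3 x1 x2 (q1/B)) - (B / e) * F2 x1 x2\<bar> \<le> (2 * K) * (2 - \<kappa> + 1) + 2 * (2 * M)"
      unfolding F2_def by (rule riemann_AP[OF B0 e lk(1) c3 M3])
    also have "\<dots> \<le> (2 * K) * 3 + 2 * (2 * M)" using K0 \<kappa> by (intro add_mono mult_left_mono) auto
    finally show ?thesis by simp
  qed
  have s2: "\<bar>(\<Sum>m2\<in>AP B f c 0 1. F2 x1 (m2/B)) - (B / f) * F1 x1\<bar> \<le> 4 * ?E" for x1 c
  proof -
    have "\<bar>(\<Sum>m2\<in>AP B f c 0 1. F2 x1 (m2/B)) - (B / f) * F1 x1\<bar> \<le> (2 * (2 * K)) * (1 - 0 + 1) + 2 * (2 * (2 * M))"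
      unfolding F1_def by (rule riemann_AP[OF B0 f lk(3) b2 M2])
    also have "\<dots> \<le> 4 * ?E" using K0 by simp
    finally show ?thesis .
  qed
  have s1: "\<bar>(\<Sum>m1\<in>AP B 1 0 0 1. F1 (m1/B)) - B * I4 \<kappa> F\<bar> \<le> 8 * ?E"
  proof -
    have "\<bar>(\<Sum>m1\<in>AP B 1 0 0 1. F1 (m1/B)) - (B / real_of_int 1) * integral {0..1} F1\<bar> \<le> (2 * (2 * (2 * K))) * (1 - 0 + 1) + 2 * (2 * (2 * (2 * M)))"
      by (rule riemann_AP[OF B0 _ _ lk(3) a1 M1]) (use B in auto)
    also have "\<dots> \<le> 8 * ?E" using K0 by simp
    finally show ?thesis unfolding I by simp
  qed
  have sc: "\<bar>c * y\<bar> \<le> B * Z" if "\<bar>y\<bar> \<le> Z" "0 \<le> c" "c \<le> B" for c y Z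
    unfolding abs_mult using that B0 by (intro mult_mono) auto
  have t3: "\<bar>(\<Sum>q1\<in>AP B e 0 \<kappa> 2. \<Sum>q2\<in>AP B e 0 \<kappa> 2. F x1 x2 (q1/B) (q2/B)) - (B / e)^2 * F2 x1 x2\<bar> \<le> 5 * B * ?E" for x1 x2
  proof -
    have "\<bar>(\<Sum>q1\<in>AP B e 0 \<kappa> 2. \<Sum>q2\<in>AP B e 0 \<kappa> 2. F x1 x2 (q1/B) (q2/B)) - (\<Sum>q1\<in>AP B e 0 \<kappa> 2. (B / e) * F3 x1 x2 (q1/B))\<bar>
       \<le> 3 * B * ?E" by (rule sum_approx_step[OF s4 ce E0])
    moreover have "\<bar>(B / e) * ((\<Sum>q1\<in>AP B e 0 \<kappa> 2. F3 x1 x2 (q1/B)) - (B / e) * F2 x1 x2)\<bar> \<le> B * (2 * ?E)"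
      by (rule sc[OF s3 b(1,2)])
    moreover have "(B / e) * ((\<Sum>q1\<in>AP B e 0 \<kappa> 2. F3 x1 x2 (q1/B)) - (B / e) * F2 x1 x2)
       = (\<Sum>q1\<in>AP B e 0 \<kappa> 2. (B / e) * F3 x1 x2 (q1/B)) - (B / e)^2 * F2 x1 x2"
      by (simp add: right_diff_distrib sum_distrib_left power2_eq_square)
    moreover have "3 * B * ?E + B * (2 * ?E) = 5 * B * ?E" by (simp add: algebra_simps)
    ultimately show ?thesis by (rule approx_chain)
  qed
  have be2: "0 \<le> (B / e)^2" "(B / e)^2 \<le> B^2" using b by (auto intro: power_mono)
  have t2: "\<bar>(\<Sum>m2\<in>AP B f c 0 1. \<Sum>q1\<in>AP B e 0 \<kappa> 2. \<Sum>q2\<in>AP B e 0 \<kappa> 2. F x1 (m2/B) (q1/B) (q2/B))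
      - (B / e)^2 * (B / f) * F1 x1\<bar> \<le> 19 * B^2 * ?E" for x1 c
  proof -
    have "\<bar>(\<Sum>m2\<in>AP B f c 0 1. \<Sum>q1\<in>AP B e 0 \<kappa> 2. \<Sum>q2\<in>AP B e 0 \<kappa> 2. F x1 (m2/B) (q1/B) (q2/B)) -
        (\<Sum>m2\<in>AP B f c 0 1. (B / e)^2 * F2 x1 (m2/B))\<bar> \<le> 3 * B * (5 * B * ?E)"
      by (rule sum_approx_step[OF t3 cf]) (use E0 B0 in simp)
    moreover have "\<bar>(B / e)^2 * ((\<Sum>m2\<in>AP B f c 0 1. F2 x1 (m2/B)) - (B / f) * F1 x1)\<bar> \<le> B^2 * (4 * ?E)"
      unfolding abs_mult[of "(B / e)^2"] abs_of_nonneg[OF be2(1)] by (rule mult_mono[OF be2(2) s2]) auto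
    moreover have "(B / e)^2 * ((\<Sum>m2\<in>AP B f c 0 1. F2 x1 (m2/B)) - (B / f) * F1 x1) =
        (\<Sum>m2\<in>AP B f c 0 1. (B / e)^2 * F2 x1 (m2/B)) - (B / e)^2 * (B / f) * F1 x1"
      by (simp only: right_diff_distrib sum_distrib_left mult.assoc)
    moreover have "3 * B * (5 * B * ?E) + B^2 * (4 * ?E) = 19 * B^2 * ?E" by (simp add: algebra_simps power2_eq_square)
    ultimately show ?thesis by (rule approx_chain)
  qed
  let ?S = "\<Sum>m1\<in>AP B 1 0 0 1. \<Sum>m2\<in>AP B f m1 0 1. \<Sum>q1\<in>AP B e 0 \<kappa> 2. \<Sum>q2\<in>AP B e 0 \<kappa> 2. F (m1/B) (m2/B) (q1/B) (q2/B)"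
  let ?C = "(B / e)^2 * (B / f)"
  have C: "0 \<le> ?C" "?C \<le> B^2 * B"
    using mult_nonneg_nonneg[OF be2(1) b(3)] mult_mono[OF be2(2) b(4) _ b(3)] by simp_all
  have "\<bar>?S - (\<Sum>m1\<in>AP B 1 0 0 1. ?C * F1 (m1/B))\<bar> \<le> 3 * B * (19 * B^2 * ?E)"
    by (rule sum_approx_step[OF t2 c1]) (use E0 B0 in simp)
  moreover have "\<bar>?C * ((\<Sum>m1\<in>AP B 1 0 0 1. F1 (m1/B)) - B * I4 \<kappa> F)\<bar> \<le> (B^2 * B) * (8 * ?E)"
    unfolding abs_mult[of ?C] abs_of_nonneg[OF C(1)] by (intro mult_mono C s1) (use B0 in auto)
  moreover have "?C * ((\<Sum>m1\<in>AP B 1 0 0 1. F1 (m1/B)) - B * I4 \<kappa> F) = (\<Sum>m1\<in>AP B 1 0 0 1. ?C * F1 (m1/B)) - B^4 / (f * e^2) * I4 \<kappa> F"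
    by (simp add: right_diff_distrib sum_distrib_left sum_divide_distrib power2_eq_square eval_nat_numeral power_divide mult_ac)
  moreover have "3 * B * (19 * B^2 * ?E) + (B^2 * B) * (8 * ?E) = 65 * B^3 * ?E" by (simp add: algebra_simps power2_eq_square power3_eq_cube)
  ultimately show ?thesis by (rule approx_chain)
qed


section \<open>Lipschitz bounds and scaling of the integrand\<close>

definition num :: "real \<Rightarrow> real \<Rightarrow> real \<Rightarrow> real \<Rightarrow> real" where
  "num u1 u2 v1 v2 = max 0 (min 1 (min ((u1 + v1)^2) ((u2 + v2)^2))
            - max (max (u1^2) (u2^2)) (max ((u1 - v1)^2) ((u2 - v2)^2)))"

lemma phi_num: "phi u1 u2 v1 v2 = num u1 u2 v1 v2 / (v1 * v2)"
  unfolding phi_def num_def by simp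

lemma phi_swap: "phi u1 u2 v1 v2 = phi u2 u1 v2 v1"
  unfolding phi_def
  by (simp only: min.commute[of "(u1 + v1)^2"] max.commute[of "u1^2"] max.commute[of "(u1 - v1)^2"] mult.commute[of v1])

lemma num_bounds: "0 \<le> num u1 u2 v1 v2" "num u1 u2 v1 v2 \<le> 1"
proof -
  show "0 \<le> num u1 u2 v1 v2" unfolding num_def by simp
  have "0 \<le> max (max (u1^2) (u2^2)) (max ((u1 - v1)^2) ((u2 - v2)^2))" by (simp add: le_max_iff_disj)
  then show "num u1 u2 v1 v2 \<le> 1" unfolding num_def by (simp add: min_def)
qed

lemma min_diff: "\<bar>x - x'\<bar> \<le> d \<Longrightarrow> \<bar>y - y'\<bar> \<le> d \<Longrightarrow> \<bar>min x y - min x' y'\<bar> \<le> d" for x :: real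
  by (auto simp: min_def abs_le_iff)

lemma max_diff: "\<bar>x - x'\<bar> \<le> d \<Longrightarrow> \<bar>y - y'\<bar> \<le> d \<Longrightarrow> \<bar>max x y - max x' y'\<bar> \<le> d" for x :: real
  by (auto simp: max_def abs_le_iff)

lemma num_diff:
  assumes "\<bar>(u1 + v1)^2 - (u1' + v1')^2\<bar> \<le> d" "\<bar>u1^2 - u1'^2\<bar> \<le> d" "\<bar>(u1 - v1)^2 - (u1' - v1')^2\<bar> \<le> d"
  shows "\<bar>num u1 u2 v1 v2 - num u1' u2 v1' v2\<bar> \<le> 2 * d"
proof -
  have d: "0 \<le> d" using assms(1) by linarith
  have a: "\<bar>min 1 (min ((u1 + v1)^2) ((u2 + v2)^2)) - min 1 (min ((u1' + v1')^2) ((u2 + v2)^2))\<bar> \<le> d"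
    by (intro min_diff assms) (use d in auto)
  have b: "\<bar>max (max (u1^2) (u2^2)) (max ((u1 - v1)^2) ((u2 - v2)^2)) - max (max (u1'^2) (u2^2)) (max ((u1' - v1')^2) ((u2 - v2)^2))\<bar> \<le> d"
    by (intro max_diff assms) (use d in auto)
  have c: "\<bar>(x - y) - (x' - y')\<bar> \<le> 2 * d" if "\<bar>x - x'\<bar> \<le> d" "\<bar>y - y'\<bar> \<le> d" for x y x' y' :: real
    using that by linarith
  show ?thesis unfolding num_def by (rule max_diff[OF _ c[OF a b]]) (use d in simp)
qed

lemma square_diff_le:
  fixes x y :: real
  assumes "\<bar>x\<bar> \<le> 3" "\<bar>y\<bar> \<le> 3"
  shows "\<bar>x^2 - y^2\<bar> \<le> 6 * \<bar>x - y\<bar>"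
proof -
  have "\<bar>x^2 - y^2\<bar> = \<bar>x + y\<bar> * \<bar>x - y\<bar>" by (simp add: power2_eq_square algebra_simps flip: abs_mult)
  also have "\<dots> \<le> 6 * \<bar>x - y\<bar>" using assms by (intro mult_right_mono) auto
  finally show ?thesis .
qed

lemma phi_diff_u:
  assumes \<kappa>: "0 < \<kappa>" "\<kappa> \<le> 1" and u: "0 \<le> u1" "u1 \<le> 1" "0 \<le> u1'" "u1' \<le> 1"
    and v: "\<kappa> \<le> v1" "v1 \<le> 2" "\<kappa> \<le> v2"
  shows "\<bar>phi u1 u2 v1 v2 - phi u1' u2 v1 v2\<bar> \<le> 13 / \<kappa>^3 * \<bar>u1 - u1'\<bar>"
proof -
  have "\<bar>num u1 u2 v1 v2 - num u1' u2 v1 v2\<bar> \<le> 2 * (6 * \<bar>u1 - u1'\<bar>)"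
    by (rule num_diff; rule order_trans[OF square_diff_le]) (use u v \<kappa> in auto)
  moreover have "phi u1 u2 v1 v2 - phi u1' u2 v1 v2 = (num u1 u2 v1 v2 - num u1' u2 v1 v2) / (v1 * v2)"
    unfolding phi_num by (simp add: diff_divide_distrib)
  moreover have "0 < v1 * v2" using v \<kappa> by simp
  ultimately have "\<bar>phi u1 u2 v1 v2 - phi u1' u2 v1 v2\<bar> \<le> 2 * (6 * \<bar>u1 - u1'\<bar>) / (v1 * v2)"
    by (simp add: divide_right_mono)
  \<comment> \<open>12 / \<kappa>^2 is relaxed to the constant of \<open>phi_diff_v\<close>, so that
    all four variables share one Lipschitz constant.\<close>
  also have "\<dots> \<le> 13 * \<bar>u1 - u1'\<bar> / \<kappa>^3"
  proof (rule frac_le)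
    have "\<kappa>^3 = \<kappa> * \<kappa> * \<kappa>" by (simp add: power3_eq_cube)
    also have "\<dots> \<le> v1 * v2 * 1" using v \<kappa> by (intro mult_mono) auto
    finally show "\<kappa>^3 \<le> v1 * v2" by simp
  qed (use \<kappa> in auto)
  finally show ?thesis by simp
qed

lemma phi_diff_v:
  assumes \<kappa>: "0 < \<kappa>" "\<kappa> \<le> 1" and u: "0 \<le> u1" "u1 \<le> 1"
    and v: "\<kappa> \<le> v1" "v1 \<le> 2" "\<kappa> \<le> v1'" "v1' \<le> 2" "\<kappa> \<le> v2"
  shows "\<bar>phi u1 u2 v1 v2 - phi u1 u2 v1' v2\<bar> \<le> 13 / \<kappa>^3 * \<bar>v1 - v1'\<bar>"
proof -
  let ?n = "num u1 u2 v1 v2" and ?n' = "num u1 u2 v1' v2"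
  have p: "0 < v1" "0 < v1'" "0 < v2" using v \<kappa> by auto
  have nd: "\<bar>?n - ?n'\<bar> \<le> 2 * (6 * \<bar>v1 - v1'\<bar>)"
    by (rule num_diff; (rule order_trans[OF square_diff_le])?) (use u v \<kappa> in auto)
  \<comment> \<open>The change of the numerator costs 12 / \<kappa>^2 and the change of the
    denominator 1 / \<kappa>^3; together at most 13 / \<kappa>^3, as \<kappa> \<le> 1.\<close>
  have "phi u1 u2 v1 v2 - phi u1 u2 v1' v2 = (?n - ?n') / (v1 * v2) + ?n' * (v1' - v1) / (v1 * v1' * v2)"
    unfolding phi_num using p by (simp add: field_simps)
  also have "\<bar>\<dots>\<bar> \<le> \<bar>?n - ?n'\<bar> / (v1 * v2) + ?n' * \<bar>v1' - v1\<bar> / (v1 * v1' * v2)"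
    using p num_bounds(1)[of u1 u2 v1' v2] by (intro order_trans[OF abs_triangle_ineq]) (simp add: abs_mult)
  also have "\<dots> \<le> 12 * \<bar>v1 - v1'\<bar> / \<kappa>^3 + 1 * \<bar>v1 - v1'\<bar> / \<kappa>^3"
  proof (intro add_mono frac_le)
    have "\<kappa>^3 = \<kappa> * \<kappa> * \<kappa>" by (simp add: power3_eq_cube)
    also have "\<dots> \<le> v1 * v2 * 1" using v \<kappa> by (intro mult_mono) auto
    finally show "\<kappa>^3 \<le> v1 * v2" by simp
    have "\<kappa>^3 = \<kappa> * \<kappa> * \<kappa>" by (simp add: power3_eq_cube)
    also have "\<dots> \<le> v1 * v1' * v2" using v \<kappa> p by (intro mult_mono) auto
    finally show "\<kappa>^3 \<le> v1 * v1' * v2" .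
    show "?n' * \<bar>v1' - v1\<bar> \<le> 1 * \<bar>v1 - v1'\<bar>"
      using num_bounds[of u1 u2 v1' v2] by (intro mult_mono) auto
  qed (use nd \<kappa> in auto)
  also have "\<dots> = 13 / \<kappa>^3 * \<bar>v1 - v1'\<bar>" by (simp add: add_divide_distrib[symmetric])
  finally show ?thesis .
qed

definition cl :: "real \<Rightarrow> real \<Rightarrow> real \<Rightarrow> real" where "cl a b x = max a (min b x)"

lemma cl_lip: "\<bar>cl a b x - cl a b y\<bar> \<le> \<bar>x - y\<bar>"
  unfolding cl_def by (auto simp: max_def min_def)

lemma cl_range: "a \<le> b \<Longrightarrow> a \<le> cl a b x \<and> cl a b x \<le> b"
  unfolding cl_def by auto

lemma cl_id: "a \<le> x \<Longrightarrow> x \<le> b \<Longrightarrow> cl a b x = x"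
  unfolding cl_def by auto

text \<open>Clamping the arguments makes \<^const>\<open>phi\<close> globally Lipschitz without changing it on the domain of integration.\<close>

definition phic :: "real \<Rightarrow> real \<Rightarrow> real \<Rightarrow> real \<Rightarrow> real \<Rightarrow> real" where
  "phic \<kappa> u1 u2 v1 v2 = phi (cl 0 1 u1) (cl 0 1 u2) (cl \<kappa> 2 v1) (cl \<kappa> 2 v2)"

lemma lip_cl:
  assumes "0 \<le> K" "\<And>x y. a \<le> x \<Longrightarrow> x \<le> b \<Longrightarrow> a \<le> y \<Longrightarrow> y \<le> b \<Longrightarrow> \<bar>f x - f y\<bar> \<le> K * \<bar>x - y\<bar>" "a \<le> b"
  shows "lip K (\<lambda>x. f (cl a b x))"
  unfolding lip_def
proof (intro allI)
  fix x y
  have "\<bar>f (cl a b x) - f (cl a b y)\<bar> \<le> K * \<bar>cl a b x - cl a b y\<bar>" using cl_range[OF assms(3)] by (intro assms) auto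
  also have "\<dots> \<le> K * \<bar>x - y\<bar>" by (intro mult_left_mono cl_lip assms)
  finally show "\<bar>f (cl a b x) - f (cl a b y)\<bar> \<le> K * \<bar>x - y\<bar>" .
qed

lemma phic_lip:
  assumes \<kappa>: "0 < \<kappa>" "\<kappa> \<le> 1"
  shows "lip (13 / \<kappa>^3) (\<lambda>x. phic \<kappa> x u2 v1 v2)" "lip (13 / \<kappa>^3) (\<lambda>x. phic \<kappa> u1 x v1 v2)"
    "lip (13 / \<kappa>^3) (\<lambda>x. phic \<kappa> u1 u2 x v2)" "lip (13 / \<kappa>^3) (phic \<kappa> u1 u2 v1)"
proof -
  have K: "0 \<le> 13 / \<kappa>^3" using \<kappa> by simp
  have k2: "\<kappa> \<le> 2" using \<kappa> by simp
  note r = cl_range[OF k2] cl_range[OF zero_le_one]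
  have "lip (13 / \<kappa>^3) (\<lambda>x. (\<lambda>u. phi u (cl 0 1 u2) (cl \<kappa> 2 v1) (cl \<kappa> 2 v2)) (cl 0 1 x))"
    by (rule lip_cl[OF K _ zero_le_one], rule phi_diff_u[OF \<kappa>]) (use r in auto)
  then show "lip (13 / \<kappa>^3) (\<lambda>x. phic \<kappa> x u2 v1 v2)" by (simp only: phic_def)
  have "lip (13 / \<kappa>^3) (\<lambda>x. (\<lambda>u. phi u (cl 0 1 u1) (cl \<kappa> 2 v2) (cl \<kappa> 2 v1)) (cl 0 1 x))"
    by (rule lip_cl[OF K _ zero_le_one], rule phi_diff_u[OF \<kappa>]) (use r in auto)
  then show "lip (13 / \<kappa>^3) (\<lambda>x. phic \<kappa> u1 x v1 v2)" by (simp only: phic_def phi_swap[of "cl 0 1 u1"])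
  have "lip (13 / \<kappa>^3) (\<lambda>x. (\<lambda>v. phi (cl 0 1 u1) (cl 0 1 u2) v (cl \<kappa> 2 v2)) (cl \<kappa> 2 x))"
    by (rule lip_cl[OF K _ k2], rule phi_diff_v[OF \<kappa>]) (use r in auto)
  then show "lip (13 / \<kappa>^3) (\<lambda>x. phic \<kappa> u1 u2 x v2)" by (simp only: phic_def)
  have "lip (13 / \<kappa>^3) (\<lambda>x. (\<lambda>v. phi (cl 0 1 u2) (cl 0 1 u1) v (cl \<kappa> 2 v1)) (cl \<kappa> 2 x))"
    by (rule lip_cl[OF K _ k2], rule phi_diff_v[OF \<kappa>]) (use r in auto)
  moreover have "phic \<kappa> u1 u2 v1 = (\<lambda>x. phi (cl 0 1 u2) (cl 0 1 u1) (cl \<kappa> 2 x) (cl \<kappa> 2 v1))"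
    by (rule ext) (simp only: phic_def phi_swap[of "cl 0 1 u1"])
  ultimately show "lip (13 / \<kappa>^3) (phic \<kappa> u1 u2 v1)" by (simp only:)
qed

lemma phi_bound_kappa:
  assumes \<kappa>: "0 < \<kappa>" and v: "\<kappa> \<le> v1" "\<kappa> \<le> v2"
  shows "\<bar>phi u1 u2 v1 v2\<bar> \<le> 1 / \<kappa>^2"
proof -
  have p: "0 < v1 * v2" using v \<kappa> by simp
  have "\<bar>phi u1 u2 v1 v2\<bar> = num u1 u2 v1 v2 / (v1 * v2)"
    unfolding phi_num using num_bounds(1)[of u1 u2 v1 v2] p by (simp add: abs_divide del: abs_mult_pos)
  also have "\<dots> \<le> 1 / \<kappa>^2"
    using num_bounds(2)[of u1 u2 v1 v2] \<kappa> v by (intro frac_le) (auto simp: power2_eq_square intro!: mult_mono)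
  finally show ?thesis .
qed

lemma phic_bound:
  assumes \<kappa>: "0 < \<kappa>" "\<kappa> \<le> 1"
  shows "\<bar>phic \<kappa> u1 u2 v1 v2\<bar> \<le> 1 / \<kappa>^2"
  unfolding phic_def using cl_range[of \<kappa> 2] \<kappa> by (intro phi_bound_kappa) auto

text \<open>Numerator and denominator are both homogeneous of degree two, so the powers of B
  cancel.\<close>

lemma phi_scaled:
  fixes m1 m2 q1 q2 :: int
  assumes B: "B > 0" and q: "q1 \<ge> 1" "q2 \<ge> 1"
  shows "phi (m1 / B) (m2 / B) (q1 / B) (q2 / B) = width B m1 m2 q1 q2 / (q1 * q2)"
proof -
  have mx: "max (x / B^2) (y / B^2) = max x y / B^2" for x y using B by (simp add: max_divide_distrib_right)
  have mn: "min (x / B^2) (y / B^2) = min x y / B^2" for x y using B by (simp add: min_divide_distrib_right)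
  have sq: "(x / B + y / B)^2 = (x + y)^2 / B^2" "(x / B - y / B)^2 = (x - y)^2 / B^2" "(x / B)^2 = x^2 / B^2" for x y
    by (simp_all add: power_divide add_divide_distrib[symmetric] diff_divide_distrib[symmetric])
  have "num (m1 / B) (m2 / B) (q1 / B) (q2 / B) = width B m1 m2 q1 q2 / B^2"
  proof -
    have "num (m1 / B) (m2 / B) (q1 / B) (q2 / B) =
      max 0 (min (B^2 / B^2) (min ((real_of_int m1 + q1)^2 / B^2) ((real_of_int m2 + q2)^2 / B^2))
       - max (max ((real_of_int m1)^2 / B^2) ((real_of_int m2)^2 / B^2)) (max ((real_of_int m1 - q1)^2 / B^2) ((real_of_int m2 - q2)^2 / B^2)))"
      unfolding num_def sq using B by simp
    also have "\<dots> = max 0 (min (B^2) (min ((real_of_int m1 + q1)^2) ((real_of_int m2 + q2)^2)) / B^2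
       - max (max ((real_of_int m1)^2) ((real_of_int m2)^2)) (max ((real_of_int m1 - q1)^2) ((real_of_int m2 - q2)^2)) / B^2)"
      unfolding mx mn ..
    also have "\<dots> = max (0 / B^2) ((min (B^2) (min ((real_of_int m1 + q1)^2) ((real_of_int m2 + q2)^2))
       - max (max ((real_of_int m1)^2) ((real_of_int m2)^2)) (max ((real_of_int m1 - q1)^2) ((real_of_int m2 - q2)^2))) / B^2)"
      by (simp add: diff_divide_distrib)
    also have "\<dots> = max 0 (min (B^2) (min ((real_of_int m1 + q1)^2) ((real_of_int m2 + q2)^2))
       - max (max ((real_of_int m1)^2) ((real_of_int m2)^2)) (max ((real_of_int m1 - q1)^2) ((real_of_int m2 - q2)^2))) / B^2"
      by (rule mx)
    also have "\<dots> = width B m1 m2 q1 q2 / B^2"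
      unfolding width_def up_def lo_def by (simp add: of_int_max power2_commute)
    finally show ?thesis .
  qed
  then show ?thesis unfolding phi_num using B q by (simp add: power2_eq_square)
qed

lemma AP_q:
  fixes e :: int
  assumes B: "B > 0" and N: "N = \<lfloor>2 * B\<rfloor>" and \<kappa>: "0 < \<kappa>"
  shows "AP B e 0 \<kappa> 2 = {q \<in> {1..N}. e dvd q \<and> \<kappa> * B \<le> q}"
proof -
  have "\<kappa> \<le> q / B \<longleftrightarrow> \<kappa> * B \<le> q" "q / B \<le> 2 \<longleftrightarrow> q \<le> N" for q :: int
    using B unfolding N by (simp_all add: field_simps le_floor_iff)
  moreover have "1 \<le> q" if "\<kappa> * B \<le> q" for q :: int
  proof -
    have "0 < \<kappa> * B" using B \<kappa> by simp
    then have "0 < real_of_int q" using that by linarith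
    then show ?thesis by simp
  qed
  ultimately show ?thesis unfolding AP_def by auto
qed

text \<open>The substitution m1 = m + a, m2 = m. The two index sets do not match exactly, but
  nonzero terms have both m1 and m2 in [1, B), and such pairs occur on either side.\<close>

lemma sum_shift_pairs:
  fixes f :: int
  assumes B: "B \<ge> 1" and N: "N = \<lfloor>2 * B\<rfloor>" and q: "q1 \<ge> 1" "q2 \<ge> 1" and f: "f \<ge> 1"
  shows "(\<Sum>a\<in>{a \<in> {-N..N}. f dvd a}. Ph B N a q1 q2) =
     (\<Sum>m1\<in>AP B 1 0 0 1. \<Sum>m2\<in>AP B f m1 0 1. width B m1 m2 q1 q2 / (q1 * q2))"
proof -
  have B0: "B > 0" using B by simp
  let ?w = "\<lambda>m1 m2. width B m1 m2 q1 q2 / (q1 * q2)"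
  let ?S = "{a \<in> {-N..N}. f dvd a} \<times> {-N..N}"
  let ?T = "Sigma (AP B 1 0 0 1) (\<lambda>m1. AP B f m1 0 1)"
  have finT: "finite ?T" using finite_AP[OF B0] f by auto
  have nz: "1 \<le> m1 \<and> 1 \<le> m2 \<and> m1 < B \<and> m2 < B" if "?w m1 m2 \<noteq> 0" for m1 m2
    using width_eq_0[OF B0 q, of m1 m2] that by force
  have BN: "\<lfloor>B\<rfloor> \<le> N" unfolding N using B by (intro floor_mono) simp
  have "(\<Sum>a\<in>{a \<in> {-N..N}. f dvd a}. Ph B N a q1 q2) = (\<Sum>(a, m)\<in>?S. ?w (m + a) m)"
    unfolding Ph_def by (rule sum.cartesian_product)
  also have "\<dots> = (\<Sum>(m1, m2)\<in>?T. ?w m1 m2)"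
  proof (rule sum.reindex_bij_witness_not_neutral[where i = "\<lambda>(m1, m2). (m1 - m2, m2)" and j = "\<lambda>(a, m). (m + a, m)"
      and S' = "{x \<in> ?S. (case x of (a, m) \<Rightarrow> ?w (m + a) m) = 0}" and T' = "{x \<in> ?T. (case x of (m1, m2) \<Rightarrow> ?w m1 m2) = 0}"])
    show "finite {x \<in> ?S. (case x of (a, m) \<Rightarrow> ?w (m + a) m) = 0}"
      by (rule finite_subset[of _ "{-N..N} \<times> {-N..N}"]) auto
    show "finite {x \<in> ?T. (case x of (m1, m2) \<Rightarrow> ?w m1 m2) = 0}" using finT by simp
    fix x assume x: "x \<in> ?S - {x \<in> ?S. (case x of (a, m) \<Rightarrow> ?w (m + a) m) = 0}"
    obtain a m where am: "x = (a, m)" by (cases x)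
    have n: "?w (m + a) m \<noteq> 0" and fa: "f dvd a" using x am by auto
    have "f dvd m - (m + a)" using fa by simp
    then show "(case x of (a, m) \<Rightarrow> (m + a, m)) \<in> ?T - {x \<in> ?T. (case x of (m1, m2) \<Rightarrow> ?w m1 m2) = 0}"
      using nz[OF n] n B0 unfolding am AP_def by auto
  next
    fix y assume y: "y \<in> ?T - {x \<in> ?T. (case x of (m1, m2) \<Rightarrow> ?w m1 m2) = 0}"
    obtain m1 m2 where mm: "y = (m1, m2)" by (cases y)
    have n: "?w m1 m2 \<noteq> 0" and fd: "f dvd m2 - m1" using y mm by (auto simp: AP_def)
    have "f dvd m1 - m2" using fd by (simp add: dvd_diff_commute)
    moreover have "m1 \<le> \<lfloor>B\<rfloor>" "m2 \<le> \<lfloor>B\<rfloor>" "1 \<le> m1" "1 \<le> m2" using nz[OF n] by linarith+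
    ultimately show "(case y of (m1, m2) \<Rightarrow> (m1 - m2, m2)) \<in> ?S - {x \<in> ?S. (case x of (a, m) \<Rightarrow> ?w (m + a) m) = 0}"
      using n BN unfolding mm by auto
  qed auto
  also have "\<dots> = (\<Sum>m1\<in>AP B 1 0 0 1. \<Sum>m2\<in>AP B f m1 0 1. ?w m1 m2)"
    using finite_AP[OF B0] f by (subst sum.Sigma) auto
  finally show ?thesis .
qed

lemma I4_phic: "0 < \<kappa> \<Longrightarrow> I4 \<kappa> (phic \<kappa>) = I4 \<kappa> phi"
  unfolding I4_def by (intro integral_cong) (auto simp: phic_def cl_id)

text \<open>The conditions that f divides a and e divides both q_i single out a proportion 1 / (f
  e^2) of the triples. The sums are reordered to bring m1 and m2 outside, as
  \<open>riemann_AP_4\<close> expects; the constant is 2665 = 65 * (3 * 13 + 2).\<close>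

lemma sum_Ph_progression:
  fixes e f :: int and B \<kappa> :: real
  assumes B: "B \<ge> 1" and N: "N = \<lfloor>2 * B\<rfloor>" and e: "e \<ge> 1" "e \<le> B" and f: "f \<ge> 1" "f \<le> B" and \<kappa>: "0 < \<kappa>" "\<kappa> \<le> 1"
  shows "\<bar>(\<Sum>(a, q1, q2)\<in>Tr N. if \<kappa> * B \<le> q1 \<and> \<kappa> * B \<le> q2 \<and> f dvd a \<and> e dvd q1 \<and> e dvd q2 then Ph B N a q1 q2 else 0)
     - B^4 / (f * e^2) * I4 \<kappa> phi\<bar> \<le> 2665 * B^3 / \<kappa>^3"
proof -
  have B0: "B > 0" using B by simp
  let ?A = "{a \<in> {-N..N}. f dvd a}"
  let ?Q = "AP B e 0 \<kappa> 2"
  have Q: "?Q = {q \<in> {1..N}. e dvd q \<and> \<kappa> * B \<le> q}" by (rule AP_q[OF B0 N \<kappa>(1)])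
  have "(\<Sum>(a, q1, q2)\<in>Tr N. if \<kappa> * B \<le> q1 \<and> \<kappa> * B \<le> q2 \<and> f dvd a \<and> e dvd q1 \<and> e dvd q2 then Ph B N a q1 q2 else 0)
    = (\<Sum>(a, q1, q2)\<in>?A \<times> ?Q \<times> ?Q. Ph B N a q1 q2)"
    unfolding Q by (rule sum.mono_neutral_cong_right) (auto simp: Tr_def split: if_splits)
  also have "\<dots> = (\<Sum>a\<in>?A. \<Sum>q1\<in>?Q. \<Sum>q2\<in>?Q. Ph B N a q1 q2)"
    by (simp only: sum.cartesian_product case_prod_unfold)
  also have "\<dots> = (\<Sum>q1\<in>?Q. \<Sum>a\<in>?A. \<Sum>q2\<in>?Q. Ph B N a q1 q2)" by (rule sum.swap)
  also have "\<dots> = (\<Sum>q1\<in>?Q. \<Sum>q2\<in>?Q. \<Sum>a\<in>?A. Ph B N a q1 q2)" by (intro sum.cong refl sum.swap)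
  also have "\<dots> = (\<Sum>q1\<in>?Q. \<Sum>q2\<in>?Q. \<Sum>m1\<in>AP B 1 0 0 1. \<Sum>m2\<in>AP B f m1 0 1. width B m1 m2 q1 q2 / (q1 * q2))"
    by (intro sum.cong refl sum_shift_pairs[OF B N _ _ f(1)]) (auto simp: Q)
  also have "\<dots> = (\<Sum>q1\<in>?Q. \<Sum>q2\<in>?Q. \<Sum>m1\<in>AP B 1 0 0 1. \<Sum>m2\<in>AP B f m1 0 1. phic \<kappa> (m1/B) (m2/B) (q1/B) (q2/B))"
  proof (intro sum.cong refl)
    fix q1 q2 m1 m2 assume h: "q1 \<in> ?Q" "q2 \<in> ?Q" "m1 \<in> AP B 1 0 0 1" "m2 \<in> AP B f m1 0 1"
    have q: "q1 \<ge> 1" "q2 \<ge> 1" using h(1,2) unfolding Q by auto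
    have "phic \<kappa> (m1/B) (m2/B) (q1/B) (q2/B) = phi (m1/B) (m2/B) (q1/B) (q2/B)"
      unfolding phic_def using h unfolding AP_def by (simp add: cl_id)
    then show "width B m1 m2 q1 q2 / (q1 * q2) = phic \<kappa> (m1/B) (m2/B) (q1/B) (q2/B)"
      using phi_scaled[OF B0 q] by simp
  qed
  also have "\<dots> = (\<Sum>q1\<in>?Q. \<Sum>m1\<in>AP B 1 0 0 1. \<Sum>q2\<in>?Q. \<Sum>m2\<in>AP B f m1 0 1. phic \<kappa> (m1/B) (m2/B) (q1/B) (q2/B))"
    by (rule sum.cong[OF refl], rule sum.swap)
  also have "\<dots> = (\<Sum>m1\<in>AP B 1 0 0 1. \<Sum>q1\<in>?Q. \<Sum>q2\<in>?Q. \<Sum>m2\<in>AP B f m1 0 1. phic \<kappa> (m1/B) (m2/B) (q1/B) (q2/B))"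
    by (rule sum.swap)
  also have "\<dots> = (\<Sum>m1\<in>AP B 1 0 0 1. \<Sum>q1\<in>?Q. \<Sum>m2\<in>AP B f m1 0 1. \<Sum>q2\<in>?Q. phic \<kappa> (m1/B) (m2/B) (q1/B) (q2/B))"
    by (intro sum.cong[OF refl], rule sum.swap)
  also have "\<dots> = (\<Sum>m1\<in>AP B 1 0 0 1. \<Sum>m2\<in>AP B f m1 0 1. \<Sum>q1\<in>?Q. \<Sum>q2\<in>?Q. phic \<kappa> (m1/B) (m2/B) (q1/B) (q2/B))"
    by (rule sum.cong[OF refl], rule sum.swap)
  finally have eq: "(\<Sum>(a, q1, q2)\<in>Tr N. if \<kappa> * B \<le> q1 \<and> \<kappa> * B \<le> q2 \<and> f dvd a \<and> e dvd q1 \<and> e dvd q2 then Ph B N a q1 q2 else 0)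
    = \<dots>" .
  have "\<bar>(\<Sum>m1\<in>AP B 1 0 0 1. \<Sum>m2\<in>AP B f m1 0 1. \<Sum>q1\<in>?Q. \<Sum>q2\<in>?Q. phic \<kappa> (m1/B) (m2/B) (q1/B) (q2/B))
     - B^4 / (f * e^2) * I4 \<kappa> (phic \<kappa>)\<bar> \<le> 65 * B^3 * (3 * (13 / \<kappa>^3) + 2 * (1 / \<kappa>^2))"
    by (rule riemann_AP_4[OF B e f \<kappa> phic_lip[OF \<kappa>] phic_bound[OF \<kappa>]])
  also have "\<dots> \<le> 65 * B^3 * (3 * (13 / \<kappa>^3) + 2 * (1 / \<kappa>^3))"
  proof (intro mult_left_mono add_left_mono)
    have "\<kappa>^3 \<le> \<kappa>^2" using \<kappa> by (intro power_decreasing) auto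
    then show "1 / \<kappa>^2 \<le> 1 / \<kappa>^3" using \<kappa> by (intro divide_left_mono) auto
  qed (use B0 in auto)
  also have "\<dots> = 2665 * B^3 / \<kappa>^3" by simp
  finally show ?thesis unfolding eq I4_phic[OF \<kappa>(1)] .
qed


section \<open>The singular series\<close>

text \<open>This is the modulus that turns the condition that e divides 2 a into a condition on a
  alone: the factor 2 is invertible modulo an odd e and cancels against an even one.\<close>

definition half2 :: "int \<Rightarrow> int" where "half2 e = e div gcd e 2"

lemma half2_dvd_iff:
  fixes e a :: int
  assumes "e \<ge> 1"
  shows "half2 e dvd a \<longleftrightarrow> e dvd 2 * a"
proof -
  let ?g = "gcd e 2"
  have g: "?g > 0" using assms by simp
  have e: "e = ?g * half2 e" unfolding half2_def by simp
  define h where "h = 2 div ?g"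
  have t: "2 = ?g * h" unfolding h_def by simp
  have "coprime (half2 e) h" unfolding half2_def h_def using assms by (intro div_gcd_coprime) auto
  have "e dvd 2 * a \<longleftrightarrow> ?g * half2 e dvd ?g * (h * a)" using e t by (metis mult.assoc)
  also have "\<dots> \<longleftrightarrow> half2 e dvd h * a" using g by simp
  also have "\<dots> \<longleftrightarrow> half2 e dvd a" using \<open>coprime (half2 e) h\<close> by (simp add: coprime_dvd_mult_right_iff)
  finally show ?thesis by simp
qed

lemma half2_bounds: "e \<ge> 1 \<Longrightarrow> 1 \<le> half2 e \<and> half2 e \<le> e"
proof -
  assume e: "e \<ge> 1"
  then have "e = gcd e 2 * half2 e" "gcd e 2 \<ge> 1" unfolding half2_def by (auto simp: int_one_le_iff_zero_less)
  then show ?thesis using e by (smt (verit) mult_le_cancel_right1 zero_less_mult_iff)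
qed

lemma sum_totient_dvd:
  fixes n N :: int
  assumes "1 \<le> n" "n \<le> N"
  shows "(\<Sum>e\<in>{1..N}. if e dvd n then real (totient (nat e)) else 0) = n"
proof -
  have "(\<Sum>e\<in>{1..N}. if e dvd n then real (totient (nat e)) else 0) = (\<Sum>e\<in>{e \<in> {1..N}. e dvd n}. real (totient (nat e)))"
    by (rule sum.inter_filter[symmetric]) simp
  also have "\<dots> = (\<Sum>d\<in>{d. d dvd nat n}. real (totient d))"
  proof (rule sum.reindex_bij_witness[of _ int nat])
    fix d assume d: "d \<in> {d. d dvd nat n}"
    then have "int d dvd n" using assms by (simp add: nat_dvd_iff int_dvd_int_iff[symmetric])
    moreover from this have "int d \<le> n" using assms by (intro zdvd_imp_le) auto
    moreover have "d \<noteq> 0" using d assms by (intro notI) auto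
    ultimately show "int d \<in> {e \<in> {1..N}. e dvd n}" using assms by auto
  qed (use assms in \<open>auto simp: nat_dvd_iff\<close>)
  also have "\<dots> = real (\<Sum>d | d dvd nat n. totient d)" by simp
  also have "\<dots> = n" using assms by (simp add: totient_divisor_sum)
  finally show ?thesis .
qed

text \<open>The three terms come from \<open>\<omega> = gcd (a, q1, q2) - [q1, q2 even] gcd (a, q1, q2) + [a, q1, q2 even] gcd (2 a, q1, q2)\<close>.\<close>

definition br :: "int \<Rightarrow> int \<Rightarrow> int \<Rightarrow> int \<Rightarrow> real" where
  "br e a q1 q2 = of_bool (e dvd a \<and> e dvd q1 \<and> e dvd q2) - of_bool (e dvd a \<and> lcm 2 e dvd q1 \<and> lcm 2 e dvd q2)
     + of_bool (lcm 2 (half2 e) dvd a \<and> lcm 2 e dvd q1 \<and> lcm 2 e dvd q2)"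

text \<open>If q1 and q2 are not both even, G is odd, hence equals gcd (a, q1, q2) and divides a^2.
  If both are even and a is odd, G is even and cannot divide a^2, while the first two terms of
  \<open>br\<close> cancel. If all three are even, a = 2 b gives a^2 = (2 a) b, so G divides a^2 and
  the third term alone survives. Each gcd is the sum of \<open>totient\<close> over its
  divisors.\<close>

lemma omega_eq_sum:
  assumes tr: "(a, q1, q2) \<in> Tr N"
  shows "omega a q1 q2 = (\<Sum>e\<in>{1..N}. totient (nat e) * br e a q1 q2)"
proof -
  have q: "1 \<le> q1" "q1 \<le> N" "1 \<le> q2" using tr unfolding Tr_def by auto
  define g1 where "g1 = gcd (gcd a q1) q2"
  define ev where "ev \<longleftrightarrow> even q1 \<and> even q2"
  have g1d: "e dvd g1 \<longleftrightarrow> e dvd a \<and> e dvd q1 \<and> e dvd q2" for e unfolding g1_def by (simp add: conj_assoc)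
  note Gd = dvd_G_iff[of _ a q1 q2]
  have g1: "1 \<le> g1" "g1 \<le> N"
    using q zdvd_imp_le[of g1 q1] g1d[of g1] unfolding g1_def by (auto simp: int_one_le_iff_zero_less)
  have G1: "1 \<le> G a q1 q2" "G a q1 q2 \<le> N"
    using q zdvd_imp_le[of "G a q1 q2" q1] Gd[of "G a q1 q2"] G_pos[OF q(1)] by (auto simp: int_one_le_iff_zero_less)
  have "totient (nat e) * br e a q1 q2 = (if e dvd g1 then real (totient (nat e)) else 0) - of_bool ev * (if e dvd g1 then real (totient (nat e)) else 0)
     + of_bool (ev \<and> even a) * (if e dvd G a q1 q2 then real (totient (nat e)) else 0)" if "e \<in> {1..N}" for e
  proof -
    have "lcm 2 (half2 e) dvd a \<longleftrightarrow> even a \<and> e dvd 2 * a" using half2_dvd_iff[of e a] that by simp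
    then show ?thesis unfolding br_def g1d Gd ev_def by auto
  qed
  then have "(\<Sum>e\<in>{1..N}. totient (nat e) * br e a q1 q2) = (\<Sum>e\<in>{1..N}. (if e dvd g1 then real (totient (nat e)) else 0)
     - of_bool ev * (if e dvd g1 then real (totient (nat e)) else 0)
     + of_bool (ev \<and> even a) * (if e dvd G a q1 q2 then real (totient (nat e)) else 0))" by (rule sum.cong[OF refl])
  also have "\<dots> = real_of_int g1 - of_bool ev * real_of_int g1 + of_bool (ev \<and> even a) * real_of_int (G a q1 q2)"
    by (simp only: sum.distrib sum_subtractf sum_distrib_left[symmetric] sum_totient_dvd[OF g1] sum_totient_dvd[OF G1])
  also have "\<dots> = omega a q1 q2"
  proof (cases ev)
    case False
    have "odd (G a q1 q2)"
    proof
      assume "even (G a q1 q2)"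
      then show False using False Gd[of 2] unfolding ev_def by simp
    qed
    then have "coprime (G a q1 q2) 2" by simp
    then have "G a q1 q2 dvd a" using Gd[of "G a q1 q2"] by (simp add: coprime_dvd_mult_right_iff)
    then have d: "G a q1 q2 dvd g1" using Gd[of "G a q1 q2"] g1d by simp
    have "g1 dvd G a q1 q2" using Gd[of g1] g1d[of g1] by simp
    then have "G a q1 q2 = g1" using d G1 g1 by (intro zdvd_antisym_nonneg) auto
    moreover have "G a q1 q2 dvd a^2" using \<open>G a q1 q2 dvd a\<close> by (simp add: power2_eq_square)
    ultimately show ?thesis using False unfolding omega_def by simp
  next
    case True
    have eG: "even (G a q1 q2)" using True Gd[of 2] unfolding ev_def by simp
    show ?thesis
    proof (cases "even a")
      case False
      have "\<not> G a q1 q2 dvd a^2"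
      proof
        assume "G a q1 q2 dvd a^2"
        then have "even (a^2)" using eG dvd_trans by blast
        then show False using False by simp
      qed
      then show ?thesis using True False unfolding omega_def by simp
    next
      case ea: True
      then obtain b where b: "a = 2 * b" by (elim evenE)
      have "G a q1 q2 dvd 2 * a" using Gd[of "G a q1 q2"] by simp
      then have "G a q1 q2 dvd (2 * a) * b" by simp
      also have "(2 * a) * b = a^2" unfolding b by (simp add: power2_eq_square)
      finally show ?thesis using True ea unfolding omega_def by simp
    qed
  qed
  finally show ?thesis by simp
qed

lemma br_bound:
  assumes "e \<ge> 1"
  shows "\<bar>br e a q1 q2\<bar> \<le> (if e dvd G a q1 q2 then 2 else 0)"
proof (cases "e dvd G a q1 q2")
  case True
  then show ?thesis unfolding br_def by (simp add: of_bool_def)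
next
  case False
  have "lcm 2 (half2 e) dvd a \<Longrightarrow> e dvd 2 * a" using half2_dvd_iff[OF assms, of a] by simp
  then show ?thesis using False unfolding dvd_G_iff br_def by auto
qed

text \<open>Only divisors e > D of G contribute to the remainder. There are none unless G > D, and
  the totients of all divisors of G add up to G.\<close>

lemma omega_truncate:
  assumes tr: "(a, q1, q2) \<in> Tr N" and D: "D \<ge> 0" "D \<le> N"
  shows "\<bar>omega a q1 q2 - (\<Sum>e\<in>{1..D}. totient (nat e) * br e a q1 q2)\<bar> \<le> 2 * (if G a q1 q2 > D then G a q1 q2 else 0)"
proof -
  have q: "1 \<le> q1" "q1 \<le> N" "1 \<le> q2" using tr unfolding Tr_def by auto
  have G1: "1 \<le> G a q1 q2" "G a q1 q2 \<le> N"
    using q zdvd_imp_le[OF G_dvd(2)[of a q1 q2]] G_pos[OF q(1), of a q2] by auto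
  have "{1..N} = {1..D} \<union> {D+1..N}" using D by auto
  then have "omega a q1 q2 = (\<Sum>e\<in>{1..D}. totient (nat e) * br e a q1 q2) + (\<Sum>e\<in>{D+1..N}. totient (nat e) * br e a q1 q2)"
    unfolding omega_eq_sum[OF tr] by (simp add: sum.union_disjoint)
  then have "\<bar>omega a q1 q2 - (\<Sum>e\<in>{1..D}. totient (nat e) * br e a q1 q2)\<bar> = \<bar>\<Sum>e\<in>{D+1..N}. totient (nat e) * br e a q1 q2\<bar>" by simp
  also have "\<dots> \<le> (\<Sum>e\<in>{D+1..N}. \<bar>totient (nat e) * br e a q1 q2\<bar>)" by (rule sum_abs)
  also have "\<dots> \<le> (\<Sum>e\<in>{D+1..N}. totient (nat e) * (if e dvd G a q1 q2 then 2 else (0::real)))"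
    unfolding abs_mult using D br_bound by (intro sum_mono mult_mono) auto
  also have "\<dots> \<le> 2 * (if G a q1 q2 > D then G a q1 q2 else 0)"
  proof (cases "G a q1 q2 > D")
    case True
    have "(\<Sum>e\<in>{D+1..N}. totient (nat e) * (if e dvd G a q1 q2 then 2 else (0::real))) \<le> (\<Sum>e\<in>{1..N}. totient (nat e) * (if e dvd G a q1 q2 then 2 else (0::real)))"
      using D by (intro sum_mono2) auto
    also have "\<dots> = 2 * (\<Sum>e\<in>{1..N}. if e dvd G a q1 q2 then real (totient (nat e)) else 0)"
      unfolding sum_distrib_left by (rule sum.cong) auto
    finally show ?thesis using True by (simp add: sum_totient_dvd[OF G1])
  next
    case False
    have "(\<Sum>e\<in>{D+1..N}. totient (nat e) * (if e dvd G a q1 q2 then 2 else (0::real))) = 0"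
    proof (rule sum.neutral, safe)
      fix e assume e: "e \<in> {D+1..N}"
      have "\<not> e dvd G a q1 q2" using zdvd_not_zless[of "G a q1 q2" e] G1 False e by auto
      then show "totient (nat e) * (if e dvd G a q1 q2 then 2 else (0::real)) = 0" by simp
    qed
    then show ?thesis using False by simp
  qed
  finally show ?thesis .
qed

text \<open>\<open>totient e\<close> times the asymptotic density, among the triples (a, q1, q2), of
  each of the three divisibility patterns in \<open>br e\<close>.\<close>

definition cc :: "int \<Rightarrow> real" where
  "cc e = totient (nat e) * (1 / (e * e^2) - 1 / (e * (lcm 2 e)^2) + 1 / (lcm 2 (half2 e) * (lcm 2 e)^2))"

text \<open>For q_i \<ge> \<kappa> B one has \<open>Ph\<close> \<le> 16 B / \<kappa>, so
  \<open>sum_G_tail\<close> bounds the truncation at D by 16 * 2 * 5 * 8 = 1280 times B^4 /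
  (\<kappa> D). Each of the D retained values e involves three progressions, with
  \<open>totient e\<close> at most D, whence 7995 D^2 with 7995 = 3 * 2665. The moduli reach lcm (2,
  e) \<le> 2 D, which must not exceed B.\<close>

lemma main_sum_approx:
  fixes B \<kappa> :: real and N D :: int
  assumes B: "B \<ge> 1" and N: "N = \<lfloor>2 * B\<rfloor>" and \<kappa>: "0 < \<kappa>" "\<kappa> \<le> 1" and D: "D \<ge> 1" "2 * D \<le> B"
  shows "\<bar>(\<Sum>(a, q1, q2)\<in>Tr N. if \<kappa> * B \<le> q1 \<and> \<kappa> * B \<le> q2 then omega a q1 q2 * Ph B N a q1 q2 else 0)
     - B^4 * I4 \<kappa> phi * (\<Sum>e\<in>{1..D}. cc e)\<bar> \<le> 7995 * (real_of_int D)^2 * B^3 / \<kappa>^3 + 1280 * B^4 / (\<kappa> * D)"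
proof -
  have B0: "B > 0" using B by simp
  have N1: "N \<ge> 1" and NB: "real_of_int N \<le> 2 * B" using B unfolding N by linarith+
  have DN: "D \<le> N" using D B unfolding N by linarith
  let ?P = "\<lambda>q1 q2. \<kappa> * B \<le> real_of_int q1 \<and> \<kappa> * B \<le> real_of_int q2"
  define R where "R f e = (\<Sum>(a, q1, q2)\<in>Tr N. if \<kappa> * B \<le> q1 \<and> \<kappa> * B \<le> q2 \<and> f dvd a \<and> e dvd q1 \<and> e dvd q2 then Ph B N a q1 q2 else 0)" for f e
  let ?om = "\<lambda>t. case t of (a, q1, q2) \<Rightarrow> if ?P q1 q2 then omega a q1 q2 * Ph B N a q1 q2 else 0"
  let ?tr = "\<lambda>t. case t of (a, q1, q2) \<Rightarrow> if ?P q1 q2 then (\<Sum>e\<in>{1..D}. totient (nat e) * br e a q1 q2) * Ph B N a q1 q2 else 0"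
  have 1: "\<bar>sum ?om (Tr N) - sum ?tr (Tr N)\<bar> \<le> 1280 * B^4 / (\<kappa> * D)"
  proof -
    have "\<bar>sum ?om (Tr N) - sum ?tr (Tr N)\<bar> \<le> (\<Sum>t\<in>Tr N. \<bar>?om t - ?tr t\<bar>)" by (simp only: sum_subtractf[symmetric] sum_abs)
    also have "\<dots> \<le> (\<Sum>t\<in>Tr N. 16 * B / \<kappa> * (2 * (case t of (a, q1, q2) \<Rightarrow> if G a q1 q2 > D then real_of_int (G a q1 q2) else 0)))"
    proof (rule sum_mono)
      fix t assume t: "t \<in> Tr N"
      obtain a q1 q2 where tt: "t = (a, q1, q2)" by (cases t)
      have q: "1 \<le> q1" "1 \<le> q2" using t tt unfolding Tr_def by auto
      have G0: "0 \<le> (if G a q1 q2 > D then real_of_int (G a q1 q2) else 0)" using G_pos[OF q(1), of a q2] by simp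
      have "\<bar>?om t - ?tr t\<bar> \<le> (16 * B / \<kappa>) * (2 * (if G a q1 q2 > D then real_of_int (G a q1 q2) else 0))"
      proof (cases "?P q1 q2")
        case True
        have "\<kappa> * B = sqrt (\<kappa> * B) * sqrt (\<kappa> * B)" using \<kappa> B0 by simp
        also have "\<dots> \<le> sqrt q1 * sqrt q2" using True \<kappa> B0 q by (intro mult_mono) auto
        finally have sq: "\<kappa> * B \<le> sqrt q1 * sqrt q2" .
        have "Ph B N a q1 q2 \<le> 4 * (real_of_int N)^2 / (sqrt q1 * sqrt q2)" by (rule Ph_bound[OF B N q])
        also have "\<dots> \<le> 4 * (2 * B)^2 / (\<kappa> * B)"
          using sq N1 NB \<kappa> B0 by (intro frac_le mult_left_mono power_mono) auto
        also have "\<dots> = 16 * B / \<kappa>" using B0 by (simp add: power2_eq_square)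
        finally have P: "Ph B N a q1 q2 \<le> 16 * B / \<kappa>" .
        have "\<bar>?om t - ?tr t\<bar> = \<bar>(omega a q1 q2 - (\<Sum>e\<in>{1..D}. totient (nat e) * br e a q1 q2)) * Ph B N a q1 q2\<bar>"
          using True tt by (simp add: left_diff_distrib)
        also have "\<dots> = Ph B N a q1 q2 * \<bar>omega a q1 q2 - (\<Sum>e\<in>{1..D}. totient (nat e) * br e a q1 q2)\<bar>"
          using Ph_nonneg[OF q] by (simp add: abs_mult)
        also have "\<dots> \<le> (16 * B / \<kappa>) * (2 * (if G a q1 q2 > D then real_of_int (G a q1 q2) else 0))"
        proof (rule mult_mono[OF P])
          show "\<bar>omega a q1 q2 - (\<Sum>e\<in>{1..D}. totient (nat e) * br e a q1 q2)\<bar> \<le> 2 * (if G a q1 q2 > D then real_of_int (G a q1 q2) else 0)"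
            using omega_truncate[of a q1 q2 N D] t tt D DN by (simp split: if_splits)
        qed (use B0 \<kappa> in auto)
        finally show ?thesis .
      next
        case False
        have z: "?om t - ?tr t = 0" unfolding tt prod.case if_not_P[OF False] by simp
        show ?thesis unfolding z using G0 B0 \<kappa> by (intro order_trans[OF _ mult_nonneg_nonneg]) auto
      qed
      then show "\<bar>?om t - ?tr t\<bar> \<le> 16 * B / \<kappa> * (2 * (case t of (a, q1, q2) \<Rightarrow> if G a q1 q2 > D then real_of_int (G a q1 q2) else 0))"
        unfolding tt by simp
    qed
    also have "\<dots> = 16 * B / \<kappa> * (2 * (\<Sum>(a, q1, q2)\<in>Tr N. if G a q1 q2 > D then real_of_int (G a q1 q2) else 0))"
      by (simp only: sum_distrib_left)
    also have "\<dots> \<le> 16 * B / \<kappa> * (2 * (5 * (2 * B)^3 / D))"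
    proof (intro mult_left_mono order_trans[OF sum_G_tail[OF D(1) N1]] divide_right_mono power_mono NB)
    qed (use B0 \<kappa> D N1 in auto)
    also have "\<dots> = 1280 * B^4 / (\<kappa> * D)" by (simp add: power3_eq_cube eval_nat_numeral)
    finally show ?thesis .
  qed
  have 2: "sum ?tr (Tr N) = (\<Sum>e\<in>{1..D}. totient (nat e) * (R e e - R e (lcm 2 e) + R (lcm 2 (half2 e)) (lcm 2 e)))"
  proof -
    have "sum ?tr (Tr N) = (\<Sum>t\<in>Tr N. \<Sum>e\<in>{1..D}. totient (nat e) * (case t of (a, q1, q2) \<Rightarrow> if ?P q1 q2 then br e a q1 q2 * Ph B N a q1 q2 else 0))"
      by (rule sum.cong[OF refl]) (auto simp: sum_distrib_right mult.assoc)
    also have "\<dots> = (\<Sum>e\<in>{1..D}. \<Sum>t\<in>Tr N. totient (nat e) * (case t of (a, q1, q2) \<Rightarrow> if ?P q1 q2 then br e a q1 q2 * Ph B N a q1 q2 else 0))"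
      by (rule sum.swap)
    also have "\<dots> = (\<Sum>e\<in>{1..D}. totient (nat e) * (R e e - R e (lcm 2 e) + R (lcm 2 (half2 e)) (lcm 2 e)))"
      unfolding R_def sum_distrib_left[symmetric] sum_subtractf[symmetric] sum.distrib[symmetric]
      by (intro sum.cong refl arg_cong2[where f = "(*)"]) (auto simp: br_def of_bool_def algebra_simps)
    finally show ?thesis .
  qed
  have RR: "\<bar>R f e - B^4 / real_of_int (f * e^2) * I4 \<kappa> phi\<bar> \<le> 2665 * B^3 / \<kappa>^3" if "1 \<le> f" "f \<le> B" "1 \<le> e" "e \<le> B" for f e
    unfolding R_def using sum_Ph_progression[OF B N that(3,4,1,2) \<kappa>] by simp
  have 3: "\<bar>totient (nat e) * (R e e - R e (lcm 2 e) + R (lcm 2 (half2 e)) (lcm 2 e)) - B^4 * I4 \<kappa> phi * cc e\<bar>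
      \<le> D * (7995 * B^3 / \<kappa>^3)" if e: "e \<in> {1..D}" for e
  proof -
    have ll: "lcm 2 e \<le> 2 * e" using e by (intro zdvd_imp_le lcm_least) auto
    have hb: "1 \<le> half2 e" "half2 e \<le> e" using half2_bounds[of e] e by auto
    have "lcm 2 (half2 e) \<le> 2 * half2 e" using hb by (intro zdvd_imp_le lcm_least) auto
    then have lh: "lcm 2 (half2 e) \<le> 2 * e" using hb by linarith
    have pos: "1 \<le> lcm 2 e" "1 \<le> lcm 2 (half2 e)" using e hb by (auto simp: int_one_le_iff_zero_less lcm_pos_int)
    have eD: "e \<le> D" using e by simp
    have eB: "e \<le> B" "lcm 2 e \<le> B" "lcm 2 (half2 e) \<le> B" using ll lh eD D by linarith+
    have e1: "1 \<le> e" using e by simp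
    have r: "\<bar>R e e - B^4 / (e * e^2) * I4 \<kappa> phi\<bar> \<le> 2665 * B^3 / \<kappa>^3"
       "\<bar>R e (lcm 2 e) - B^4 / (e * (lcm 2 e)^2) * I4 \<kappa> phi\<bar> \<le> 2665 * B^3 / \<kappa>^3"
       "\<bar>R (lcm 2 (half2 e)) (lcm 2 e) - B^4 / (lcm 2 (half2 e) * (lcm 2 e)^2) * I4 \<kappa> phi\<bar> \<le> 2665 * B^3 / \<kappa>^3"
      by (intro RR e1 eB pos)+
    have "totient (nat e) * (R e e - R e (lcm 2 e) + R (lcm 2 (half2 e)) (lcm 2 e)) - B^4 * I4 \<kappa> phi * cc e
      = totient (nat e) * ((R e e - B^4 / (e * e^2) * I4 \<kappa> phi) - (R e (lcm 2 e) - B^4 / (e * (lcm 2 e)^2) * I4 \<kappa> phi)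
        + (R (lcm 2 (half2 e)) (lcm 2 e) - B^4 / (lcm 2 (half2 e) * (lcm 2 e)^2) * I4 \<kappa> phi))"
      unfolding cc_def by (simp add: algebra_simps)
    also have "\<bar>\<dots>\<bar> \<le> D * (7995 * B^3 / \<kappa>^3)"
      unfolding abs_mult
    proof (rule mult_mono)
      have "totient (nat e) \<le> nat e" by (rule totient_le)
      then have "real (totient (nat e)) \<le> real (nat e)" by simp
      also have "\<dots> \<le> D" using e by simp
      finally show "\<bar>real (totient (nat e))\<bar> \<le> real_of_int D" by simp
      show "\<bar>(R e e - B^4 / (e * e^2) * I4 \<kappa> phi) - (R e (lcm 2 e) - B^4 / (e * (lcm 2 e)^2) * I4 \<kappa> phi)
        + (R (lcm 2 (half2 e)) (lcm 2 e) - B^4 / (lcm 2 (half2 e) * (lcm 2 e)^2) * I4 \<kappa> phi)\<bar> \<le> 7995 * B^3 / \<kappa>^3"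
      proof -
        have t: "\<bar>x - y + z\<bar> \<le> w" if "\<bar>x\<bar> \<le> c" "\<bar>y\<bar> \<le> c" "\<bar>z\<bar> \<le> c" "3 * c = w" for x y z c w :: real using that by linarith
        show ?thesis by (rule t[OF r]) simp
      qed
    qed (use D in auto)
    finally show ?thesis .
  qed
  have 4: "\<bar>sum ?tr (Tr N) - B^4 * I4 \<kappa> phi * (\<Sum>e\<in>{1..D}. cc e)\<bar> \<le> D * (D * (7995 * B^3 / \<kappa>^3))"
    unfolding 2 sum_distrib_left[of _ cc] by (rule sum_approx_step[OF 3]) (use D B0 \<kappa> in auto)
  have "\<bar>sum ?om (Tr N) - B^4 * I4 \<kappa> phi * (\<Sum>e\<in>{1..D}. cc e)\<bar> \<le> 1280 * B^4 / (\<kappa> * D) + D * (D * (7995 * B^3 / \<kappa>^3))"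
    using 1 4 by linarith
  also have "\<dots> = 7995 * (real_of_int D)^2 * B^3 / \<kappa>^3 + 1280 * B^4 / (\<kappa> * D)" by (simp add: power2_eq_square)
  finally show ?thesis .
qed


section \<open>The series of totients and the factor 13/14\<close>

lemma has_sum_zeta:
  assumes "k \<ge> 2"
  shows "((\<lambda>n::nat. 1 / real n ^ k) has_sum zeta (real k)) {1..}"
proof -
  have "summable (\<lambda>n. inverse (real n ^ k))" by (rule inverse_power_summable[OF assms])
  then have "summable (\<lambda>n. 1 / real (Suc n) ^ k)" by (subst (asm) summable_Suc_iff[symmetric]) (simp add: inverse_eq_divide)
  then have "(\<lambda>n. 1 / real (Suc n) ^ k) sums (\<Sum>n. 1 / real (Suc n) ^ k)" by (rule summable_sums)
  also have "(\<Sum>n. 1 / real (Suc n) ^ k) = zeta (real k)"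
    unfolding zeta_def by (intro suminf_cong) (simp add: powr_realpow del: of_nat_Suc)
  finally have "((\<lambda>n. 1 / real (Suc n) ^ k) has_sum zeta (real k)) UNIV"
    by (rule sums_nonneg_imp_has_sum) simp
  moreover have "bij_betw Suc UNIV {1..}"
    by (rule bij_betwI[of _ _ _ "\<lambda>n. n - 1"]) auto
  ultimately show ?thesis using has_sum_reindex_bij_betw[of Suc UNIV "{1..}" "\<lambda>n. 1 / real n ^ k"] by simp
qed

definition A :: "nat \<Rightarrow> real" where "A n = totient n / real n ^ 3"

lemma A_bounds: "0 \<le> A n" "A n \<le> 1 / real n ^ 2"
proof -
  show "0 \<le> A n" unfolding A_def by simp
  have "totient n / real n ^ 3 \<le> real n / real n ^ 3" using totient_le[of n] by (intro divide_right_mono) auto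
  also have "\<dots> = 1 / real n ^ 2" by (cases "n = 0") (simp_all add: power2_eq_square power3_eq_cube)
  finally show "A n \<le> 1 / real n ^ 2" unfolding A_def .
qed

lemma A_summable: "A summable_on {1..}"
proof (rule summable_on_comparison_test)
  show "(\<lambda>n::nat. 1 / real n ^ 2) summable_on {1..}" using has_sum_zeta[of 2] has_sum_imp_summable by blast
qed (use A_bounds in auto)

lemma zeta_pos: "k \<ge> 2 \<Longrightarrow> zeta (real k) > 0"
proof -
  assume k: "k \<ge> 2"
  have "(\<Sum>n\<in>{1::nat}. 1 / real n ^ k) \<le> zeta (real k)"
    by (rule finite_sum_le_has_sum[OF has_sum_zeta[OF k]]) auto
  then show ?thesis by simp
qed

text \<open>The Dirichlet convolution of \<open>totient\<close> with 1 is the identity.\<close>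

lemma has_sum_A: "(A has_sum (zeta 2 / zeta 3)) {1..}"
proof -
  define Z where "Z = infsum A {1..}"
  have Z: "(A has_sum Z) {1..}" unfolding Z_def using A_summable by (rule has_sum_infsum)
  have z2: "((\<lambda>n::nat. 1 / real n ^ 2) has_sum zeta 2) {1..}" using has_sum_zeta[of 2] by simp
  have z3: "((\<lambda>n::nat. 1 / real n ^ 3) has_sum zeta 3) {1..}" using has_sum_zeta[of 3] by simp
  let ?f = "\<lambda>(d, k). A d * (1 / real k ^ 3)"
  have inner: "((\<lambda>k. ?f (d, k)) has_sum (A d * zeta 3)) {1..}" for d
    using has_sum_cmult_right[OF z3, of "A d"] by simp
  have outer: "((\<lambda>d. A d * zeta 3) has_sum (Z * zeta 3)) {1..}" by (rule has_sum_cmult_left[OF Z])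
  have sm: "?f summable_on ({1..} \<times> {1..})"
    by (rule summable_on_SigmaI[OF inner]) (use outer has_sum_imp_summable A_bounds in auto)
  have p: "(?f has_sum (Z * zeta 3)) ({1..} \<times> {1..})"
    by (rule has_sum_SigmaI[OF inner outer sm])
  let ?h = "\<lambda>(n, d). totient d / real n ^ 3"
  have "(?f has_sum (Z * zeta 3)) ({1..} \<times> {1..}) \<longleftrightarrow> (?h has_sum (Z * zeta 3)) (Sigma {1..} (\<lambda>n. {d. d dvd n}))"
    by (rule has_sum_reindex_bij_witness[of _ "\<lambda>(n, d). (d, n div d)" "\<lambda>(d, k). (d * k, d)"])
       (auto simp: A_def power_mult_distrib Suc_le_eq dvd_div_eq_0_iff intro!: Nat.gr0I)
  then have q: "(?h has_sum (Z * zeta 3)) (Sigma {1..} (\<lambda>n. {d. d dvd n}))" using p by blast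
  have "((\<lambda>n::nat. 1 / real n ^ 2) has_sum (Z * zeta 3)) {1..}"
  proof (rule has_sum_SigmaD[OF q])
    fix n :: nat assume n: "n \<in> {1..}"
    have "(\<Sum>d | d dvd n. totient d / real n ^ 3) = real (\<Sum>d | d dvd n. totient d) / real n ^ 3"
      by (simp add: sum_divide_distrib)
    also have "\<dots> = 1 / real n ^ 2" unfolding totient_divisor_sum using n by (simp add: power2_eq_square power3_eq_cube)
    finally have "(\<Sum>d | d dvd n. totient d / real n ^ 3) = 1 / real n ^ 2" .
    then show "((\<lambda>d. ?h (n, d)) has_sum (1 / real n ^ 2)) {d. d dvd n}"
      using has_sum_finite[of "{d. d dvd n}" "\<lambda>d. totient d / real n ^ 3"] n by simp
  qed
  then have "Z * zeta 3 = zeta 2" using z2 has_sum_unique by blast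
  then have "Z = zeta 2 / zeta 3" using zeta_pos[of 3] by (simp add: field_simps)
  then show ?thesis using Z by simp
qed

text \<open>Splitting according to parity, the identity \<open>A_double\<close> expresses both the even part of \<open>\<Sum> A n\<close> and the weighted sum
  through the odd part.\<close>

lemma A_double: "A (2 * m) = A m / 8 * (if even m then 2 else 1)"
  unfolding A_def totient_double by (simp add: power_mult_distrib)

text \<open>The bracket of \<open>cc n\<close> times n^3. For odd n it is 1 - 1/4 + 1/8 = 7/8. For
  even n one has lcm (2, n) = n, the first two terms cancel, and the third is n / lcm (2, n / 2):
  this is 1 if n / 2 is odd and 2 if n / 2 is even.\<close>

definition wt :: "nat \<Rightarrow> real" where
  "wt n = (if odd n then 7/8 else if odd (n div 2) then 1 else 2)"

text \<open>Doubling gives se = so / 8 + se / 4, hence se = so / 6 and a total of 7/6 so. The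
  weighted sum is 7/8 so + (so / 8 + se / 2) = 13/12 so, and the quotient of the two is
  13/14.\<close>

lemma has_sum_A_wt: "((\<lambda>n. A n * wt n) has_sum (13 * zeta 2 / (14 * zeta 3))) {1..}"
proof -
  let ?Od = "{n::nat. n \<ge> 1 \<and> odd n}" and ?Ev = "{n::nat. n \<ge> 1 \<and> even n}"
  have S: "{1..} = ?Od \<union> ?Ev" by auto
  define so where "so = infsum A ?Od"
  define se where "se = infsum A ?Ev"
  have O: "(A has_sum so) ?Od" unfolding so_def
    by (rule has_sum_infsum) (rule summable_on_subset_banach[OF A_summable], auto)
  have E: "(A has_sum se) ?Ev" unfolding se_def
    by (rule has_sum_infsum) (rule summable_on_subset_banach[OF A_summable], auto)
  have bij: "bij_betw ((*) 2) {1..} ?Ev"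
    by (rule bij_betwI[of _ _ _ "\<lambda>n. n div 2"]) auto
  have split: "(f has_sum (s + t)) {1..}" if "(f has_sum s) ?Od" "(f has_sum t) ?Ev" for f :: "nat \<Rightarrow> real" and s t
    unfolding S by (rule has_sum_Un_disjoint[OF that]) auto
  have Z: "so + se = zeta 2 / zeta 3" using split[OF O E] has_sum_A has_sum_unique by blast
  have "((\<lambda>m. A (2 * m)) has_sum se) {1..}"
    using E has_sum_reindex_bij_betw[OF bij, of A] by simp
  moreover have "((\<lambda>m. A (2 * m)) has_sum (so / 8 + se / 4)) {1..}"
  proof (rule split)
    have "((\<lambda>m. A m * (1/8)) has_sum (so * (1/8))) ?Od" by (rule has_sum_cmult_left[OF O])
    then show "((\<lambda>m. A (2 * m)) has_sum (so / 8)) ?Od"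
      by (subst has_sum_cong[where g = "\<lambda>m. A m * (1/8)"]) (auto simp: A_double)
    have "((\<lambda>m. A m * (1/4)) has_sum (se * (1/4))) ?Ev" by (rule has_sum_cmult_left[OF E])
    then show "((\<lambda>m. A (2 * m)) has_sum (se / 4)) ?Ev"
      by (subst has_sum_cong[where g = "\<lambda>m. A m * (1/4)"]) (auto simp: A_double)
  qed
  ultimately have eq: "se = so / 8 + se / 4" using has_sum_unique by blast
  have "((\<lambda>m. A (2 * m) * wt (2 * m)) has_sum (so / 8 + se / 2)) {1..}"
  proof (rule split)
    have "((\<lambda>m. A m * (1/8)) has_sum (so * (1/8))) ?Od" by (rule has_sum_cmult_left[OF O])
    then show "((\<lambda>m. A (2 * m) * wt (2 * m)) has_sum (so / 8)) ?Od"
      by (subst has_sum_cong[where g = "\<lambda>m. A m * (1/8)"]) (auto simp: A_double wt_def)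
    have "((\<lambda>m. A m * (1/2)) has_sum (se * (1/2))) ?Ev" by (rule has_sum_cmult_left[OF E])
    then show "((\<lambda>m. A (2 * m) * wt (2 * m)) has_sum (se / 2)) ?Ev"
      by (subst has_sum_cong[where g = "\<lambda>m. A m * (1/2)"]) (auto simp: A_double wt_def)
  qed
  then have ev: "((\<lambda>m. A m * wt m) has_sum (so / 8 + se / 2)) ?Ev"
    using has_sum_reindex_bij_betw[OF bij, of "\<lambda>m. A m * wt m"] by simp
  have "((\<lambda>m. A m * (7/8)) has_sum (so * (7/8))) ?Od" by (rule has_sum_cmult_left[OF O])
  then have od: "((\<lambda>m. A m * wt m) has_sum (so * (7/8))) ?Od"
    by (subst has_sum_cong[where g = "\<lambda>m. A m * (7/8)"]) (auto simp: wt_def)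
  have "so * (7/8) + (so / 8 + se / 2) = 13 / 14 * (so + se)" using eq by simp
  also have "\<dots> = 13 * zeta 2 / (14 * zeta 3)" unfolding Z by simp
  finally show ?thesis using split[OF od ev] by simp
qed

lemma cc_eq:
  assumes e: "e \<ge> 1"
  shows "cc e = A (nat e) * wt (nat e)"
proof -
  have t: "real (nat e) = real_of_int e" using e by simp
  have en: "even (nat e) \<longleftrightarrow> even e" using e by (simp add: even_nat_iff)
  show ?thesis
  proof (cases "even e")
    case False
    have g: "gcd e 2 = 1" using False by (simp add: coprime_iff_gcd_eq_1[symmetric])
    then have h: "half2 e = e" unfolding half2_def by simp
    have l: "lcm 2 e = 2 * e" using g e by (simp add: lcm_altdef_int gcd.commute)
    show ?thesis unfolding cc_def A_def wt_def h l t using False en e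
      by (simp add: field_simps power2_eq_square power3_eq_cube)
  next
    case True
    then obtain f where f: "e = 2 * f" by (elim evenE)
    have f1: "f \<ge> 1" using e f by simp
    have h: "half2 e = f" unfolding half2_def f using gcd_mult_right[of 2 1 f] by simp
    have l: "lcm 2 e = e" using f1 by (simp add: f)
    have nd: "nat e div 2 = nat f" unfolding f by (simp add: nat_mult_distrib)
    have fn: "even (nat f) \<longleftrightarrow> even f" using f1 by (simp add: even_nat_iff)
    show ?thesis
    proof (cases "even f")
      case ef: False
      then have g: "gcd f 2 = 1" by (simp add: coprime_iff_gcd_eq_1[symmetric])
      then have "lcm 2 f = e" using f1 unfolding f by (simp add: lcm_altdef_int gcd.commute)
      then show ?thesis unfolding cc_def A_def wt_def h l t nd using True en ef fn e
        by (simp add: field_simps power2_eq_square power3_eq_cube)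
    next
      case ef: True
      then have "lcm 2 f = f" using f1 by (simp add: lcm_proj2_if_dvd)
      then show ?thesis unfolding cc_def A_def wt_def h l t nd using True en ef fn e f1
        unfolding f by (simp add: field_simps power2_eq_square power3_eq_cube)
    qed
  qed
qed

text \<open>The terms are nonnegative and at most 2 / n^2, so the partial sums increase to the limit
  and the tail beyond D is at most 2 / D.\<close>

lemma sum_cc_approx:
  fixes D :: int
  assumes D: "D \<ge> 1"
  shows "\<bar>(\<Sum>e\<in>{1..D}. cc e) - 13 * zeta 2 / (14 * zeta 3)\<bar> \<le> 2 / D"
proof -
  let ?g = "\<lambda>n. A n * wt n"
  have wt: "0 \<le> wt n" "wt n \<le> 2" for n unfolding wt_def by auto
  have g: "0 \<le> ?g n" "?g n \<le> 2 / real n ^ 2" for n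
  proof -
    show "0 \<le> ?g n" using A_bounds wt by simp
    have "?g n \<le> (1 / real n ^ 2) * 2" using A_bounds[of n] wt[of n] by (intro mult_mono) auto
    then show "?g n \<le> 2 / real n ^ 2" by simp
  qed
  \<comment> \<open>The term at 0 vanishes because division by 0 gives 0; thus the index 0 may be
    added and the sum read as an ordinary series.\<close>
  have "(?g has_sum (13 * zeta 2 / (14 * zeta 3))) UNIV"
    using has_sum_A_wt by (rule has_sum_cong_neutral[THEN iffD1, rotated -1]) (auto simp: A_def not_le)
  then have "?g sums (13 * zeta 2 / (14 * zeta 3))" by (rule has_sum_imp_sums)
  then have lim: "(\<lambda>M. (\<Sum>n<M. ?g n)) \<longlonglongrightarrow> 13 * zeta 2 / (14 * zeta 3)" unfolding sums_def .
  have S: "(\<Sum>e\<in>{1..D}. cc e) = (\<Sum>n\<in>{1..nat D}. ?g n)"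
    by (rule sum.reindex_bij_witness[of _ int nat]) (auto simp: cc_eq)
  have S': "(\<Sum>n<Suc (nat D). ?g n) = (\<Sum>n\<in>{1..nat D}. ?g n)"
  proof -
    have "{..<Suc (nat D)} = insert 0 {1..nat D}" by auto
    then show ?thesis by (simp add: A_def)
  qed
  have up: "(\<Sum>n<M. ?g n) \<le> (\<Sum>e\<in>{1..D}. cc e) + 2 / D" if M: "M > Suc (nat D)" for M
  proof -
    have "{..<M} = {..<Suc (nat D)} \<union> {Suc (nat D)..<M}" using M by auto
    then have "(\<Sum>n<M. ?g n) = sum ?g ({..<Suc (nat D)} \<union> {Suc (nat D)..<M})" by (rule arg_cong)
    also have "\<dots> = (\<Sum>n<Suc (nat D). ?g n) + (\<Sum>n\<in>{Suc (nat D)..<M}. ?g n)" by (rule sum.union_disjoint) auto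
    also have "(\<Sum>n\<in>{Suc (nat D)..<M}. ?g n) \<le> (\<Sum>n\<in>{Suc (nat D)..<M}. 2 / real n ^ 2)" by (intro sum_mono g)
    also have "\<dots> = 2 * (\<Sum>e\<in>{D+1..int M - 1}. 1 / (real_of_int e)^2)"
      unfolding sum_distrib_left by (rule sum.reindex_bij_witness[of _ nat int]) (use D in auto)
    also have "\<dots> \<le> 2 * (1 / D)" by (intro mult_left_mono sum_inverse_squares_tail D) simp
    finally show ?thesis unfolding S' S by simp
  qed
  have low: "(\<Sum>e\<in>{1..D}. cc e) \<le> (\<Sum>n<M. ?g n)" if M: "M > Suc (nat D)" for M
    unfolding S S'[symmetric] using M g by (intro sum_mono2) auto
  have "13 * zeta 2 / (14 * zeta 3) \<le> (\<Sum>e\<in>{1..D}. cc e) + 2 / D"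
    by (rule LIMSEQ_le_const2[OF lim]) (use up in \<open>auto intro!: exI[of _ "Suc (Suc (nat D))"]\<close>)
  moreover have "(\<Sum>e\<in>{1..D}. cc e) \<le> 13 * zeta 2 / (14 * zeta 3)"
    by (rule LIMSEQ_le_const[OF lim]) (use low in \<open>auto intro!: exI[of _ "Suc (Suc (nat D))"]\<close>)
  ultimately show ?thesis by (simp add: abs_le_iff)
qed


section \<open>The singular integral\<close>

lemma num_swap: "num u1 u2 v1 v2 = num u2 u1 v2 v1"
  unfolding num_def by (simp only: min.commute[of "(u1 + v1)^2"] max.commute[of "u1^2"] max.commute[of "(u1 - v1)^2"])

text \<open>Continuous form of the length bound for \<open>width\<close>: (u1 + v1)^2 - (u1 - v1)^2
  = 4 u1 v1.\<close>

lemma num_le: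
  assumes u: "u1 \<le> 1" and v: "0 \<le> v1"
  shows "num u1 u2 v1 v2 \<le> 4 * v1"
proof -
  have t: "mn - mx \<le> 4 * v" if "mn \<le> p" "q \<le> mx" "p - q = 4 * w" "w \<le> 1 * v" for mn mx p q w v :: real
    using that by linarith
  have "min 1 (min ((u1 + v1)^2) ((u2 + v2)^2)) \<le> (u1 + v1)^2" by simp
  moreover have "(u1 - v1)^2 \<le> max (max (u1^2) (u2^2)) (max ((u1 - v1)^2) ((u2 - v2)^2))" by simp
  moreover have "(u1 + v1)^2 - (u1 - v1)^2 = 4 * (u1 * v1)" by (simp add: power2_eq_square algebra_simps)
  moreover have "u1 * v1 \<le> 1 * v1" using u v by (intro mult_right_mono) auto
  ultimately have "min 1 (min ((u1 + v1)^2) ((u2 + v2)^2)) - max (max (u1^2) (u2^2)) (max ((u1 - v1)^2) ((u2 - v2)^2)) \<le> 4 * v1"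
    by (rule t)
  then show ?thesis unfolding num_def using v by (intro max.boundedI) auto
qed

text \<open>The numerator is at most 4 v1 and at most 4 v2, hence at most their geometric mean. This
  replaces the singularity 1 / (v1 v2) by an integrable one and makes the cut-off at \<kappa> cost
  only a multiple of sqrt \<kappa>.\<close>

lemma phi_le_inverse_sqrt:
  assumes u: "0 \<le> u1" "u1 \<le> 1" "0 \<le> u2" "u2 \<le> 1" and v: "0 < v1" "0 < v2"
  shows "\<bar>phi u1 u2 v1 v2\<bar> \<le> 4 / sqrt v1 / sqrt v2"
proof -
  have n1: "num u1 u2 v1 v2 \<le> 4 * v1" by (rule num_le) (use u v in auto)
  have n2: "num u1 u2 v1 v2 \<le> 4 * v2" by (subst num_swap, rule num_le) (use u v in auto)
  have n0: "0 \<le> num u1 u2 v1 v2" by (rule num_bounds)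
  have "(num u1 u2 v1 v2)^2 \<le> (4 * v1) * (4 * v2)"
    unfolding power2_eq_square using n0 n1 n2 v by (intro mult_mono) auto
  also have "\<dots> = (4 * (sqrt v1 * sqrt v2))^2" using v by (simp add: power_mult_distrib)
  finally have "num u1 u2 v1 v2 \<le> 4 * (sqrt v1 * sqrt v2)" by (rule power2_le_imp_le) (use v in simp)
  then have "num u1 u2 v1 v2 / (v1 * v2) \<le> 4 * (sqrt v1 * sqrt v2) / (v1 * v2)" using v by (intro divide_right_mono) auto
  also have "\<dots> = 4 / sqrt v1 / sqrt v2"
  proof -
    have e: "v1 * v2 = (sqrt v1 * sqrt v1) * (sqrt v2 * sqrt v2)" using v by simp
    show ?thesis unfolding e using v by (simp add: field_simps del: real_sqrt_mult_self)
  qed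
  finally have "num u1 u2 v1 v2 / (v1 * v2) \<le> 4 / sqrt v1 / sqrt v2" .
  moreover have "0 \<le> num u1 u2 v1 v2 / (v1 * v2)" using n0 v by simp
  ultimately show ?thesis unfolding phi_num by simp
qed

text \<open>Here the lower end (u2 - v2)^2 already reaches the upper bound 1. This allows the
  variable end points 1 + u_i of the integrals to be replaced by 2.\<close>

lemma phi_eq_0:
  assumes u: "0 \<le> u2" and v: "1 + u2 \<le> v2"
  shows "phi u1 u2 v1 v2 = 0"
proof -
  have "1 \<le> (v2 - u2)^2" using v one_le_power[of "v2 - u2" 2] by simp
  then have "1 \<le> (u2 - v2)^2" by (simp add: power2_commute)
  also have "(u2 - v2)^2 \<le> max (max (u1^2) (u2^2)) (max ((u1 - v1)^2) ((u2 - v2)^2))" by simp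
  finally have "1 \<le> max (max (u1^2) (u2^2)) (max ((u1 - v1)^2) ((u2 - v2)^2))" .
  then have "min 1 (min ((u1 + v1)^2) ((u2 + v2)^2)) - max (max (u1^2) (u2^2)) (max ((u1 - v1)^2) ((u2 - v2)^2)) \<le> 0"
    using order_trans[OF min.cobounded1] by simp
  then have "num u1 u2 v1 v2 = 0" unfolding num_def by (rule max_absorb1)
  then show ?thesis unfolding phi_num by simp
qed

text \<open>The integrand is unbounded at 0 but nonnegative, and its antiderivative 2 sqrt v has
  one-sided limits at both ends, so this form of the fundamental theorem yields integrability
  together with the value.\<close>

lemma inverse_sqrt_integral:
  fixes c :: real
  assumes c: "0 < c"
  shows "set_integrable lborel {0<..<c} (\<lambda>v. 1 / sqrt v)" "(LINT v:{0<..<c}|lborel. 1 / sqrt v) = 2 * sqrt c"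
proof -
  have lt: "ereal 0 < ereal c" using c by simp
  have d: "DERIV (\<lambda>x. 2 * sqrt x) x :> 1 / sqrt x" if "ereal 0 < ereal x" "ereal x < ereal c" for x
  proof -
    have "x > 0" using that by simp
    then show ?thesis by (auto intro!: derivative_eq_intros simp: divide_simps)
  qed
  have ct: "isCont (\<lambda>x. 1 / sqrt x) x" if "ereal 0 < ereal x" "ereal x < ereal c" for x
    using that by (intro continuous_intros) auto
  have nn: "AE x in lborel. ereal 0 < ereal x \<longrightarrow> ereal x < ereal c \<longrightarrow> 0 \<le> 1 / sqrt x" by simp
  have tc: "((\<lambda>x. 2 * sqrt x) \<longlongrightarrow> 2 * sqrt t) (at t within S)" for t S by (intro tendsto_intros)
  have l0: "(((\<lambda>x. 2 * sqrt x) \<circ> real_of_ereal) \<longlongrightarrow> 2 * sqrt 0) (at_right (ereal 0))"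
    unfolding ereal_tendsto_simps1 by (rule tc)
  have lc: "(((\<lambda>x. 2 * sqrt x) \<circ> real_of_ereal) \<longlongrightarrow> 2 * sqrt c) (at_left (ereal c))"
    unfolding ereal_tendsto_simps1 by (rule tc)
  note F = interval_integral_FTC_nonneg[OF lt d ct nn l0 lc]
  show "set_integrable lborel {0<..<c} (\<lambda>v. 1 / sqrt v)" using F(1) by simp
  show "(LINT v:{0<..<c}|lborel. 1 / sqrt v) = 2 * sqrt c"
    using F(2) c by (simp add: interval_lebesgue_integral_def)
qed

lemma set_integral_bound_by:
  fixes f h :: "real \<Rightarrow> real"
  assumes f: "f \<in> borel_measurable borel" and S: "S \<in> sets borel" and h: "set_integrable lborel S h"
    and le: "\<And>x. x \<in> S \<Longrightarrow> \<bar>f x\<bar> \<le> h x"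
  shows "set_integrable lborel S f" "\<bar>LINT x:S|lborel. f x\<bar> \<le> (LINT x:S|lborel. h x)"
proof -
  have f': "set_borel_measurable lborel S f" unfolding set_borel_measurable_def using f S by measurable
  show i: "set_integrable lborel S f"
    by (rule set_integrable_bound[OF h f']) (use le in \<open>auto intro!: AE_I2 order_trans[OF le]\<close>)
  have "norm (LINT x:S|lborel. f x) \<le> (LINT x:S|lborel. norm (f x))" by (rule set_integral_norm_bound[OF i])
  also have "\<dots> \<le> (LINT x:S|lborel. h x)"
    by (rule set_integral_mono[OF set_integrable_norm[OF i] h]) (use le in auto)
  finally show "\<bar>LINT x:S|lborel. f x\<bar> \<le> (LINT x:S|lborel. h x)" by simp
qed

text \<open>Below \<kappa> the function f contributes at most K times 2 sqrt \<kappa>; above it the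
  difference is at most E times the integral of 1 / sqrt v. The factor 4 bounds 2 sqrt 3, that
  integral over (0, 3), an open interval containing (0, 2]. The lemma also passes from Lebesgue
  integrals to the gauge integrals of \<open>I4\<close>.\<close>

lemma truncation_step:
  fixes f g :: "real \<Rightarrow> real"
  assumes f: "f \<in> borel_measurable borel" and bd: "\<And>v. 0 < v \<Longrightarrow> \<bar>f v\<bar> \<le> K / sqrt v"
    and g: "continuous_on {\<kappa>..2} g" and cl: "\<And>v. \<kappa> \<le> v \<Longrightarrow> v \<le> 2 \<Longrightarrow> \<bar>f v - g v\<bar> \<le> E / sqrt v"
    and \<kappa>: "0 < \<kappa>" "\<kappa> \<le> 1" and KE: "0 \<le> K" "0 \<le> E"
  shows "\<bar>(LINT v:{0<..2}|lborel. f v) - integral {\<kappa>..2} g\<bar> \<le> 2 * K * sqrt \<kappa> + 4 * E"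
    "\<bar>LINT v:{0<..2}|lborel. f v\<bar> \<le> 4 * K"
proof -
  have scale: "set_integrable lborel {0<..<c} (\<lambda>v. C / sqrt v)" "(LINT v:{0<..<c}|lborel. C / sqrt v) = C * (2 * sqrt c)"
    if "0 < c" for c C :: real
  proof -
    have e: "(\<lambda>v. C / sqrt v) = (\<lambda>v. C * (1 / sqrt v))" by auto
    show "set_integrable lborel {0<..<c} (\<lambda>v. C / sqrt v)" unfolding e
      by (rule set_integrable_mult_right) (rule inverse_sqrt_integral(1)[OF that])
    show "(LINT v:{0<..<c}|lborel. C / sqrt v) = C * (2 * sqrt c)" unfolding e
      using inverse_sqrt_integral(2)[OF that] by (simp only: set_integral_mult_right)
  qed
  have sub: "set_integrable lborel S (\<lambda>v. C / sqrt v)" "0 \<le> C \<Longrightarrow> (LINT v:S|lborel. C / sqrt v) \<le> 4 * C"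
    if "S \<subseteq> {0<..<3}" "S \<in> sets borel" for S C
  proof -
    have i3: "set_integrable lborel {0<..<3::real} (\<lambda>v. C / sqrt v)" by (rule scale) simp
    show i: "set_integrable lborel S (\<lambda>v. C / sqrt v)" by (rule set_integrable_subset[OF i3]) (use that in auto)
    assume C: "0 \<le> C"
    have "(LINT v:S|lborel. C / sqrt v) \<le> (LINT v:{0<..<3}|lborel. C / sqrt v)"
      using i i3 that C unfolding set_lebesgue_integral_def set_integrable_def
      by (intro integral_mono) (auto simp: indicator_def)
    also have "\<dots> = C * (2 * sqrt 3)" by (rule scale) simp
    also have "\<dots> \<le> C * 4"
    proof (intro mult_left_mono C)
      have "sqrt 3 \<le> 2" by (rule real_le_lsqrt) auto
      then show "2 * sqrt 3 \<le> (4::real)" by simp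
    qed
    finally show "(LINT v:S|lborel. C / sqrt v) \<le> 4 * C" by simp
  qed
  have s: "{0<..2} \<subseteq> {0<..<3::real}" "{\<kappa>..2} \<subseteq> {0<..<3}" using \<kappa> by auto
  show "\<bar>LINT v:{0<..2}|lborel. f v\<bar> \<le> 4 * K"
    by (rule order_trans[OF set_integral_bound_by(2)[OF f _ sub(1)[OF s(1)]] sub(2)[OF s(1) _ KE(1)]]) (use bd in auto)
  have i1: "set_integrable lborel {0<..<\<kappa>} f"
    by (rule set_integral_bound_by(1)[OF f _ scale(1)[OF \<kappa>(1), of K]]) (use bd in auto)
  have b1: "\<bar>LINT v:{0<..<\<kappa>}|lborel. f v\<bar> \<le> K * (2 * sqrt \<kappa>)"
    using set_integral_bound_by(2)[OF f _ scale(1)[OF \<kappa>(1), of K]] bd unfolding scale(2)[OF \<kappa>(1)] by auto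
  have i2: "set_integrable lborel {\<kappa>..2} f"
    by (rule set_integral_bound_by(1)[OF f _ sub(1)[OF s(2), of K]]) (use bd \<kappa> in auto)
  have ig: "set_integrable lborel {\<kappa>..2} g" by (rule borel_integrable_atLeastAtMost'[OF g])
  have "{0<..2} = {0<..<\<kappa>} \<union> {\<kappa>..2}" using \<kappa> by auto
  then have 1: "(LINT v:{0<..2}|lborel. f v) = (LINT v:{0<..<\<kappa>}|lborel. f v) + (LINT v:{\<kappa>..2}|lborel. f v)"
    by (simp only:) (rule set_integral_Un[OF _ i1 i2], auto)
  have 2: "(LINT v:{\<kappa>..2}|lborel. g v) = integral {\<kappa>..2} g" by (rule set_borel_integral_eq_integral(2)[OF ig])
  have 3: "(LINT v:{\<kappa>..2}|lborel. f v) - (LINT v:{\<kappa>..2}|lborel. g v) = (LINT v:{\<kappa>..2}|lborel. f v - g v)"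
    by (rule set_integral_diff(2)[OF i2 ig, symmetric])
  have "\<bar>LINT v:{\<kappa>..2}|lborel. f v - g v\<bar> \<le> (LINT v:{\<kappa>..2}|lborel. \<bar>f v - g v\<bar>)"
    using set_integral_norm_bound[OF set_integral_diff(1)[OF i2 ig]] by simp
  also have "\<dots> \<le> (LINT v:{\<kappa>..2}|lborel. E / sqrt v)"
    using set_integrable_norm[OF set_integral_diff(1)[OF i2 ig]] cl
    by (intro set_integral_mono sub(1)[OF s(2)]) auto
  also have "\<dots> \<le> 4 * E" by (rule sub(2)[OF s(2) _ KE(2)]) simp
  finally have 4: "\<bar>LINT v:{\<kappa>..2}|lborel. f v - g v\<bar> \<le> 4 * E" .
  show "\<bar>(LINT v:{0<..2}|lborel. f v) - integral {\<kappa>..2} g\<bar> \<le> 2 * K * sqrt \<kappa> + 4 * E"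
    using 1 2 3 4 b1 by (simp add: abs_le_iff)
qed

lemma unit_step:
  fixes f g :: "real \<Rightarrow> real"
  assumes f: "f \<in> borel_measurable borel" and bd: "\<And>v. 0 < v \<Longrightarrow> v < 1 \<Longrightarrow> \<bar>f v\<bar> \<le> M"
    and g: "continuous_on {0..1} g" and cl: "\<And>v. 0 < v \<Longrightarrow> v < 1 \<Longrightarrow> \<bar>f v - g v\<bar> \<le> E"
  shows "\<bar>(LINT v:{0<..<1}|lborel. f v) - integral {0..1} g\<bar> \<le> E" "\<bar>LINT v:{0<..<1}|lborel. f v\<bar> \<le> M"
proof -
  have c: "set_integrable lborel {0<..<1::real} (\<lambda>v. C)" "(LINT v:{0<..<1::real}|lborel. C) = C" for C :: real
  proof -
    show "set_integrable lborel {0<..<1::real} (\<lambda>v. C)"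
      by (rule set_integrable_subset[of _ "{0..1}"]) (auto intro!: borel_integrable_atLeastAtMost' continuous_intros)
    show "(LINT v:{0<..<1::real}|lborel. C) = C" by (simp add: set_lebesgue_integral_def)
  qed
  have i: "set_integrable lborel {0<..<1} f" by (rule set_integral_bound_by(1)[OF f _ c(1)[of M]]) (use bd in auto)
  show "\<bar>LINT v:{0<..<1}|lborel. f v\<bar> \<le> M"
    using set_integral_bound_by(2)[OF f _ c(1)[of M]] bd unfolding c(2) by auto
  have ig1: "set_integrable lborel {0..1} g" by (rule borel_integrable_atLeastAtMost'[OF g])
  have ig: "set_integrable lborel {0<..<1} g" by (rule set_integrable_subset[OF ig1]) auto
  have "(LINT v:{0<..<1}|lborel. g v) = integral {0<..<1} g" by (rule set_borel_integral_eq_integral(2)[OF ig])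
  also have "\<dots> = integral {0..1} g" using integral_open_interval[of 0 1 g] by (simp add: box_real)
  finally have 2: "(LINT v:{0<..<1}|lborel. g v) = integral {0..1} g" .
  have 3: "(LINT v:{0<..<1}|lborel. f v) - (LINT v:{0<..<1}|lborel. g v) = (LINT v:{0<..<1}|lborel. f v - g v)"
    by (rule set_integral_diff(2)[OF i ig, symmetric])
  have "\<bar>LINT v:{0<..<1}|lborel. f v - g v\<bar> \<le> (LINT v:{0<..<1}|lborel. \<bar>f v - g v\<bar>)"
    using set_integral_norm_bound[OF set_integral_diff(1)[OF i ig]] by simp
  also have "\<dots> \<le> (LINT v:{0<..<1::real}|lborel. E)"
    using set_integrable_norm[OF set_integral_diff(1)[OF i ig]] cl by (intro set_integral_mono c(1)) auto
  also have "\<dots> = E" by (rule c(2))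
  finally show "\<bar>(LINT v:{0<..<1}|lborel. f v) - integral {0..1} g\<bar> \<le> E" using 2 3 by simp
qed

text \<open>The inner integrals of \<open>singular_S\<close> with the ends 1 + u_i replaced by 2.
  With domains that do not depend on the outer variables, measurability in those variables passes
  through the iterated integrals.\<close>

definition L4 :: "real \<Rightarrow> real \<Rightarrow> real \<Rightarrow> real" where
  "L4 u1 u2 v1 = (LINT v2:{0<..2}|lborel. phi u1 u2 v1 v2)"
definition L3 :: "real \<Rightarrow> real \<Rightarrow> real" where
  "L3 u1 u2 = (LINT v1:{0<..2}|lborel. L4 u1 u2 v1)"
definition L2 :: "real \<Rightarrow> real" where
  "L2 u1 = (LINT u2:{0<..<1}|lborel. L3 u1 u2)"

lemma phi_measurable [measurable]:
  "(\<lambda>x. phi (a x) (b x) (c x) (d x)) \<in> borel_measurable M"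
  if [measurable]: "a \<in> borel_measurable M" "b \<in> borel_measurable M" "c \<in> borel_measurable M" "d \<in> borel_measurable M"
  unfolding phi_def by measurable

lemma L4_measurable [measurable]:
  "(\<lambda>x. L4 (a x) (b x) (c x)) \<in> borel_measurable M"
  if [measurable]: "a \<in> borel_measurable M" "b \<in> borel_measurable M" "c \<in> borel_measurable M"
  unfolding L4_def set_lebesgue_integral_def by measurable

lemma L3_measurable [measurable]:
  "(\<lambda>x. L3 (a x) (b x)) \<in> borel_measurable M"
  if [measurable]: "a \<in> borel_measurable M" "b \<in> borel_measurable M"
  unfolding L3_def set_lebesgue_integral_def by measurable

lemma L2_measurable [measurable]:
  "(\<lambda>x. L2 (a x)) \<in> borel_measurable M"
  if [measurable]: "a \<in> borel_measurable M"
  unfolding L2_def set_lebesgue_integral_def by measurable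

lemma set_integral_shrink:
  fixes f :: "real \<Rightarrow> real"
  assumes "S \<subseteq> S'" "\<And>x. x \<in> S' - S \<Longrightarrow> f x = 0"
  shows "(LINT x:S|lborel. f x) = (LINT x:S'|lborel. f x)"
  unfolding set_lebesgue_integral_def
  by (rule Bochner_Integration.integral_cong) (use assms in \<open>auto simp: indicator_def\<close>)

text \<open>Each \<open>LBINT\<close> here is a Lebesgue integral over an open interval. Where a
  v-interval is enlarged to (0, 2], the integrand vanishes by \<open>phi_eq_0\<close>, preceded by
  \<open>phi_swap\<close> in the case of v1.\<close>

lemma singular_S_eq: "singular_S = (LINT u1:{0<..<1}|lborel. L2 u1)"
proof -
  have inner: "(LBINT v2=0..ereal (1 + u2). phi u1 u2 v1 v2) = L4 u1 u2 v1" if u: "0 < u1" "0 < u2" "u2 < 1" "0 < v1" for u1 u2 v1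
  proof -
    have "(LBINT v2=0..ereal (1 + u2). phi u1 u2 v1 v2) = (LINT v2:{0<..<1+u2}|lborel. phi u1 u2 v1 v2)"
      using u by (simp add: interval_lebesgue_integral_def zero_ereal_def)
    also have "\<dots> = L4 u1 u2 v1" unfolding L4_def
      by (rule set_integral_shrink) (use u phi_eq_0 in auto)
    finally show ?thesis .
  qed
  have mid: "(LBINT v1=0..ereal (1 + u1). (LBINT v2=0..ereal (1 + u2). phi u1 u2 v1 v2)) = L3 u1 u2"
    if u: "0 < u1" "u1 < 1" "0 < u2" "u2 < 1" for u1 u2
  proof -
    have "(LBINT v1=0..ereal (1 + u1). (LBINT v2=0..ereal (1 + u2). phi u1 u2 v1 v2)) =
        (LINT v1:{0<..<1+u1}|lborel. (LBINT v2=0..ereal (1 + u2). phi u1 u2 v1 v2))"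
      using u by (simp add: interval_lebesgue_integral_def zero_ereal_def)
    also have "\<dots> = (LINT v1:{0<..<1+u1}|lborel. L4 u1 u2 v1)"
      by (rule set_lebesgue_integral_cong) (use inner u in auto)
    also have "\<dots> = L3 u1 u2" unfolding L3_def
    proof (rule set_integral_shrink)
      fix v1 assume v: "v1 \<in> {0<..2} - {0<..<1+u1}"
      have "phi u1 u2 v1 v2 = 0" for v2 by (subst phi_swap) (rule phi_eq_0, use u v in auto)
      then have "phi u1 u2 v1 = (\<lambda>_. 0)" by (intro ext)
      then show "L4 u1 u2 v1 = 0" unfolding L4_def set_lebesgue_integral_def by simp
    qed (use u in auto)
    finally show ?thesis .
  qed
  have out: "(LBINT u2=0..1. (LBINT v1=0..ereal (1 + u1). (LBINT v2=0..ereal (1 + u2). phi u1 u2 v1 v2))) = L2 u1"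
    if u: "0 < u1" "u1 < 1" for u1
  proof -
    have "(LBINT u2=0..1. (LBINT v1=0..ereal (1 + u1). (LBINT v2=0..ereal (1 + u2). phi u1 u2 v1 v2))) =
      (LINT u2:{0<..<1}|lborel. (LBINT v1=0..ereal (1 + u1). (LBINT v2=0..ereal (1 + u2). phi u1 u2 v1 v2)))"
      by (simp add: interval_lebesgue_integral_def zero_ereal_def one_ereal_def)
    also have "\<dots> = L2 u1" unfolding L2_def
      by (rule set_lebesgue_integral_cong) (use mid u in auto)
    finally show ?thesis .
  qed
  have "singular_S = (LINT u1:{0<..<1}|lborel. (LBINT u2=0..1. (LBINT v1=0..ereal (1 + u1). (LBINT v2=0..ereal (1 + u2). phi u1 u2 v1 v2))))"
    unfolding singular_S_def by (simp add: interval_lebesgue_integral_def zero_ereal_def one_ereal_def)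
  also have "\<dots> = (LINT u1:{0<..<1}|lborel. L2 u1)"
    by (rule set_lebesgue_integral_cong) (use out in auto)
  finally show ?thesis .
qed

text \<open>\<open>truncation_step\<close> is applied twice. In v2, with K = 4 / sqrt v1, it gives
  the error 8 sqrt \<kappa> / sqrt v1 and the bound 16 / sqrt v1, both still integrable in v1; in v1
  it then gives 2 * 16 + 4 * 8 = 64 times sqrt \<kappa>. The unit intervals of u1 and u2 preserve
  this error.\<close>

lemma singular_S_approx:
  assumes \<kappa>: "0 < \<kappa>" "\<kappa> \<le> 1"
  shows "\<bar>singular_S - I4 \<kappa> phi\<bar> \<le> 64 * sqrt \<kappa>"
proof -
  let ?F = "phic \<kappa>"
  define F3 where "F3 x1 x2 x3 = integral {\<kappa>..2} (?F x1 x2 x3)" for x1 x2 x3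
  define F2 where "F2 x1 x2 = integral {\<kappa>..2} (F3 x1 x2)" for x1 x2
  define F1 where "F1 x1 = integral {0..1} (F2 x1)" for x1
  have I: "I4 \<kappa> ?F = integral {0..1} F1" unfolding I4_def F1_def F2_def F3_def by simp
  have lk: "\<kappa> \<le> 2" "2 - \<kappa> \<le> 2" "(0::real) \<le> 1" "(1::real) - 0 \<le> 2" using \<kappa> by auto
  note l = phic_lip[OF \<kappa>]
  have a3: "lip (2 * (13 / \<kappa>^3)) (\<lambda>x. F3 x x2 x3)" for x2 x3 unfolding F3_def by (rule lip_integral[OF l(1) l(4) lk(1,2)])
  have b3: "lip (2 * (13 / \<kappa>^3)) (\<lambda>x. F3 x1 x x3)" for x1 x3 unfolding F3_def by (rule lip_integral[OF l(2) l(4) lk(1,2)])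
  have c3: "lip (2 * (13 / \<kappa>^3)) (F3 x1 x2)" for x1 x2 unfolding F3_def by (rule lip_integral[OF l(3) l(4) lk(1,2)])
  have a2: "lip (2 * (2 * (13 / \<kappa>^3))) (\<lambda>x. F2 x x2)" for x2 unfolding F2_def by (rule lip_integral[OF a3 c3 lk(1,2)])
  have b2: "lip (2 * (2 * (13 / \<kappa>^3))) (F2 x1)" for x1 unfolding F2_def by (rule lip_integral[OF b3 c3 lk(1,2)])
  have a1: "lip (2 * (2 * (2 * (13 / \<kappa>^3)))) F1" unfolding F1_def by (rule lip_integral[OF a2 b2 lk(3,4)])
  have m4: "(\<lambda>v. phi u1 u2 v1 v) \<in> borel_measurable borel" for u1 u2 v1 by measurable
  have s4: "\<bar>L4 u1 u2 v1 - integral {\<kappa>..2} (\<lambda>v2. phi u1 u2 v1 v2)\<bar> \<le> 8 * sqrt \<kappa> / sqrt v1" (is ?a)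
      and t4: "\<bar>L4 u1 u2 v1\<bar> \<le> 16 / sqrt v1" (is ?b)
    if u: "0 < u1" "u1 < 1" "0 < u2" "u2 < 1" "0 < v1" for u1 u2 v1
  proof -
    have ct: "continuous_on {\<kappa>..2} (\<lambda>v2. phi u1 u2 v1 v2)"
      unfolding phi_def using \<kappa> u by (intro continuous_intros) auto
    have b: "\<bar>phi u1 u2 v1 v\<bar> \<le> (4 / sqrt v1) / sqrt v" if "0 < v" for v
      using phi_le_inverse_sqrt[of u1 u2 v1 v] u that by simp
    have c: "\<bar>phi u1 u2 v1 v - phi u1 u2 v1 v\<bar> \<le> 0 / sqrt v" for v by simp
    have "\<bar>L4 u1 u2 v1 - integral {\<kappa>..2} (\<lambda>v2. phi u1 u2 v1 v2)\<bar> \<le> 2 * (4 / sqrt v1) * sqrt \<kappa> + 4 * 0"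
      unfolding L4_def by (rule truncation_step(1)[OF m4 b ct c \<kappa>]) (use u in auto)
    then show ?a by simp
    have "\<bar>L4 u1 u2 v1\<bar> \<le> 4 * (4 / sqrt v1)"
      unfolding L4_def by (rule truncation_step(2)[OF m4 b ct c \<kappa>]) (use u in auto)
    then show ?b by simp
  qed
  \<comment> \<open>On this range clamping is the identity; for v1 below \<kappa>, where
    \<open>phic\<close> and \<open>phi\<close> may differ, only the bound \<open>t4\<close>
    enters.\<close>
  have e4: "F3 u1 u2 v1 = integral {\<kappa>..2} (\<lambda>v2. phi u1 u2 v1 v2)"
    if "0 < u1" "u1 < 1" "0 < u2" "u2 < 1" "\<kappa> \<le> v1" "v1 \<le> 2" for u1 u2 v1
    unfolding F3_def by (rule integral_cong) (use that in \<open>simp add: phic_def cl_id\<close>)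
  have m3: "(\<lambda>v. L4 u1 u2 v) \<in> borel_measurable borel" for u1 u2 by measurable
  have s3: "\<bar>L3 u1 u2 - F2 u1 u2\<bar> \<le> 64 * sqrt \<kappa>" (is ?a) and t3: "\<bar>L3 u1 u2\<bar> \<le> 64" (is ?b)
    if u: "0 < u1" "u1 < 1" "0 < u2" "u2 < 1" for u1 u2
  proof -
    have ct: "continuous_on {\<kappa>..2} (F3 u1 u2)" by (rule lip_continuous[OF c3])
    have b: "\<bar>L4 u1 u2 v\<bar> \<le> 16 / sqrt v" if "0 < v" for v by (rule t4) (use u that in auto)
    have c: "\<bar>L4 u1 u2 v - F3 u1 u2 v\<bar> \<le> 8 * sqrt \<kappa> / sqrt v" if "\<kappa> \<le> v" "v \<le> 2" for v
      using s4[OF u, of v] e4[OF u that] \<kappa> that by simp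
    have "\<bar>L3 u1 u2 - F2 u1 u2\<bar> \<le> 2 * 16 * sqrt \<kappa> + 4 * (8 * sqrt \<kappa>)"
      unfolding L3_def F2_def by (rule truncation_step(1)[OF m3 b ct c \<kappa>]) (use \<kappa> in auto)
    then show ?a by simp
    have "\<bar>L3 u1 u2\<bar> \<le> 4 * 16"
      unfolding L3_def by (rule truncation_step(2)[OF m3 b ct c \<kappa>]) (use \<kappa> in auto)
    then show ?b by simp
  qed
  have m2: "(\<lambda>u. L3 u1 u) \<in> borel_measurable borel" for u1 by measurable
  have s2: "\<bar>L2 u1 - F1 u1\<bar> \<le> 64 * sqrt \<kappa>" and t2: "\<bar>L2 u1\<bar> \<le> 64" if u: "0 < u1" "u1 < 1" for u1
    unfolding L2_def F1_def
    by (rule unit_step[OF m2 t3 lip_continuous[OF b2] s3]; use u in simp)+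
  have m1: "(\<lambda>u. L2 u) \<in> borel_measurable borel" by measurable
  have "\<bar>singular_S - integral {0..1} F1\<bar> \<le> 64 * sqrt \<kappa>"
    unfolding singular_S_eq by (rule unit_step(1)[OF m1 t2 lip_continuous[OF a1] s2])
  then show ?thesis unfolding I[symmetric] I4_phic[OF \<kappa>(1)] .
qed


section \<open>Choice of parameters\<close>

text \<open>The parameters are \<open>B = y^25\<close>, \<open>\<kappa> = y^(-2)\<close> and \<open>X = D = floor (y^5)\<close>; the constants \<open>b\<close> and \<open>c\<close> absorb
  the singular integral and the singular series.\<close>

definition err :: "real \<Rightarrow> real \<Rightarrow> real \<Rightarrow> real" where
  "err b c y = 1600 * (2 * y^25)^3 * (sqrt (y^23) * sqrt (2 * y^25))
     + 24 * (2 * y^25)^2 / y^23 * (189 * y^5 * (y^5)^3 * (2 * y^25)^3 / y^23 + 5 * (2 * y^25)^3 / (y^5 / 2))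
     + 1520 * (2 * y^25)^6 / (y^5 / 2 * (y^23)^2)
     + (7995 * (y^5)^2 * (y^25)^3 / (1 / y^2)^3 + 1280 * (y^25)^4 / (1 / y^2 * (y^5 / 2)))
     + b * ((y^25)^4 * (2 / (y^5 / 2)))
     + c * ((y^25)^4 * (64 * sqrt (1 / y^2)))"

lemma W_quantitative:
  fixes y :: real
  assumes y: "y \<ge> 2"
  shows "\<bar>W (y^50) - c0 * y^100\<bar> \<le> err (\<bar>singular_S\<bar> + 64) \<bar>13 * zeta 2 / (14 * zeta 3)\<bar> y"
proof -
  define B where "B = y^25"
  define \<kappa> where "\<kappa> = 1 / y^2"
  define N where "N = \<lfloor>2 * B\<rfloor>"
  define D where "D = \<lfloor>y^5\<rfloor>"
  define C where "C = 13 * zeta 2 / (14 * zeta 3)"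
  have y0: "y > 0" "y \<ge> 1" using y by auto
  have y5: "y^5 \<ge> 32"
  proof -
    have "(2::real)^5 \<le> y^5" using y by (intro power_mono) auto
    then show ?thesis by simp
  qed
  have B1: "B \<ge> 1" unfolding B_def using y0 by (intro one_le_power) auto
  have \<kappa>: "0 < \<kappa>" "\<kappa> \<le> 1" unfolding \<kappa>_def using y0 by (auto simp: one_le_power)
  have D: "y^5 / 2 \<le> D" "D \<le> y^5" "D \<ge> 1" unfolding D_def using y5 by linarith+
  have N: "real_of_int N \<le> 2 * B" "B \<le> N" unfolding N_def using B1 by linarith+
  have N0: "0 \<le> real_of_int N" "1 \<le> real_of_int N" using N B1 by auto
  have y10: "(y^5)^2 \<le> B" unfolding B_def power_mult[symmetric] using y0 by (intro power_increasing) auto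
  have "2 * y^5 \<le> y^5 * y^5" using y5 y0 by (intro mult_right_mono) auto
  then have D2: "2 * D \<le> B" using D y10 by (simp add: power2_eq_square)
  have D2N: "2 * D \<le> N" using D2 N(2) by linarith
  have "real_of_int (D^2) \<le> real_of_int N"
  proof -
    have "(real_of_int D)^2 \<le> (y^5)^2" using D by (intro power_mono) auto
    then have "(real_of_int D)^2 \<le> real_of_int N" using y10 N(2) by linarith
    then show ?thesis by (simp only: of_int_power)
  qed
  then have DN: "D^2 \<le> N" by (simp only: of_int_le_iff)
  \<comment> \<open>The threshold Q of \<open>W_arith_approx\<close> and the cut-off \<kappa> B of
    \<open>main_sum_approx\<close> coincide, so both estimates concern the same sum
    \<open>?M\<close>.\<close>
  have Q: "\<kappa> * B = y^23"
  proof -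
    have e: "y^25 = y^2 * y^23" by (simp flip: power_add)
    have "y^2 \<noteq> 0" using y0 by simp
    then show ?thesis unfolding \<kappa>_def B_def e times_divide_eq_left mult_1 by (rule nonzero_mult_div_cancel_left)
  qed
  have Q0: "0 < y^23" using y0 by simp
  have QN: "y^23 \<le> N"
  proof -
    have "\<kappa> * B \<le> 1 * B" using \<kappa> B1 by (intro mult_right_mono) auto
    then show ?thesis using Q N(2) by simp
  qed
  let ?M = "\<Sum>(a, q1, q2)\<in>Tr N. if y^23 \<le> q1 \<and> y^23 \<le> q2 then omega a q1 q2 * Ph B N a q1 q2 else 0"
  let ?S = "\<Sum>e\<in>{1..D}. cc e"
  let ?n = "real_of_int N" and ?d = "real_of_int D"
  have d0: "0 \<le> ?d" "0 < ?d" "0 < y^5 / 2" using D y5 y0 by auto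
  have n2: "?n \<le> 2 * y^25" using N unfolding B_def by simp
  have "\<bar>W (B^2) - ?M\<bar> \<le> 1600 * ?n^3 * (sqrt (y^23) * sqrt ?n)
      + 24 * ?n^2 / y^23 * (189 * ?d * ?d^3 * ?n^3 / y^23 + 5 * ?n^3 / ?d) + 1520 * ?n^6 / (?d * (y^23)^2)"
    using W_arith_approx[OF B1 N_def D(3) DN D2N D(3) Q0 QN] by simp
  also have "\<dots> \<le> 1600 * (2 * y^25)^3 * (sqrt (y^23) * sqrt (2 * y^25))
     + 24 * (2 * y^25)^2 / y^23 * (189 * y^5 * (y^5)^3 * (2 * y^25)^3 / y^23 + 5 * (2 * y^25)^3 / (y^5 / 2))
     + 1520 * (2 * y^25)^6 / (y^5 / 2 * (y^23)^2)"
    by (intro add_mono mult_mono frac_le power_mono mult_nonneg_nonneg divide_nonneg_nonneg add_nonneg_nonneg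
          zero_le_power mult_pos_pos real_sqrt_le_mono real_sqrt_ge_zero order_refl n2 D N0 d0)
       (use y0 Q0 in auto)
  finally have E1: "\<bar>W (B^2) - ?M\<bar> \<le> 1600 * (2 * y^25)^3 * (sqrt (y^23) * sqrt (2 * y^25))
     + 24 * (2 * y^25)^2 / y^23 * (189 * y^5 * (y^5)^3 * (2 * y^25)^3 / y^23 + 5 * (2 * y^25)^3 / (y^5 / 2))
     + 1520 * (2 * y^25)^6 / (y^5 / 2 * (y^23)^2)" .
  have "\<bar>?M - B^4 * I4 \<kappa> phi * ?S\<bar> \<le> 7995 * ?d^2 * B^3 / \<kappa>^3 + 1280 * B^4 / (\<kappa> * ?d)"
    using main_sum_approx[OF B1 N_def \<kappa> D(3)] D2 unfolding Q by simp
  also have "\<dots> \<le> 7995 * (y^5)^2 * B^3 / \<kappa>^3 + 1280 * B^4 / (\<kappa> * (y^5 / 2))"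
    by (intro add_mono mult_mono frac_le power_mono mult_nonneg_nonneg mult_pos_pos zero_le_power order_refl D d0 \<kappa>)
       (use \<kappa> B1 y0 in auto)
  finally have E2: "\<bar>?M - B^4 * I4 \<kappa> phi * ?S\<bar> \<le> 7995 * (y^5)^2 * (y^25)^3 / (1 / y^2)^3 + 1280 * (y^25)^4 / (1 / y^2 * (y^5 / 2))"
    unfolding \<kappa>_def B_def .
  have I: "\<bar>singular_S - I4 \<kappa> phi\<bar> \<le> 64 * sqrt \<kappa>" by (rule singular_S_approx[OF \<kappa>])
  have "sqrt \<kappa> \<le> 1" using \<kappa> by simp
  then have I': "\<bar>I4 \<kappa> phi\<bar> \<le> \<bar>singular_S\<bar> + 64" using I by linarith
  have "\<bar>?S - C\<bar> \<le> 2 / ?d" unfolding C_def by (rule sum_cc_approx[OF D(3)])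
  also have "\<dots> \<le> 2 / (y^5 / 2)" by (rule divide_left_mono[OF D(1) _ mult_pos_pos[OF d0(2,3)]]) simp
  finally have S: "\<bar>?S - C\<bar> \<le> 2 / (y^5 / 2)" .
  have c0: "c0 = C * singular_S" unfolding c0_def C_def by simp
  \<comment> \<open>The two factors are replaced by their limits one after the other: first the
    truncated series by C, then the truncated integral by \<open>singular_S\<close>.\<close>
  have "B^4 * I4 \<kappa> phi * ?S - c0 * B^4 = I4 \<kappa> phi * (B^4 * (?S - C)) + C * (B^4 * (I4 \<kappa> phi - singular_S))"
    unfolding c0 by (simp add: algebra_simps)
  also have "\<bar>\<dots>\<bar> \<le> \<bar>I4 \<kappa> phi\<bar> * (B^4 * \<bar>?S - C\<bar>) + \<bar>C\<bar> * (B^4 * \<bar>I4 \<kappa> phi - singular_S\<bar>)"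
    by (rule order_trans[OF abs_triangle_ineq]) (use B1 in \<open>simp add: abs_mult\<close>)
  also have "\<dots> \<le> (\<bar>singular_S\<bar> + 64) * (B^4 * (2 / (y^5 / 2))) + \<bar>C\<bar> * (B^4 * (64 * sqrt \<kappa>))"
    using I I' S B1 by (intro add_mono mult_mono mult_nonneg_nonneg order_refl) auto
  finally have E3: "\<bar>B^4 * I4 \<kappa> phi * ?S - c0 * B^4\<bar> \<le> (\<bar>singular_S\<bar> + 64) * ((y^25)^4 * (2 / (y^5 / 2)))
     + \<bar>13 * zeta 2 / (14 * zeta 3)\<bar> * ((y^25)^4 * (64 * sqrt (1 / y^2)))"
    unfolding C_def \<kappa>_def B_def .
  have B2: "B^2 = y^50" "B^4 = y^100" unfolding B_def by (simp_all flip: power_mult)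
  have chain: "\<bar>w - c\<bar> \<le> e1 + e2 + (e3 + e4)" if "\<bar>w - m\<bar> \<le> e1" "\<bar>m - s\<bar> \<le> e2" "\<bar>s - c\<bar> \<le> e3 + e4" for w m s c e1 e2 e3 e4 :: real
    using that by linarith
  show ?thesis using chain[OF E1 E2 E3] unfolding B2 err_def by (simp only: add.assoc)
qed

text \<open>The small q_i, the exceptional triples, the boundaries and the cut-off of the singular
  integral all reach the exponent 99; the tail in G gives 97, the Riemann sums 91 and the tail of
  the series 95. The constant is 383547 = 25600 + 152832 + 194560 + 10555.\<close>

lemma err_le:
  fixes y :: real
  assumes y: "y \<ge> 1" and b: "b \<ge> 0"
  shows "err b c y \<le> (383547 + 4 * b + 64 * c) * y^99"
proof -
  have mono: "a * y^k \<le> a * y^99" if "a \<ge> 0" "k \<le> 99" for a k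
    using that y by (intro mult_left_mono power_increasing) auto
  have "sqrt (y^23) * sqrt (2 * y^25) = sqrt (2 * (y^24)^2)"
    by (simp flip: real_sqrt_mult power_mult power_add)
  also have "\<dots> = sqrt 2 * y^24" unfolding real_sqrt_mult real_sqrt_abs using y by simp
  also have "\<dots> \<le> 2 * y^24" using y sqrt2_less_2 by (intro mult_right_mono) auto
  finally have "1600 * (2 * y^25)^3 * (sqrt (y^23) * sqrt (2 * y^25)) \<le> 1600 * (2 * y^25)^3 * (2 * y^24)"
    using y by (intro mult_left_mono) auto
  also have "\<dots> = 25600 * y^99" by (simp add: power_mult_distrib flip: power_mult power_add)
  finally have 1: "1600 * (2 * y^25)^3 * (sqrt (y^23) * sqrt (2 * y^25)) \<le> 25600 * y^99" .
  have "24 * (2 * y^25)^2 / y^23 * (189 * y^5 * (y^5)^3 * (2 * y^25)^3 / y^23 + 5 * (2 * y^25)^3 / (y^5 / 2))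
      = 145152 * y^99 + 7680 * y^97"
    using y by (simp add: field_simps flip: power_mult power_add)
  also have "\<dots> \<le> 152832 * y^99" using mono[of 7680 97] by simp
  finally have 2: "24 * (2 * y^25)^2 / y^23 * (189 * y^5 * (y^5)^3 * (2 * y^25)^3 / y^23 + 5 * (2 * y^25)^3 / (y^5 / 2))
      \<le> 152832 * y^99" .
  have 3: "1520 * (2 * y^25)^6 / (y^5 / 2 * (y^23)^2) = 194560 * y^99"
    using y by (simp add: field_simps flip: power_mult power_add)
  have "7995 * (y^5)^2 * (y^25)^3 / (1 / y^2)^3 + 1280 * (y^25)^4 / (1 / y^2 * (y^5 / 2)) = 7995 * y^91 + 2560 * y^97"
    using y by (simp add: field_simps flip: power_mult power_add)
  also have "\<dots> \<le> 10555 * y^99" using mono[of 7995 91] mono[of 2560 97] by simp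
  finally have 4: "7995 * (y^5)^2 * (y^25)^3 / (1 / y^2)^3 + 1280 * (y^25)^4 / (1 / y^2 * (y^5 / 2)) \<le> 10555 * y^99" .
  have "b * ((y^25)^4 * (2 / (y^5 / 2))) = 4 * b * y^95"
    using y by (simp add: field_simps flip: power_mult power_add)
  also have "\<dots> \<le> 4 * b * y^99" using b by (intro mono) auto
  finally have 5: "b * ((y^25)^4 * (2 / (y^5 / 2))) \<le> 4 * b * y^99" .
  have 6: "c * ((y^25)^4 * (64 * sqrt (1 / y^2))) = 64 * c * y^99"
    using y by (simp add: real_sqrt_divide field_simps flip: power_mult power_add power_Suc)
  show ?thesis using 1 2 4 5 unfolding err_def 3 6 by (simp only: distrib_right)
qed

theorem mainTheorem1:
  fixes \<epsilon> :: real
  assumes "0 < \<epsilon>" and "\<epsilon> < 1/54"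
  shows "(\<lambda>x. W x - c0 * x^2) \<in> O[at_top](\<lambda>x. x powr (2 - 1/54 + \<epsilon>))"
proof -
  define c where "c = 383547 + 4 * (\<bar>singular_S\<bar> + 64) + 64 * \<bar>13 * zeta 2 / (14 * zeta 3)\<bar>"
  have c0: "c \<ge> 0" unfolding c_def by simp
  have bound: "\<bar>W x - c0 * x^2\<bar> \<le> c * x powr (2 - 1/54 + \<epsilon>)" if "x \<ge> 2^50" for x
  proof -
    have x: "x \<ge> 1" "x > 0" using that one_le_power[of "2::real" 50] by linarith+
    define y where "y = x powr (1/50)"
    have p: "y^k = x powr (real k / 50)" for k
      unfolding y_def using x by (simp add: powr_powr flip: powr_realpow)
    have p50: "y^50 = x" "y^100 = x^2" unfolding p using x by (simp_all add: powr_numeral)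
    have y0: "y > 0" unfolding y_def using x by simp
    have "y \<ge> 2" using that p50(1) y0 power_mono_iff[of 2 y 50] by simp
    then have "\<bar>W (y^50) - c0 * y^100\<bar> \<le> err (\<bar>singular_S\<bar> + 64) \<bar>13 * zeta 2 / (14 * zeta 3)\<bar> y"
      by (rule W_quantitative)
    also have "\<dots> \<le> c * y^99" unfolding c_def using \<open>y \<ge> 2\<close> by (intro err_le) auto
    \<comment> \<open>Here y^99 = x powr (99/50), and 99/50 = 2 - 1/50 lies below 2 - 1/54.\<close>
    also have "\<dots> \<le> c * x powr (2 - 1/54 + \<epsilon>)"
      unfolding p using assms x c0 by (intro mult_left_mono powr_mono) auto
    finally show ?thesis unfolding p50 .
  qed
  show ?thesis
    by (rule bigoI[of _ c], rule eventually_mono[OF eventually_ge_at_top[of "2^50"]]) (use bound in simp)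
qed

end
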